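(* Let $\mathcal P$ be a frame polyomino and $K$ a field. Then the $h$-polynomial of $K[\mathcal P]$ is equal to the switching rook polynomial $\tilde r_{\mathcal P}(t)$ of $\mathcal P$.
   Context: Intervals and cells. For $a=(i,j),b=(k,l)\in\mathbb Z^2$ write $a\le b$ if $i\le k$ and $j\le l$; for $a\le b$ the interval is $[a,b]=\{(p,q)\in\mathbb Z^2: i\le p\le k,\ j\le q\le l\}$. It is proper if $i<k$ and $j<l$; then $a,b$ are its diagonal corners and $(i,l),(k,j)$ its anti-diagonal corners. A cell is an interval $[a,a+(1,1)]$; its four elements are its vertices, its lower right corner is $a+(1,0)$, and its edges are the four unit segments on its boundary. A polyomino $\mathcal P$ is a finite nonempty set of cells such that any two of its cells are joined by a sequence of cells of $\mathcal P$ with consecutive cells sharing an edge. $V(\mathcal P)$ is the union of the vertex sets of its cells. For an interval $J$, $\mathcal P_J$ denotes the set of cells contained in $J$. A proper interval $[a,b]$ is an inner interval of $\mathcal P$ if all cells contained in $[a,b]$ belong to $\mathcal P$; the two cells of $\mathcal P_{[a,b]}$ containing $a$ resp. $b$ are its diagonal cells, and the two containing its anti-diagonal corners are its anti-diagonal cells. Polyomino ideal. $S_{\mathcal P}=K[x_v:v\in V(\mathcal P)]$; $I_{\mathcal P}$ is the ideal generated by all binomials $x_ax_b-x_cx_d$ with $[a,b]$ an inner interval of $\mathcal P$ with anti-diagonal corners $c,d$; $K[\mathcal P]=S_{\mathcal P}/I_{\mathcal P}$, standard graded. Its $h$-polynomial is the unique $h(t)\in\mathbb Z[t]$ with $h(1)\neq0$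 and $\sum_k \dim_K K[\mathcal P]_k\,t^k=h(t)/(1-t)^d$, $d=\dim K[\mathcal P]$. Frame polyominoes. A north-east path is a sequence of points of $\mathbb Z^2$ whose consecutive differences are $(1,0)$ or $(0,1)$. For two such paths $S_1:(a_0,b_0),\dots,(a_k,b_k)$ and $S_2:(c_0,d_0),\dots,(c_k,d_k)$ with $(a_0,b_0)=(c_0,d_0)$, $(a_k,b_k)=(c_k,d_k)$, $S_1$ lies above $S_2$ if $b_i>d_j$ whenever $a_i=c_j$ with $1\le i,j\le k-1$; the parallelogram polyomino determined by $S_1,S_2$ is then the set of cells in the region bounded above by $S_1$ and below by $S_2$. Let $I=[(1,1),(m,n)]$ and let $\mathcal S$ be a parallelogram polyomino determined by such $S_1,S_2$ whose endpoints satisfy $1<a_0<a_k<m$, $1<b_0<b_k<n$. The frame polyomino is $\mathcal P=\mathcal P_I\setminus\mathcal S$. Rooks. Two distinct cells $A,B$ of $\mathcal P$ are in attacking position if their lower left corners lie on a common horizontal or vertical line and all cells of the cell interval between them (the cells whose lower left corners lie on the segment joining those of $A$ and $B$) belong to $\mathcal P$. A $k$-rook configuration is a set of $k$ cells of $\mathcal P$ (rooks) pairwise not in attacking position; the rook number $r_{\mathcal P}$ is the maximal such $k$. Two rooks of a configuration are switching if they are the two diagonal cells (diagonal position) or the two anti-diagonal cells (anti-diagonal position) of some inner interval of $\mathcal P$; a switch replaces them by the other pair of corner cells of that interval. Let $\sim$ be the equivalence relation on $k$-rook configurations generated by switches, $\tilde r_k$ the number of equivalence classes of $k$-rook configurations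 ($\tilde r_0=1$), and $\tilde r_{\mathcal P}(t)=\sum_{k=0}^{r_{\mathcal P}}\tilde r_kt^k$ the switching rook polynomial. *)

theory Defs
  imports
    "HOL-Algebra.Embedded_Algebras"
    "HOL-Library.Poly_Mapping"
    "HOL-Library.Extended_Nat"
    "HOL-Computational_Algebra.Polynomial_FPS"
begin

section \<open>Intervals, cells and polyominoes\<close>

type_synonym point = "int \<times> int"

text \<open>A cell \<open>[a, a + (1,1)]\<close> is represented by its lower left corner \<open>a\<close>.\<close>

type_synonym cell = "int \<times> int"

text \<open>The interval \<open>[a, b]\<close> for the componentwise order (empty unless \<open>a \<le> b\<close>).\<close>

definition interval :: "point \<Rightarrow> point \<Rightarrow> point set" where
  "interval a b = {fst a..fst b} \<times> {snd a..snd b}"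

definition proper_corners :: "point \<Rightarrow> point \<Rightarrow> bool" where
  "proper_corners a b \<longleftrightarrow> fst a < fst b \<and> snd a < snd b"

definition cell_vertices :: "cell \<Rightarrow> point set" where
  "cell_vertices c = interval c (fst c + 1, snd c + 1)"

definition cell_edges :: "cell \<Rightarrow> point set set" where
  "cell_edges c =
    (let p = fst c; q = snd c in
      {{(p, q), (p + 1, q)}, {(p, q + 1), (p + 1, q + 1)},
       {(p, q), (p, q + 1)}, {(p + 1, q), (p + 1, q + 1)}})"

definition polyomino :: "cell set \<Rightarrow> bool" where
  "polyomino P \<longleftrightarrow> finite P \<and> P \<noteq> {} \<and>
    (\<forall>A\<in>P. \<forall>B\<in>P.
      (A, B) \<in> {(C, D). C \<in> P \<and> D \<in> P \<and> cell_edges C \<inter> cell_edges D \<noteq> {}}\<^sup>*)"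

definition vertex_set :: "cell set \<Rightarrow> point set" where
  "vertex_set P = (\<Union>c\<in>P. cell_vertices c)"

definition cells_in :: "point set \<Rightarrow> cell set" where
  "cells_in J = {c. cell_vertices c \<subseteq> J}"

definition inner_interval :: "cell set \<Rightarrow> point \<Rightarrow> point \<Rightarrow> bool" where
  "inner_interval P a b \<longleftrightarrow> proper_corners a b \<and> cells_in (interval a b) \<subseteq> P"

text \<open>The cells of \<open>[a, b]\<close> containing \<open>a\<close>, \<open>b\<close> and, respectively, the anti-diagonal
  corners \<open>(i, l)\<close>, \<open>(k, j)\<close> where \<open>a = (i, j)\<close> and \<open>b = (k, l)\<close>.\<close>

definition diagonal_cells :: "point \<Rightarrow> point \<Rightarrow> cell set" where
  "diagonal_cells a b = {(fst a, snd a), (fst b - 1, snd b - 1)}"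

definition antidiagonal_cells :: "point \<Rightarrow> point \<Rightarrow> cell set" where
  "antidiagonal_cells a b = {(fst a, snd b - 1), (fst b - 1, snd a)}"


section \<open>The coordinate ring of a polyomino and its \<open>h\<close>-polynomial\<close>

type_synonym 'k mpoly = "(point \<Rightarrow>\<^sub>0 nat) \<Rightarrow>\<^sub>0 'k"

text \<open>The polynomial ring \<open>K[x\<^sub>v : v \<in> V]\<close>, with \<open>K\<close> the field type \<open>'k\<close>.\<close>

definition mpoly_ring :: "point set \<Rightarrow> 'k::field mpoly ring" where
  "mpoly_ring V =
    \<lparr>carrier = {p. \<forall>m\<in>Poly_Mapping.keys p. Poly_Mapping.keys m \<subseteq> V},
     monoid.mult = (*), one = 1, zero = 0, add = (+)\<rparr>"

definition const :: "'k::field \<Rightarrow> 'k mpoly" where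
  "const c = Poly_Mapping.single 0 c"

definition var :: "point \<Rightarrow> 'k::field mpoly" where
  "var v = Poly_Mapping.single (Poly_Mapping.single v 1) 1"

definition homogeneous :: "nat \<Rightarrow> 'k::field mpoly \<Rightarrow> bool" where
  "homogeneous k p \<longleftrightarrow>
    (\<forall>m\<in>Poly_Mapping.keys p. (\<Sum>v\<in>Poly_Mapping.keys m. Poly_Mapping.lookup m v) = k)"

definition inner_binomials :: "cell set \<Rightarrow> 'k::field mpoly set" where
  "inner_binomials P =
    {var a * var b - var (fst a, snd b) * var (fst b, snd a) | a b. inner_interval P a b}"

definition polyomino_ideal :: "cell set \<Rightarrow> 'k::field mpoly set" where
  "polyomino_ideal P = Idl\<^bsub>mpoly_ring (vertex_set P)\<^esub> (inner_binomials P)"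

definition coord_ring :: "cell set \<Rightarrow> 'k::field mpoly set ring" where
  "coord_ring P = mpoly_ring (vertex_set P) Quot polyomino_ideal P"

definition residue_class :: "cell set \<Rightarrow> 'k::field mpoly \<Rightarrow> 'k mpoly set" where
  "residue_class P f = polyomino_ideal P +>\<^bsub>mpoly_ring (vertex_set P)\<^esub> f"

text \<open>The copy of \<open>K\<close> inside \<open>K[P]\<close>, over which dimensions are taken.\<close>

definition coord_ring_scalars :: "cell set \<Rightarrow> 'k::field mpoly set set" where
  "coord_ring_scalars P = residue_class P ` range const"

definition coord_ring_component :: "cell set \<Rightarrow> nat \<Rightarrow> 'k::field mpoly set set" where
  "coord_ring_component P k =
    residue_class P ` {f \<in> carrier (mpoly_ring (vertex_set P)). homogeneous k f}"

definition hilbert_function :: "'k::field itself \<Rightarrow> cell set \<Rightarrow> nat \<Rightarrow> nat" where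
  "hilbert_function _ P k =
    ring.dim (coord_ring P) (coord_ring_scalars P) (coord_ring_component P k :: 'k mpoly set set)"

definition hilbert_series :: "'k::field itself \<Rightarrow> cell set \<Rightarrow> int fps" where
  "hilbert_series K P = Abs_fps (\<lambda>k. int (hilbert_function K P k))"

definition krull_dim :: "('a, 'b) ring_scheme \<Rightarrow> enat" where
  "krull_dim R = (SUP n \<in> {n. \<exists>C :: nat \<Rightarrow> 'a set.
      (\<forall>i\<le>n. primeideal (C i) R) \<and> (\<forall>i<n. C i \<subset> C (Suc i))}. enat n)"

text \<open>The defining property of the \<open>h\<close>-polynomial, with \<open>d = dim K[P]\<close> and the denominator
  \<open>(1 - t)\<^sup>d\<close> (a unit of \<open>\<int>[[t]]\<close>) cleared.\<close>

definition is_h_polynomial :: "'k::field itself \<Rightarrow> cell set \<Rightarrow> int poly \<Rightarrow> bool" where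
  "is_h_polynomial K P h \<longleftrightarrow> poly h 1 \<noteq> 0 \<and>
    (\<exists>d. krull_dim (coord_ring P :: 'k mpoly set ring) = enat d \<and>
         hilbert_series K P * (1 - fps_X) ^ d = fps_of_poly h)"

lemma is_h_polynomial_unique:
  assumes "is_h_polynomial K P h" "is_h_polynomial K P h'"
  shows "h = h'"
  using assms unfolding is_h_polynomial_def by (metis enat.inject fps_of_poly_eq_iff)

text \<open>The library specifies \<open>ring.dim\<close> only for rings; \<open>coord_ring P\<close> is one.\<close>

lemma cring_mpoly_ring: "cring (mpoly_ring V :: 'k::field mpoly ring)"
proof (rule cringI)
  let ?R = "mpoly_ring V :: 'k mpoly ring"
  have add: "x + y \<in> carrier ?R" if "x \<in> carrier ?R" "y \<in> carrier ?R" for x y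
    using that Poly_Mapping.keys_add[of x y] unfolding mpoly_ring_def by simp blast
  have neg: "- x \<in> carrier ?R" if "x \<in> carrier ?R" for x
    using that unfolding mpoly_ring_def by simp
  have mult: "x * y \<in> carrier ?R" if x: "x \<in> carrier ?R" and y: "y \<in> carrier ?R" for x y
    unfolding mpoly_ring_def
  proof (clarsimp)
    fix m a b assume m: "m \<in> Poly_Mapping.keys (x * y)" and v: "(a, b) \<in> Poly_Mapping.keys m"
    obtain s t where st: "s \<in> Poly_Mapping.keys x" "t \<in> Poly_Mapping.keys y" "m = s + t"
      using m keys_mult[of x y] by blast
    have "(a, b) \<in> Poly_Mapping.keys s \<union> Poly_Mapping.keys t"
      using v st(3) Poly_Mapping.keys_add[of s t] by blast
    moreover have "Poly_Mapping.keys s \<subseteq> V" "Poly_Mapping.keys t \<subseteq> V"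
      using x y st(1,2) by (simp_all add: mpoly_ring_def)
    ultimately show "(a, b) \<in> V"
      by blast
  qed
  show "abelian_group ?R"
  proof (rule abelian_groupI)
    fix x y assume "x \<in> carrier ?R" "y \<in> carrier ?R"
    from add[OF this] show "x \<oplus>\<^bsub>?R\<^esub> y \<in> carrier ?R"
      by (simp add: mpoly_ring_def)
  next
    fix x assume x: "x \<in> carrier ?R"
    show "\<exists>y\<in>carrier ?R. y \<oplus>\<^bsub>?R\<^esub> x = \<zero>\<^bsub>?R\<^esub>"
      using neg[OF x] by (intro bexI[of _ "- x"]) (simp_all add: mpoly_ring_def)
  qed (simp_all add: mpoly_ring_def ac_simps)
  show "Group.comm_monoid ?R"
  proof (rule comm_monoidI)
    fix x y assume "x \<in> carrier ?R" "y \<in> carrier ?R"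
    from mult[OF this] show "x \<otimes>\<^bsub>?R\<^esub> y \<in> carrier ?R"
      by (simp add: mpoly_ring_def)
  qed (simp_all add: mpoly_ring_def ac_simps)
  fix x y z
  show "(x \<oplus>\<^bsub>?R\<^esub> y) \<otimes>\<^bsub>?R\<^esub> z = x \<otimes>\<^bsub>?R\<^esub> z \<oplus>\<^bsub>?R\<^esub> y \<otimes>\<^bsub>?R\<^esub> z"
    by (simp add: mpoly_ring_def distrib_right)
qed

lemma inner_binomials_in_carrier:
  "inner_binomials P \<subseteq> carrier (mpoly_ring (vertex_set P) :: 'k::field mpoly ring)"
proof
  fix f :: "'k mpoly" assume "f \<in> inner_binomials P"
  then obtain a b where ab: "inner_interval P a b"
    and f: "f = var a * var b - var (fst a, snd b) * var (fst b, snd a)"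
    unfolding inner_binomials_def by blast
  obtain i j k l where [simp]: "a = (i, j)" "b = (k, l)" by (cases a, cases b)
  have lt: "i < k" "j < l" and sub: "cells_in (interval a b) \<subseteq> P"
    using ab unfolding inner_interval_def proper_corners_def by auto
  have c: "{(i, j), (i, l - 1), (k - 1, j), (k - 1, l - 1)} \<subseteq> P"
    using lt by (intro subset_trans[OF _ sub])
      (auto simp: cells_in_def cell_vertices_def interval_def)
  have vs: "w \<in> vertex_set P" if "e \<in> P" "w \<in> cell_vertices e" for e w
    using that unfolding vertex_set_def by blast
  have v: "(i, j) \<in> vertex_set P" "(i, l) \<in> vertex_set P"
    "(k, j) \<in> vertex_set P" "(k, l) \<in> vertex_set P"
    using c vs[of "(i, j)" "(i, j)"] vs[of "(i, l - 1)" "(i, l)"] vs[of "(k - 1, j)" "(k, j)"]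
      vs[of "(k - 1, l - 1)" "(k, l)"]
    by (simp_all add: cell_vertices_def interval_def)
  let ?R = "mpoly_ring (vertex_set P) :: 'k mpoly ring"
  interpret cring ?R by (rule cring_mpoly_ring)
  have var: "var w \<in> carrier ?R" if "w \<in> vertex_set P" for w
    using that by (simp add: var_def mpoly_ring_def)
  have m: "var w * var u \<in> carrier ?R" if "w \<in> vertex_set P" "u \<in> vertex_set P" for w u
    using m_closed[OF var[OF that(1)] var[OF that(2)]] by (simp add: mpoly_ring_def)
  have "x - y \<in> carrier ?R" if "x \<in> carrier ?R" "y \<in> carrier ?R" for x y
    using that Poly_Mapping.keys_diff[of x y] unfolding mpoly_ring_def by simp blast
  then show "f \<in> carrier ?R"
    using v by (simp add: f m)
qed

lemma cring_coord_ring: "cring (coord_ring P :: 'k::field mpoly set ring)"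
proof -
  let ?R = "mpoly_ring (vertex_set P) :: 'k mpoly ring"
  interpret cring ?R by (rule cring_mpoly_ring)
  have "ideal (polyomino_ideal P) ?R"
    unfolding polyomino_ideal_def by (rule genideal_ideal[OF inner_binomials_in_carrier])
  then show ?thesis
    unfolding coord_ring_def by (rule ideal.quotient_is_cring) (rule cring_mpoly_ring)
qed


section \<open>Frame polyominoes\<close>

definition north_east_path :: "point list \<Rightarrow> bool" where
  "north_east_path S \<longleftrightarrow> S \<noteq> [] \<and>
    (\<forall>i. Suc i < length S \<longrightarrow>
      (fst (S ! Suc i) - fst (S ! i), snd (S ! Suc i) - snd (S ! i)) \<in> {(1, 0), (0, 1)})"

text \<open>For paths with the \<open>k + 1\<close> points numbered \<open>0, \<dots>, k\<close>, where \<open>k = length S - 1\<close>.\<close>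

definition lies_above :: "point list \<Rightarrow> point list \<Rightarrow> bool" where
  "lies_above S1 S2 \<longleftrightarrow>
    (\<forall>i j. 1 \<le> i \<and> i < length S1 - 1 \<and> 1 \<le> j \<and> j < length S2 - 1 \<and> fst (S1 ! i) = fst (S2 ! j)
      \<longrightarrow> snd (S1 ! i) > snd (S2 ! j))"

definition east_step :: "point list \<Rightarrow> int \<Rightarrow> int \<Rightarrow> bool" where
  "east_step S p y \<longleftrightarrow> (\<exists>i. Suc i < length S \<and> S ! i = (p, y) \<and> S ! Suc i = (p + 1, y))"

text \<open>Over each column \<open>[p, p + 1]\<close> between its end points a north-east path has exactly one
  east step; the cell \<open>(p, q)\<close> is in the region when it lies below the east step of the
  upper path and above that of the lower path.\<close>

definition region_between :: "point list \<Rightarrow> point list \<Rightarrow> cell set" where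
  "region_between S1 S2 = {(p, q).
    \<exists>y1 y2. east_step S1 p y1 \<and> east_step S2 p y2 \<and> y2 \<le> q \<and> q + 1 \<le> y1}"

text \<open>\<open>polyomino S\<close> only excludes a degenerate pair: if the end points are one column apart,
  the condition \<open>lies_above\<close> is also met (vacuously) when \<open>S1\<close> goes first east and then north
  and \<open>S2\<close> first north and then east, and no cell lies below \<open>S1\<close> and above \<open>S2\<close>.\<close>

definition parallelogram_polyomino :: "point list \<Rightarrow> point list \<Rightarrow> cell set \<Rightarrow> bool" where
  "parallelogram_polyomino S1 S2 S \<longleftrightarrow>
    north_east_path S1 \<and> north_east_path S2 \<and> length S1 = length S2 \<and>
    hd S1 = hd S2 \<and> last S1 = last S2 \<and> lies_above S1 S2 \<and>
    S = region_between S1 S2 \<and> polyomino S"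

definition frame_polyomino :: "cell set \<Rightarrow> bool" where
  "frame_polyomino P \<longleftrightarrow>
    (\<exists>m n S1 S2 S. parallelogram_polyomino S1 S2 S \<and>
      1 < fst (hd S1) \<and> fst (hd S1) < fst (last S1) \<and> fst (last S1) < m \<and>
      1 < snd (hd S1) \<and> snd (hd S1) < snd (last S1) \<and> snd (last S1) < n \<and>
      P = cells_in (interval (1, 1) (m, n)) - S)"


section \<open>Rook configurations and the switching rook polynomial\<close>

text \<open>When \<open>A\<close> and \<open>B\<close> share a coordinate, the interval below is the segment joining them.\<close>

definition attacking :: "cell set \<Rightarrow> cell \<Rightarrow> cell \<Rightarrow> bool" where
  "attacking P A B \<longleftrightarrow> A \<noteq> B \<and> (fst A = fst B \<or> snd A = snd B) \<and>
    interval (min (fst A) (fst B), min (snd A) (snd B)) (max (fst A) (fst B), max (snd A) (snd B)) \<subseteq> P"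

definition rook_configs :: "cell set \<Rightarrow> nat \<Rightarrow> cell set set" where
  "rook_configs P k =
    {C. C \<subseteq> P \<and> finite C \<and> card C = k \<and> (\<forall>A\<in>C. \<forall>B\<in>C. \<not> attacking P A B)}"

definition rook_number :: "cell set \<Rightarrow> nat" where
  "rook_number P = Max {k. rook_configs P k \<noteq> {}}"

definition switch :: "cell set \<Rightarrow> nat \<Rightarrow> cell set \<Rightarrow> cell set \<Rightarrow> bool" where
  "switch P k C D \<longleftrightarrow> C \<in> rook_configs P k \<and> D \<in> rook_configs P k \<and>
    (\<exists>a b. inner_interval P a b \<and> (\<exists>X Y.
      (X, Y) \<in> {(diagonal_cells a b, antidiagonal_cells a b),
                (antidiagonal_cells a b, diagonal_cells a b)} \<and>
      card X = 2 \<and> X \<subseteq> C \<and> D = (C - X) \<union> Y))"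

definition switch_equivalence :: "cell set \<Rightarrow> nat \<Rightarrow> (cell set \<times> cell set) set" where
  "switch_equivalence P k =
    {(C, D). C \<in> rook_configs P k \<and> D \<in> rook_configs P k \<and> equivclp (switch P k) C D}"

definition switching_rook_count :: "cell set \<Rightarrow> nat \<Rightarrow> nat" where
  "switching_rook_count P k = card (rook_configs P k // switch_equivalence P k)"

definition switching_rook_poly :: "cell set \<Rightarrow> int poly" where
  "switching_rook_poly P =
    (\<Sum>k\<le>rook_number P. Polynomial.monom (int (switching_rook_count P k)) k)"

end

theory Submission
  imports Defs "HOL-Library.Product_Lexorder"
begin

text \<open>
  The vertices of a frame polyomino fall into four regions: \<open>A\<close> (weakly south-west of the hole's
  first corner), \<open>B\<close> (weakly north-east of its last corner), \<open>U\<close> above and \<open>L\<close> below the hole.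
  For \<open>u\<close> strictly north-west of \<open>v\<close>, the rectangle spanned by them meets the hole iff \<open>u \<in> U\<close>
  and \<open>v \<in> L\<close>. Rewriting anti-diagonal pairs of inner intervals into diagonal ones therefore ends
  in multisets that are chains on \<open>A \<union> U \<union> B\<close> and on \<open>A \<union> L \<union> B\<close>. Such a normal multiset is
  determined by the row and column counts of \<open>A \<union> U\<close>, \<open>A \<union> L\<close>, \<open>U \<union> B\<close>, \<open>L \<union> B\<close> and the sizes of
  its parts in \<open>A\<close> and \<open>B\<close>, all of which are additive and invariant under the rewriting. Hence the
  polyomino ideal is the kernel of a monomial map, the Hilbert function counts normal multisets, and
  the series is the clique polynomial of a graph on the vertices at \<open>t / (1 - t)\<close>. The cells
  carry the same structure with strict chains, so switching classes of rook configurations are the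
  cliques of a graph on the cells. The two clique polynomials are matched by deleting
  vertices one at a time, each paired with the cell of which it is the north-west corner (the
  south-east corner for \<open>L\<close>); the vertices left without a cell form a facet.

  The Krull dimension is bounded below by a chain of kernels of monomial maps, obtained by setting
  one more weight coordinate to 1 at each step, and above by comparing the growth of the Hilbert
  function with the number of monomials in elements separating consecutive primes of a chain.
\<close>

section \<open>Clique polynomials\<close>

text \<open>The cliques of the two graphs are not matched one by one. At \<open>t / (1 - t)\<close>
  a vertex joined to all others contributes the factor \<open>1 / (1 - t)\<close>, and a vertex
  whose neighbourhood has dimension one lower contributes \<open>t\<close> times the polynomial of
  that neighbourhood, just as a cell does. It therefore suffices to delete vertices in an order in
  which the neighbourhoods of a vertex and of its cell again form a matching pair of the same kind.
  The hole dictates that kind: a vertex of \<open>U\<close> cuts off columns of \<open>A\<close> and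
  rows of \<open>B\<close>, a vertex of \<open>L\<close> cuts off rows of \<open>A\<close> and
  columns of \<open>B\<close>, while \<open>U\<close> and \<open>L\<close> do not interact. Hence
  the identity is proved for corners truncated in all four directions; \<open>U\<close> is added to
  truncated corners, and \<open>L\<close>, with the axes exchanged, to the result.\<close>

definition cliques :: "('a \<Rightarrow> 'a \<Rightarrow> bool) \<Rightarrow> 'a set \<Rightarrow> 'a set set" where
  "cliques g W = {F. F \<subseteq> W \<and> (\<forall>x\<in>F. \<forall>y\<in>F. x \<noteq> y \<longrightarrow> g x y)}"

definition clique_poly :: "('a \<Rightarrow> 'a \<Rightarrow> bool) \<Rightarrow> 'a set \<Rightarrow> 'r::comm_ring_1 \<Rightarrow> 'r" where
  "clique_poly g W z = (\<Sum>F\<in>cliques g W. z ^ card F)"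

lemma finite_cliques: "finite W \<Longrightarrow> finite (cliques g W)"
  unfolding cliques_def by simp

lemma clique_poly_empty [simp]: "clique_poly g {} z = 1"
proof -
  have "cliques g {} = {{}}" unfolding cliques_def by auto
  then show ?thesis unfolding clique_poly_def by simp
qed

text \<open>A clique either avoids \<open>v\<close> or consists of \<open>v\<close> and a clique
  among its neighbours. All steps that add a vertex or a cell to a balanced pair rest on this
  recursion.\<close>

lemma clique_poly_insert:
  assumes fin: "finite W" and v: "v \<notin> W" and sym: "symp g"
  shows "clique_poly g (insert v W) z = clique_poly g W z + z * clique_poly g {x\<in>W. g v x} z"
proof -
  let ?N = "{x\<in>W. g v x}"
  have split: "cliques g (insert v W) = cliques g W \<union> insert v ` cliques g ?N"
  proof (intro equalityI subsetI)
    fix F assume F: "F \<in> cliques g (insert v W)"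
    show "F \<in> cliques g W \<union> insert v ` cliques g ?N"
    proof (cases "v \<in> F")
      case True
      then have "F = insert v (F - {v})" "F - {v} \<in> cliques g ?N"
        using F unfolding cliques_def by auto
      then show ?thesis by blast
    next
      case False
      then show ?thesis using F unfolding cliques_def by auto
    qed
  next
    fix F assume "F \<in> cliques g W \<union> insert v ` cliques g ?N"
    then show "F \<in> cliques g (insert v W)"
      using sym unfolding cliques_def symp_def by auto
  qed
  have inj: "inj_on (insert v) (cliques g ?N)"
  proof (rule inj_onI)
    fix F F' assume "F \<in> cliques g ?N" "F' \<in> cliques g ?N" and eq: "insert v F = insert v F'"
    then have "v \<notin> F" "v \<notin> F'" using v unfolding cliques_def by auto
    then show "F = F'" using insert_ident eq by metis
  qed
  have "clique_poly g (insert v W) z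
      = clique_poly g W z + (\<Sum>F\<in>insert v ` cliques g ?N. z ^ card F)"
    unfolding clique_poly_def split
    by (rule sum.union_disjoint) (use fin v in \<open>auto simp: finite_cliques cliques_def\<close>)
  also have "(\<Sum>F\<in>insert v ` cliques g ?N. z ^ card F) = (\<Sum>F\<in>cliques g ?N. z * z ^ card F)"
  proof (subst sum.reindex[OF inj], rule sum.cong)
    fix F assume "F \<in> cliques g ?N"
    then have "finite F" "v \<notin> F"
      using fin v finite_subset[of F W] unfolding cliques_def by auto
    then show "((\<lambda>F. z ^ card F) \<circ> insert v) F = z * z ^ card F" by simp
  qed simp
  finally show ?thesis unfolding clique_poly_def by (simp add: sum_distrib_left)
qed

lemma clique_poly_join:
  assumes fin: "finite W" "finite W'" and disj: "W \<inter> W' = {}" and sym: "symp g"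
    and adj: "\<And>x y. x \<in> W \<Longrightarrow> y \<in> W' \<Longrightarrow> g x y"
  shows "clique_poly g (W \<union> W') z = clique_poly g W z * clique_poly g W' z"
  using fin(1) disj adj
\<comment> \<open>The induction is on the cardinality because the recursion needs two smaller sets,
  one of which, the neighbourhood of \<open>v\<close>, is an arbitrary subset.\<close>
proof (induction "card W" arbitrary: W rule: less_induct)
  case less
  show ?case
  proof (cases "W = {}")
    case False
    then obtain v V where W: "W = insert v V" "v \<notin> V" by (meson mk_disjoint_insert ex_in_conv)
    have N: "{x \<in> V \<union> W'. g v x} = {x \<in> V. g v x} \<union> W'"
      using less.prems(3) W by auto
    have finV: "finite V" using less.prems(1) W by simp
    have card: "card V < card W" "card {x \<in> V. g v x} < card W"
      using W finV card_mono[of V "{x \<in> V. g v x}"] by auto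
    have 1: "clique_poly g (V \<union> W') z = clique_poly g V z * clique_poly g W' z"
      by (rule less.hyps) (use less.prems W card in auto)
    have 2: "clique_poly g ({x \<in> V. g v x} \<union> W') z
        = clique_poly g {x \<in> V. g v x} z * clique_poly g W' z"
      by (rule less.hyps) (use less.prems W card finV in auto)
    have vn: "v \<notin> V \<union> W'" using W less.prems(2) by auto
    have "W \<union> W' = insert v (V \<union> W')" using W by auto
    then have "clique_poly g (W \<union> W') z
        = clique_poly g (V \<union> W') z + z * clique_poly g ({x \<in> V. g v x} \<union> W') z"
      using clique_poly_insert[OF _ vn sym] finV fin(2) N by simp
    also have "\<dots> = clique_poly g W z * clique_poly g W' z"
      unfolding W(1) clique_poly_insert[OF finV W(2) sym] 1 2 by (simp add: algebra_simps)
    finally show ?thesis .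
  qed simp
qed

text \<open>\<open>gv\<close> is a graph on vertices and \<open>gc\<close> one on cells. The ring
  stays abstract, with \<open>u\<close> in the role of \<open>1 / (1 - t)\<close>; the Hilbert
  series uses \<open>t = fps_X\<close> and \<open>u = ones\<close> over the integers.\<close>

locale clique_pair =
  fixes gv :: "'a \<Rightarrow> 'a \<Rightarrow> bool" and gc :: "'b \<Rightarrow> 'b \<Rightarrow> bool" and t u :: "'r::comm_ring_1"
  assumes symv: "symp gv" and symc: "symp gc" and unit: "u * (1 - t) = 1"
begin

text \<open>With \<open>u = 1 / (1 - t)\<close> the left-hand side is the Hilbert series of the Stanley-Reisner ring
  of the clique complex on \<open>W\<close>, so \<open>C\<close> computes its \<open>h\<close>-polynomial and \<open>d\<close> is its dimension.\<close>

definition balanced :: "'a set \<Rightarrow> 'b set \<Rightarrow> int \<Rightarrow> bool" where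
  "balanced W C d \<longleftrightarrow> finite W \<and> finite C \<and> 0 \<le> d \<and>
    clique_poly gv W (t * u) = u ^ nat d * clique_poly gc C t"

lemma balanced_empty: "balanced {} {} 0"
  unfolding balanced_def by simp

text \<open>Deletion and link give \<open>u ^ d * C + t * u * u ^ (d - 1) * C'\<close>, that is
  \<open>u ^ d * (C + t * C')\<close>: the dimension drop of the link absorbs the additional factor
  \<open>u\<close>. The vertex \<open>v\<close> and the cell \<open>c\<close> are thus accounted for
  together.\<close>

lemma balanced_shed:
  assumes del: "balanced W C d" and link: "balanced {x\<in>W. gv v x} {x\<in>C. gc c x} (d - 1)"
    and v: "v \<notin> W" and c: "c \<notin> C"
  shows "balanced (insert v W) (insert c C) d"
proof -
  have fin: "finite W" "finite C" and d: "1 \<le> d"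
    using del link unfolding balanced_def by auto
  define e where "e = nat (d - 1)"
  have e: "nat d = Suc e" "nat (d - 1) = e" using d unfolding e_def by auto
  show ?thesis
    using assms fin d unfolding balanced_def
    by (simp add: clique_poly_insert[OF fin(1) v symv] clique_poly_insert[OF fin(2) c symc] e
        algebra_simps)
qed

text \<open>A vertex joined to all others multiplies the clique polynomial by
  \<open>1 + t * u\<close>, which equals \<open>u\<close>; it raises the dimension and takes no
  cell.\<close>

lemma balanced_cone:
  assumes "balanced W C d" and v: "v \<notin> W" and adj: "\<And>x. x \<in> W \<Longrightarrow> gv v x"
  shows "balanced (insert v W) C (d + 1)"
proof -
  have fin: "finite W" and d: "0 \<le> d" using assms unfolding balanced_def by auto
  have N: "{x\<in>W. gv v x} = W" using adj by auto
  have "nat (d + 1) = Suc (nat d)" using d by simp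
  moreover have "1 + t * u = u" using unit by (simp add: algebra_simps)
  then have "clique_poly gv (insert v W) (t * u) = u * clique_poly gv W (t * u)"
    unfolding clique_poly_insert[OF fin v symv] N by (metis distrib_right mult_1)
  ultimately show ?thesis using assms unfolding balanced_def by simp
qed

lemma balanced_cones:
  assumes "balanced W C d" "finite K" "K \<inter> W = {}"
    and "\<And>x y. x \<in> K \<Longrightarrow> y \<in> K \<union> W \<Longrightarrow> x \<noteq> y \<Longrightarrow> gv x y"
  shows "balanced (K \<union> W) C (d + int (card K))"
  using assms(2,1,3,4)
proof (induction K rule: finite_induct)
  case (insert v K)
  have "balanced (K \<union> W) C (d + int (card K))"
    by (rule insert.IH) (use insert.prems in auto)
  then have "balanced (insert v (K \<union> W)) C (d + int (card K) + 1)"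
    by (rule balanced_cone) (use insert.prems insert.hyps in auto)
  then show ?case using insert.hyps by (simp add: algebra_simps)
qed simp

lemma balanced_join:
  assumes "balanced W C d" "balanced W' C' d'"
    and "W \<inter> W' = {}" "C \<inter> C' = {}"
    and "\<And>x y. x \<in> W \<Longrightarrow> y \<in> W' \<Longrightarrow> gv x y" "\<And>x y. x \<in> C \<Longrightarrow> y \<in> C' \<Longrightarrow> gc x y"
  shows "balanced (W \<union> W') (C \<union> C') (d + d')"
  using assms unfolding balanced_def
  by (simp add: clique_poly_join[OF _ _ _ symv] clique_poly_join[OF _ _ _ symc] nat_add_distrib power_add)

text \<open>The vertices of one column are added from the bottom up. Those with
  \<open>s \<le> k\<close> are cone points over \<open>W k\<close>. For larger \<open>s\<close> the
  link of \<open>v s\<close> consists of the vertices below it, all of them cone points, and of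
  \<open>W s\<close>, so \<open>v s\<close> is shed together with \<open>c s\<close>. Each step
  gains one cone point in the link, and \<open>W s\<close> losing one dimension per unit of height
  compensates for it.\<close>

lemma balanced_column:
  fixes j k n :: int and v :: "int \<Rightarrow> 'a" and c :: "int \<Rightarrow> 'b"
  assumes jk: "j - 1 \<le> k" "k \<le> n"
    and bal: "\<And>s. k \<le> s \<Longrightarrow> s \<le> n \<Longrightarrow> balanced (W s) (C s) (d + k - s)"
    and v: "inj_on v {j..n}" "\<And>s. j \<le> s \<Longrightarrow> s \<le> n \<Longrightarrow> v s \<notin> W k"
    and vv: "\<And>s s'. s \<in> {j..n} \<Longrightarrow> s' \<in> {j..n} \<Longrightarrow> s \<noteq> s' \<Longrightarrow> gv (v s) (v s')"
    and vW: "\<And>s x. j \<le> s \<Longrightarrow> s \<le> k \<Longrightarrow> x \<in> W k \<Longrightarrow> gv (v s) x"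
    and anti: "\<And>s s'. k < s \<Longrightarrow> s \<le> s' \<Longrightarrow> s' \<le> n \<Longrightarrow> W s' \<subseteq> W s"
    and vN: "\<And>s. k < s \<Longrightarrow> s \<le> n \<Longrightarrow> {x \<in> W k. gv (v s) x} = W s"
    and c: "inj_on c {k<..n}" "\<And>s. k < s \<Longrightarrow> s \<le> n \<Longrightarrow> c s \<notin> C k"
    and cc: "\<And>s s'. s \<in> {k<..n} \<Longrightarrow> s' \<in> {k<..n} \<Longrightarrow> s \<noteq> s' \<Longrightarrow> \<not> gc (c s) (c s')"
    and cN: "\<And>s. k < s \<Longrightarrow> s \<le> n \<Longrightarrow> {x \<in> C k. gc (c s) x} = C s"
  shows "balanced (v ` {j..n} \<union> W k) (c ` {k<..n} \<union> C k) (d + k - j + 1)"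
proof -
  have "balanced (v ` {j..r} \<union> W k) (c ` {k<..r} \<union> C k) (d + k - j + 1)" if "k \<le> r" "r \<le> n" for r
    using that
  proof (induction r rule: int_ge_induct)
    case base
    have card: "int (card (v ` {j..k})) = k - j + 1"
      using jk by (subst card_image) (auto intro: inj_on_subset[OF v(1)])
    have "balanced (v ` {j..k} \<union> W k) (C k) (d + k - k + int (card (v ` {j..k})))"
    proof (rule balanced_cones[OF bal])
      fix x y assume "x \<in> v ` {j..k}" "y \<in> v ` {j..k} \<union> W k" "x \<noteq> y"
      then show "gv x y" using vv vW jk by (fastforce)
    qed (use jk v in auto)
    then show ?case using card by (simp add: algebra_simps)
  next
    case (step i)
    let ?K = "v ` {j..i}"
    have Wsub: "W (i + 1) \<subseteq> W k" using vN[of "i + 1"] step by auto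
    have "v (i + 1) \<notin> ?K" using inj_onD[OF v(1), of "i + 1"] step jk by fastforce
    then have vnot: "v (i + 1) \<notin> ?K \<union> W k" using v(2) step jk by auto
    have "c (i + 1) \<notin> c ` {k<..i}" using inj_onD[OF c(1), of "i + 1"] step jk by fastforce
    then have cnot: "c (i + 1) \<notin> c ` {k<..i} \<union> C k" using c(2) step jk by auto
    have Nv: "{x \<in> ?K \<union> W k. gv (v (i + 1)) x} = ?K \<union> W (i + 1)"
      using vN[of "i + 1"] vv[of "i + 1"] step jk by auto
    have Nc: "{x \<in> c ` {k<..i} \<union> C k. gc (c (i + 1)) x} = C (i + 1)"
      using cN[of "i + 1"] cc[of "i + 1"] step jk by auto
    have card: "int (card ?K) = i - j + 1"
      using step jk by (subst card_image) (auto intro: inj_on_subset[OF v(1)])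
    \<comment> \<open>\<open>W (i + 1)\<close> has dimension \<open>d + k - (i + 1)\<close> and
      \<open>?K\<close> has \<open>i - j + 1\<close> points: in total one less than the target
      dimension, as shedding demands.\<close>
    have "balanced (?K \<union> W (i + 1)) (C (i + 1)) (d + k - (i + 1) + int (card ?K))"
    proof (rule balanced_cones[OF bal])
      fix x y assume x: "x \<in> ?K" and y: "y \<in> ?K \<union> W (i + 1)" "x \<noteq> y"
      then obtain s where s: "x = v s" "j \<le> s" "s \<le> i" by auto
      show "gv x y"
      proof (cases "y \<in> ?K")
        case True
        then obtain s' where "y = v s'" "j \<le> s'" "s' \<le> i" by auto
        then show ?thesis using vv[of s s'] s y step jk by auto
      next
        case False
        then have yW: "y \<in> W (i + 1)" using y by auto
        show ?thesis
        proof (cases "s \<le> k")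
          case True
          then show ?thesis using vW s yW Wsub by auto
        next
          case False
          then show ?thesis using anti[of s "i + 1"] vN[of s] s yW step by auto
        qed
      qed
    qed (use Wsub v step jk in auto)
    then have "balanced (?K \<union> W (i + 1)) (C (i + 1)) (d + k - j + 1 - 1)"
      using card by (simp add: algebra_simps)
    then have "balanced (insert (v (i + 1)) (?K \<union> W k))
       (insert (c (i + 1)) (c ` {k<..i} \<union> C k)) (d + k - j + 1)"
      using step Nv Nc by (intro balanced_shed vnot cnot) auto
    moreover have "{j..i + 1} = insert (i + 1) {j..i}" "{k<..i + 1} = insert (i + 1) {k<..i}"
      using step jk by auto
    ultimately show ?case by simp
  qed
  from this[of n] show ?thesis using jk by simp
qed

end

text \<open>
  One side of the hole: a staircase region of columns \<open>1..c\<close> bounded below by \<open>up\<close>, where the vertex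
  \<open>(i, j)\<close> is paired with the cell \<open>(i, j - 1)\<close>, together with the rest \<open>X k y\<close> of the vertices.
  In the rest, \<open>k\<close> bounds the columns of the part before the hole and \<open>y\<close> the rows of the part
  after it; a vertex of the staircase restricts the rest only through these two bounds. Columns
  up to \<open>a\<close> lie over the part before the hole, so there the lowest row also carries cells.
\<close>

locale strand = clique_pair gv gc t u
  for gv :: "'a \<Rightarrow> 'a \<Rightarrow> bool" and gc :: "'b \<Rightarrow> 'b \<Rightarrow> bool" and t u :: "'r::comm_ring_1" +
  fixes a b c e n \<delta> :: int and up :: "int \<Rightarrow> int"
    and vt :: "int \<Rightarrow> int \<Rightarrow> 'a" and ce :: "int \<Rightarrow> int \<Rightarrow> 'b"
    and X :: "int \<Rightarrow> int \<Rightarrow> 'a set" and Y :: "int \<Rightarrow> int \<Rightarrow> 'b set"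
    and UV UC :: "int \<Rightarrow> int \<Rightarrow> bool"
  defines "UV \<equiv> \<lambda>i j. 1 \<le> i \<and> i \<le> c \<and> up i \<le> j \<and> j \<le> n"
    and "UC \<equiv> \<lambda>p q. 1 \<le> p \<and> p \<le> c \<and> (if p < a then b else up (p + 1)) \<le> q \<and> q < n"
  assumes a: "1 \<le> a" "a \<le> c" and e: "b < e" "e \<le> n"
    and up_low: "\<And>i. 1 \<le> i \<Longrightarrow> i \<le> a \<Longrightarrow> up i = b + 1"
    and up_mono: "\<And>i i'. 1 \<le> i \<Longrightarrow> i \<le> i' \<Longrightarrow> i' \<le> c + 1 \<Longrightarrow> up i \<le> up i'"
    and up_end: "up (c + 1) = e"
    and vt_inj: "\<And>i j i' j'. vt i j = vt i' j' \<longleftrightarrow> i = i' \<and> j = j'"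
    and ce_inj: "\<And>i j i' j'. ce i j = ce i' j' \<longleftrightarrow> i = i' \<and> j = j'"
    and vt_adj: "\<And>i j i' j'. UV i j \<Longrightarrow> UV i' j' \<Longrightarrow> (i, j) \<noteq> (i', j') \<Longrightarrow>
      gv (vt i j) (vt i' j') \<longleftrightarrow> i \<le> i' \<and> j \<le> j' \<or> i' \<le> i \<and> j' \<le> j"
    and ce_adj: "\<And>p q p' q'. UC p q \<Longrightarrow> UC p' q' \<Longrightarrow>
      gc (ce p q) (ce p' q') \<longleftrightarrow> p < p' \<and> q < q' \<or> p' < p \<and> q' < q"
    and vt_X: "\<And>i j. UV i j \<Longrightarrow> vt i j \<notin> X a e" and ce_Y: "\<And>p q. UC p q \<Longrightarrow> ce p q \<notin> Y a e"
    and X_int: "\<And>k y k' y'. \<lbrakk>1 \<le> k; k \<le> a; e \<le> y; y \<le> n; 1 \<le> k'; k' \<le> a; e \<le> y'; y' \<le> n\<rbrakk> \<Longrightarrow>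
      X k y \<inter> X k' y' = X (min k k') (max y y')"
    and Y_int: "\<And>k y k' y'. \<lbrakk>1 \<le> k; k \<le> a; e \<le> y; y \<le> n; 1 \<le> k'; k' \<le> a; e \<le> y'; y' \<le> n\<rbrakk> \<Longrightarrow>
      Y k y \<inter> Y k' y' = Y (min k k') (max y y')"
    and X_adj: "\<And>i j x. UV i j \<Longrightarrow> x \<in> X a e \<Longrightarrow> gv (vt i j) x \<longleftrightarrow> x \<in> X (min i a) (max j e)"
    and Y_adj: "\<And>p q x. UC p q \<Longrightarrow> x \<in> Y a e \<Longrightarrow> gc (ce p q) x \<longleftrightarrow> x \<in> Y (min p a) (max (q + 1) e)"
    and X_bal: "\<And>k y. \<lbrakk>1 \<le> k; k \<le> a; e \<le> y; y \<le> n\<rbrakk> \<Longrightarrow> balanced (X k y) (Y k y) (\<delta> + k - y)"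
begin

declare vt_inj [simp] ce_inj [simp]

text \<open>\<open>SV\<close>, \<open>SC\<close>: what remains once some vertex of the staircase, lying in column \<open>k\<close> or in column
  \<open>a\<close> or later, has been chosen; \<open>FV\<close>, \<open>FC\<close>: what remains as long as none has.\<close>

definition SV :: "int \<Rightarrow> int \<Rightarrow> int \<Rightarrow> 'a set" where
  "SV i j k = {vt i' j' | i' j'. UV i' j' \<and> i \<le> i' \<and> j \<le> j'} \<union> X k (max j e)"

definition SC :: "int \<Rightarrow> int \<Rightarrow> int \<Rightarrow> 'b set" where
  "SC i j k = {ce p q | p q. UC p q \<and> i \<le> p \<and> j \<le> q} \<union> Y k (max j e)"

lemma X_sub: "\<lbrakk>1 \<le> k; k \<le> a; e \<le> y; y \<le> n\<rbrakk> \<Longrightarrow> X k y \<subseteq> X a e"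
  using X_int[of k y a e] a e by (auto simp: min_def max_def split: if_splits)

lemma Y_sub: "\<lbrakk>1 \<le> k; k \<le> a; e \<le> y; y \<le> n\<rbrakk> \<Longrightarrow> Y k y \<subseteq> Y a e"
  using Y_int[of k y a e] a e by (auto simp: min_def max_def split: if_splits)

lemma up_le_e: "1 \<le> i \<Longrightarrow> i \<le> c + 1 \<Longrightarrow> up i \<le> e"
  using up_mono[of i "c + 1"] up_end by simp

lemma up_gt_b: "1 \<le> i \<Longrightarrow> i \<le> c + 1 \<Longrightarrow> b < up i"
  using up_mono[of 1 i] up_low[of 1] a by simp

lemma vt_notin_X: "\<lbrakk>UV i j; 1 \<le> k; k \<le> a; e \<le> y; y \<le> n\<rbrakk> \<Longrightarrow> vt i j \<notin> X k y"
  using vt_X X_sub by blast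

lemma ce_notin_Y: "\<lbrakk>UC i j; 1 \<le> k; k \<le> a; e \<le> y; y \<le> n\<rbrakk> \<Longrightarrow> ce i j \<notin> Y k y"
  using ce_Y Y_sub by blast

text \<open>A vertex in column \<open>i\<close> and row \<open>s\<close> alone would leave
  \<open>X (min i a) (max s e)\<close>. Since \<open>k \<le> min i a\<close>, the column bound in
  force is already at least as strict, and only the row bound moves.\<close>

lemma X_link:
  assumes "UV i s" "k \<le> min i a" "1 \<le> k" "j \<le> s" "s \<le> n"
  shows "{x \<in> X k (max j e). gv (vt i s) x} = X k (max s e)"
proof -
  have i: "1 \<le> i" using assms unfolding UV_def by auto
  have r: "1 \<le> k" "k \<le> a" "e \<le> max j e" "max j e \<le> n" "1 \<le> min i a" "min i a \<le> a"
    "e \<le> max s e" "max s e \<le> n"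
    using assms e i a by auto
  have "{x \<in> X k (max j e). gv (vt i s) x} = X k (max j e) \<inter> X (min i a) (max s e)"
    using X_adj[OF assms(1)] X_sub[OF r(1-4)] by auto
  also have "\<dots> = X (min k (min i a)) (max (max j e) (max s e))" by (rule X_int) (use r in auto)
  also have "min k (min i a) = k" using assms by auto
  also have "max (max j e) (max s e) = max s e" using assms by auto
  finally show ?thesis .
qed

lemma Y_link:
  assumes "UC i q" "k \<le> min i a" "1 \<le> k" "j \<le> q + 1" "q < n"
  shows "{x \<in> Y k (max j e). gc (ce i q) x} = Y k (max (q + 1) e)"
proof -
  have i: "1 \<le> i" using assms unfolding UC_def by auto
  have r: "1 \<le> k" "k \<le> a" "e \<le> max j e" "max j e \<le> n" "1 \<le> min i a" "min i a \<le> a"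
    "e \<le> max (q + 1) e" "max (q + 1) e \<le> n"
    using assms e i a by auto
  have "{x \<in> Y k (max j e). gc (ce i q) x} = Y k (max j e) \<inter> Y (min i a) (max (q + 1) e)"
    using Y_adj[OF assms(1)] Y_sub[OF r(1-4)] by auto
  also have "\<dots> = Y (min k (min i a)) (max (max j e) (max (q + 1) e))"
    by (rule Y_int) (use r in auto)
  also have "min k (min i a) = k" using assms by auto
  also have "max (max j e) (max (q + 1) e) = max (q + 1) e" using assms by auto
  finally show ?thesis .
qed

lemma SV_link:
  assumes "UV i s" "k \<le> min i a" "1 \<le> k" "j \<le> s"
  shows "{x \<in> SV (i + 1) j k. gv (vt i s) x} = SV (i + 1) s k"
proof -
  have "s \<le> n" using assms unfolding UV_def by auto
  from X_link[OF assms(1-4) this] show ?thesis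
    unfolding SV_def using vt_adj[OF assms(1)] assms by auto
qed

lemma SC_link:
  assumes "UC i q" "k \<le> min i a" "1 \<le> k" "j \<le> q + 1"
  shows "{x \<in> SC (i + 1) j k. gc (ce i q) x} = SC (i + 1) (q + 1) k"
proof -
  have "q < n" using assms unfolding UC_def by auto
  from Y_link[OF assms(1-4) this] show ?thesis
    unfolding SC_def using ce_adj[OF assms(1)] assms by auto
qed

text \<open>Columns are added from right to left. The columns after \<open>i\<close> have no points
  below row \<open>up (i + 1)\<close>, so in column \<open>i\<close> the vertices up to row
  \<open>l = max j (up (i + 1))\<close> are cone points, and the rows above \<open>l\<close> are the
  ones paired with cells. Each column adds one to the dimension. The condition relating
  \<open>k\<close>, \<open>i\<close> and \<open>a\<close> ensures that no further vertex tightens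
  the column bound \<open>k\<close>.\<close>

lemma balanced_from:
  assumes "i \<le> c + 1" "1 \<le> k" "k \<le> a" "k < i \<or> a \<le> i" "1 \<le> i" "up i \<le> j" "j \<le> n"
  shows "balanced (SV i j k) (SC i j k) (c + 1 - i + \<delta> + k - j)"
  using assms
proof (induction i arbitrary: j rule: int_le_induct)
  case base
  have "e \<le> j" using base up_end by simp
  moreover have "SV (c + 1) j k = X k (max j e)" "SC (c + 1) j k = Y k (max j e)"
    unfolding SV_def SC_def UV_def UC_def by auto
  ultimately show ?case using X_bal[of k j] base by (simp add: max_def)
next
  case (step i0)
  define i where "i = i0 - 1"
  have i0: "i0 = i + 1" by (simp add: i_def)
  define l where "l = max j (up (i + 1))"
  have i: "1 \<le> i" "i \<le> c" "k \<le> min i a" using step i0 by auto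
  have j: "up i \<le> j" "b < j" "up i \<le> up (i + 1)" "up (i + 1) \<le> e"
    using step i0 up_mono[of i "i + 1"] up_gt_b[of i] up_le_e[of "i + 1"] i by auto
  have UVs: "UV i s" if "j \<le> s" "s \<le> n" for s
    using that i j unfolding UV_def by auto
  \<comment> \<open>In columns before \<open>a\<close> the staircase is flat:
    \<open>up (i + 1) = b + 1 \<le> j\<close>, so row \<open>j\<close> holds the only cone
    point.\<close>
  have lcase: "l = j" if "i < a"
    using that up_low[of "i + 1"] i j unfolding l_def by auto
  have UCs: "UC i q" if "l \<le> q" "q < n" for q
    using that i j unfolding UC_def l_def by auto
  have ln: "j \<le> l" "l \<le> n" "up (i + 1) \<le> l"
    using step j e unfolding l_def by auto
  have memV: "x \<in> SV (i + 1) s k \<longleftrightarrow> (\<exists>i' j'. x = vt i' j' \<and> UV i' j' \<and> i + 1 \<le> i' \<and> s \<le> j') \<or> x \<in> X k (max s e)"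
    for x s unfolding SV_def by auto
  have up': "up (i + 1) \<le> up i'" if "i < i'" "i' \<le> c + 1" for i'
    using up_mono[of "i + 1" i'] that i by auto
  have Vl: "SV (i + 1) j k = SV (i + 1) l k"
  proof -
    have "max j e = max l e" using j unfolding l_def by auto
    moreover have "j \<le> j' \<longleftrightarrow> l \<le> j'" if "UV i' j'" "i + 1 \<le> i'" for i' j'
      using that up'[of i'] unfolding UV_def l_def by auto
    ultimately show ?thesis unfolding SV_def by auto
  qed
  have Cl: "SC (i + 1) j k = SC (i + 1) l k"
  proof -
    have "max j e = max l e" using j unfolding l_def by auto
    moreover have "j \<le> j' \<longleftrightarrow> l \<le> j'" if "UC i' j'" "i + 1 \<le> i'" for i' j'
      using that up'[of "i' + 1"] lcase unfolding UC_def l_def by (auto split: if_splits)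
    ultimately show ?thesis unfolding SC_def by auto
  qed
  have V: "SV i j k = (\<lambda>s. vt i s) ` {j..n} \<union> SV (i + 1) l k"
  proof -
    have "{vt i' j' | i' j'. UV i' j' \<and> i \<le> i' \<and> j \<le> j'}
      = (\<lambda>s. vt i s) ` {j..n} \<union> {vt i' j' | i' j'. UV i' j' \<and> i + 1 \<le> i' \<and> j \<le> j'}" (is "?A = ?B")
    proof
      show "?A \<subseteq> ?B"
      proof
        fix x assume "x \<in> ?A"
        then obtain i' j' where x: "x = vt i' j'" "UV i' j'" "i \<le> i'" "j \<le> j'" by auto
        show "x \<in> ?B" using x unfolding UV_def by (cases "i' = i") auto
      qed
      show "?B \<subseteq> ?A" using UVs by force
    qed
    then show ?thesis unfolding Vl[symmetric] unfolding SV_def by auto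
  qed
  have C: "SC i j k = (\<lambda>s. ce i (s - 1)) ` {l<..n} \<union> SC (i + 1) l k"
  proof -
    have "{ce i' j' | i' j'. UC i' j' \<and> i \<le> i' \<and> j \<le> j'}
      = (\<lambda>s. ce i (s - 1)) ` {l<..n} \<union> {ce i' j' | i' j'. UC i' j' \<and> i + 1 \<le> i' \<and> j \<le> j'}" (is "?A = ?B")
    proof
      show "?A \<subseteq> ?B"
      proof
        fix x assume "x \<in> ?A"
        then obtain i' j' where x: "x = ce i' j'" "UC i' j'" "i \<le> i'" "j \<le> j'" by auto
        show "x \<in> ?B"
        proof (cases "i' = i")
          case True
          then have "l \<le> j'" "j' < n" using x lcase unfolding UC_def l_def by (auto split: if_splits)
          then have "x = ce i ((j' + 1) - 1)" "j' + 1 \<in> {l<..n}" using x True by auto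
          then show ?thesis by blast
        qed (use x in auto)
      qed
      show "?B \<subseteq> ?A"
      proof
        fix x assume "x \<in> ?B"
        then consider s where "x = ce i (s - 1)" "l < s" "s \<le> n"
          | i' j' where "x = ce i' j'" "UC i' j'" "i + 1 \<le> i'" "j \<le> j'" by auto
        then show "x \<in> ?A"
        proof cases
          case 1
          then show ?thesis using UCs[of "s - 1"] ln by force
        qed force
      qed
    qed
    then show ?thesis unfolding Cl[symmetric] unfolding SC_def by auto
  qed
  have "balanced ((\<lambda>s. vt i s) ` {j..n} \<union> SV (i + 1) l k) ((\<lambda>s. ce i (s - 1)) ` {l<..n} \<union> SC (i + 1) l k)
     ((c - i + \<delta> + k - l) + l - j + 1)"
  proof (rule balanced_column)
    fix s assume s: "l \<le> s" "s \<le> n"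
    have "balanced (SV i0 s k) (SC i0 s k) (c + 1 - i0 + \<delta> + k - s)"
      by (rule step.IH) (use step.prems s i ln i0 in auto)
    then show "balanced (SV (i + 1) s k) (SC (i + 1) s k) (c - i + \<delta> + k - l + l - s)"
      using i0 by simp
  next
    show "inj_on (vt i) {j..n}" using vt_inj unfolding inj_on_def by auto
  next
    fix s assume s: "j \<le> s" "s \<le> n"
    have "max l e \<le> n" "e \<le> max l e" using ln e by auto
    then show "vt i s \<notin> SV (i + 1) l k"
      using vt_notin_X[OF UVs[OF s], of k "max l e"] vt_inj step.prems unfolding SV_def by auto
  next
    fix s s' assume "s \<in> {j..n}" "s' \<in> {j..n}" "s \<noteq> s'"
    then show "gv (vt i s) (vt i s')" using vt_adj[OF UVs UVs, of s s'] by auto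
  next
    fix s x assume s: "j \<le> s" "s \<le> l" and x: "x \<in> SV (i + 1) l k"
    have *: "max s e = max l e" using s j unfolding l_def by auto
    have "{x \<in> SV (i + 1) j k. gv (vt i s) x} = SV (i + 1) s k"
      by (rule SV_link) (use UVs s ln i step.prems in auto)
    moreover have "SV (i + 1) l k \<subseteq> SV (i + 1) s k"
      using s * unfolding SV_def by auto
    ultimately show "gv (vt i s) x" using x Vl by auto
  next
    fix s s' assume s: "l < s" "s \<le> s'" "s' \<le> n"
    have "X k (max s' e) \<subseteq> X k (max s e)"
      using X_int[of k "max s e" k "max s' e"] s step.prems e ln by (auto simp: max_def split: if_splits)
    then show "SV (i + 1) s' k \<subseteq> SV (i + 1) s k" using s unfolding SV_def by auto
  next
    fix s assume "l < s" "s \<le> n"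
    then show "{x \<in> SV (i + 1) l k. gv (vt i s) x} = SV (i + 1) s k"
      by (intro SV_link) (use UVs ln i step.prems in auto)
  next
    show "inj_on (\<lambda>s. ce i (s - 1)) {l<..n}" using ce_inj unfolding inj_on_def by auto
  next
    fix s assume s: "l < s" "s \<le> n"
    have "max l e \<le> n" "e \<le> max l e" using ln e by auto
    then show "ce i (s - 1) \<notin> SC (i + 1) l k"
      using ce_notin_Y[OF UCs, of "s - 1" k "max l e"] s ce_inj step.prems unfolding SC_def by auto
  next
    fix s s' assume "s \<in> {l<..n}" "s' \<in> {l<..n}" "s \<noteq> s'"
    then show "\<not> gc (ce i (s - 1)) (ce i (s' - 1))"
      using ce_adj[OF UCs UCs, of "s - 1" "s' - 1"] by auto
  next
    fix s assume "l < s" "s \<le> n"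
    then have "{x \<in> SC (i + 1) l k. gc (ce i (s - 1)) x} = SC (i + 1) (s - 1 + 1) k"
      by (intro SC_link) (use UCs i step.prems in auto)
    then show "{x \<in> SC (i + 1) l k. gc (ce i (s - 1)) x} = SC (i + 1) s k" by simp
  qed (use ln in auto)
  then show ?case unfolding V[symmetric] C[symmetric] i_def[symmetric]
    by (simp add: algebra_simps)
qed

definition FV :: "int \<Rightarrow> 'a set" where
  "FV i = {vt i' j' | i' j'. UV i' j' \<and> i \<le> i'} \<union> X a e"

definition FC :: "int \<Rightarrow> 'b set" where
  "FC i = {ce p q | p q. UC p q \<and> i \<le> p} \<union> Y a e"

text \<open>As long as no vertex of the staircase has been chosen, the rest is the full
  \<open>X a e\<close>. In a column \<open>i < a\<close> even the lowest vertex is shed, because it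
  cuts \<open>X a e\<close> down to \<open>X i e\<close>; it needs a cell, and this is why the cells
  of such columns start one row lower, at \<open>b\<close>. The column lemma is therefore used
  without cone points, and the dimension does not change with \<open>i\<close>.\<close>

lemma balanced_fresh:
  assumes "i \<le> a" "1 \<le> i"
  shows "balanced (FV i) (FC i) (c + \<delta> - b)"
  using assms
proof (induction i rule: int_le_induct)
  case base
  have *: "UV i' j' \<Longrightarrow> b + 1 \<le> j'" for i' j' using up_gt_b[of i'] unfolding UV_def by auto
  have **: "UC p q \<Longrightarrow> a \<le> p \<Longrightarrow> b + 1 \<le> q" for p q using up_gt_b[of "p + 1"] unfolding UC_def by auto
  have "max (b + 1) e = e" using e by auto
  then have "FV a = SV a (b + 1) a" "FC a = SC a (b + 1) a"
    unfolding FV_def FC_def SV_def SC_def using * ** by auto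
  moreover have "balanced (SV a (b + 1) a) (SC a (b + 1) a) (c + 1 - a + \<delta> + a - (b + 1))"
    by (rule balanced_from) (use a e up_low[of a] in auto)
  ultimately show ?case by (simp add: algebra_simps)
next
  case (step i0)
  define i where "i = i0 - 1"
  have i0: "i0 = i + 1" by (simp add: i_def)
  have i: "1 \<le> i" "i < a" "i \<le> min i a" using step i0 by auto
  \<comment> \<open>Height \<open>b\<close> stands for no choice in column \<open>i\<close>, hence
    \<open>FV\<close>; the heights above it stand for a chosen vertex, which also imposes the column
    bound \<open>i\<close>.\<close>
  define W where "W s = (if s = b then FV (i + 1) else SV (i + 1) s i)" for s
  define C where "C s = (if s = b then FC (i + 1) else SC (i + 1) s i)" for s
  have UVs: "UV i s" if "b + 1 \<le> s" "s \<le> n" for s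
    using that i a up_low[of i] unfolding UV_def by auto
  have UCs: "UC i s" if "b \<le> s" "s < n" for s
    using that i a unfolding UC_def by auto
  have V: "FV i = (\<lambda>s. vt i s) ` {b + 1..n} \<union> FV (i + 1)"
  proof -
    have "{vt i' j' | i' j'. UV i' j' \<and> i \<le> i'}
      = (\<lambda>s. vt i s) ` {b + 1..n} \<union> {vt i' j' | i' j'. UV i' j' \<and> i + 1 \<le> i'}" (is "?A = ?B")
    proof
      show "?A \<subseteq> ?B"
      proof
        fix x assume "x \<in> ?A"
        then obtain i' j' where x: "x = vt i' j'" "UV i' j'" "i \<le> i'" by auto
        show "x \<in> ?B" using x up_gt_b[of i'] unfolding UV_def by (cases "i' = i") auto
      qed
      show "?B \<subseteq> ?A" using UVs by force
    qed
    then show ?thesis unfolding FV_def by auto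
  qed
  have Ceq: "FC i = (\<lambda>s. ce i (s - 1)) ` {b<..n} \<union> FC (i + 1)"
  proof -
    have "{ce i' j' | i' j'. UC i' j' \<and> i \<le> i'}
      = (\<lambda>s. ce i (s - 1)) ` {b<..n} \<union> {ce i' j' | i' j'. UC i' j' \<and> i + 1 \<le> i'}" (is "?A = ?B")
    proof
      show "?A \<subseteq> ?B"
      proof
        fix x assume "x \<in> ?A"
        then obtain i' j' where x: "x = ce i' j'" "UC i' j'" "i \<le> i'" by auto
        show "x \<in> ?B"
        proof (cases "i' = i")
          case True
          then have "x = ce i ((j' + 1) - 1)" "j' + 1 \<in> {b<..n}" using x i unfolding UC_def by auto
          then show ?thesis by blast
        qed (use x in auto)
      qed
      show "?B \<subseteq> ?A"
      proof
        fix x assume "x \<in> ?B"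
        then consider s where "x = ce i (s - 1)" "b < s" "s \<le> n"
          | i' j' where "x = ce i' j'" "UC i' j'" "i + 1 \<le> i'" by auto
        then show "x \<in> ?A"
        proof cases
          case 1
          then show ?thesis using UCs[of "s - 1"] by force
        qed force
      qed
    qed
    then show ?thesis unfolding FC_def by auto
  qed
  have Wb: "W b = FV (i + 1)" "C b = FC (i + 1)" unfolding W_def C_def by auto
  have Ws: "W s = SV (i + 1) s i" "C s = SC (i + 1) s i" if "b < s" for s
    using that unfolding W_def C_def by auto
  have "max (b + 1) e = e" using e by auto
  have "balanced ((\<lambda>s. vt i s) ` {b + 1..n} \<union> W b) ((\<lambda>s. ce i (s - 1)) ` {b<..n} \<union> C b)
     (c + \<delta> - b + b - (b + 1) + 1)"
  proof (rule balanced_column)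
    fix s assume s: "b \<le> s" "s \<le> n"
    show "balanced (W s) (C s) (c + \<delta> - b + b - s)"
    proof (cases "s = b")
      case True
      then show ?thesis using step.IH step.prems i0 Wb by simp
    next
      case False
      have "balanced (SV (i + 1) s i) (SC (i + 1) s i) (c + 1 - (i + 1) + \<delta> + i - s)"
        by (rule balanced_from) (use i a s False up_low[of "i + 1"] in auto)
      then show ?thesis using False s Ws by simp
    qed
  next
    show "inj_on (vt i) {b + 1..n}" using vt_inj unfolding inj_on_def by auto
  next
    fix s assume s: "b + 1 \<le> s" "s \<le> n"
    then show "vt i s \<notin> W b"
      using vt_X[OF UVs[OF s]] vt_inj unfolding Wb FV_def by auto
  next
    fix s s' assume "s \<in> {b + 1..n}" "s' \<in> {b + 1..n}" "s \<noteq> s'"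
    then show "gv (vt i s) (vt i s')" using vt_adj[OF UVs UVs, of s s'] by auto
  next
    fix s s' assume s: "b < s" "s \<le> s'" "s' \<le> n"
    have "X i (max s' e) \<subseteq> X i (max s e)"
      using X_int[of i "max s e" i "max s' e"] s i a e by (auto simp: max_def split: if_splits)
    then show "W s' \<subseteq> W s" using s unfolding Ws[OF s(1)] Ws[OF less_le_trans[OF s(1,2)]] SV_def by auto
  next
    fix s assume s: "b < s" "s \<le> n"
    have "{x \<in> X a e. gv (vt i s) x} = X i (max s e)"
      using X_adj[OF UVs, of s] X_sub[of i "max s e"] s i a e by auto
    then show "{x \<in> W b. gv (vt i s) x} = W s"
      unfolding Wb Ws[OF s(1)] FV_def SV_def using vt_adj[OF UVs, of s] s by auto
  next
    show "inj_on (\<lambda>s. ce i (s - 1)) {b<..n}" using ce_inj unfolding inj_on_def by auto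
  next
    fix s assume s: "b < s" "s \<le> n"
    then show "ce i (s - 1) \<notin> C b"
      using ce_Y[OF UCs, of "s - 1"] ce_inj unfolding Wb FC_def by auto
  next
    fix s s' assume "s \<in> {b<..n}" "s' \<in> {b<..n}" "s \<noteq> s'"
    then show "\<not> gc (ce i (s - 1)) (ce i (s' - 1))"
      using ce_adj[OF UCs UCs, of "s - 1" "s' - 1"] by auto
  next
    fix s assume s: "b < s" "s \<le> n"
    have "{x \<in> Y a e. gc (ce i (s - 1)) x} = Y i (max s e)"
      using Y_adj[OF UCs, of "s - 1"] Y_sub[of i "max s e"] s i a e by auto
    then show "{x \<in> C b. gc (ce i (s - 1)) x} = C s"
      unfolding Wb Ws[OF s(1)] FC_def SC_def using ce_adj[OF UCs, of "s - 1"] s by auto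
  qed (use e in auto)
  then show ?case unfolding Wb V[symmetric] Ceq[symmetric] i_def[symmetric]
    by (simp add: algebra_simps)
qed

theorem balanced_strand:
  "balanced ({vt i j | i j. UV i j} \<union> X a e) ({ce p q | p q. UC p q} \<union> Y a e) (c + \<delta> - b)"
proof -
  have "{vt i j | i j. UV i j} \<union> X a e = FV 1" "{ce p q | p q. UC p q} \<union> Y a e = FC 1"
    unfolding FV_def FC_def UV_def UC_def by auto
  then show ?thesis using balanced_fresh[of 1] a by simp
qed

end

section \<open>Normal forms on a ring of four regions\<close>

type_synonym weight = "nat \<times> int \<Rightarrow>\<^sub>0 nat"

definition antidiag :: "point \<Rightarrow> point \<Rightarrow> bool" where
  "antidiag x y \<longleftrightarrow> fst x < fst y \<and> snd y < snd x"

text \<open>A point of least coordinate sum works: a point that is smaller in one coordinate must be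
  larger in the other, and the two would be in anti-diagonal position.\<close>

lemma chain_has_least:
  assumes "finite S" "S \<noteq> {}" "\<And>x y. x \<in> S \<Longrightarrow> y \<in> S \<Longrightarrow> \<not> antidiag x y"
  shows "\<exists>x\<in>S. \<forall>y\<in>S. fst x \<le> fst y \<and> snd x \<le> snd y"
proof -
  define x where "x = arg_min_on (\<lambda>p. fst p + snd p) S"
  have x: "x \<in> S" "\<And>y. y \<in> S \<Longrightarrow> fst x + snd x \<le> fst y + snd y"
    using arg_min_if_finite[OF assms(1,2), of "\<lambda>p. fst p + snd p"] unfolding x_def
    by (auto simp: not_less)
  have "fst x \<le> fst y \<and> snd x \<le> snd y" if "y \<in> S" for y
    using x(2)[OF that] assms(3)[OF x(1) that] assms(3)[OF that x(1)] unfolding antidiag_def by auto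
  then show ?thesis using x(1) by blast
qed

lemma chain_has_greatest:
  assumes "finite S" "S \<noteq> {}" "\<And>x y. x \<in> S \<Longrightarrow> y \<in> S \<Longrightarrow> \<not> antidiag x y"
  shows "\<exists>x\<in>S. \<forall>y\<in>S. fst y \<le> fst x \<and> snd y \<le> snd x"
proof -
  define x where "x = arg_min_on (\<lambda>p. - (fst p + snd p)) S"
  have x: "x \<in> S" "\<And>y. y \<in> S \<Longrightarrow> - (fst x + snd x) \<le> - (fst y + snd y)"
    using arg_min_if_finite[OF assms(1,2), of "\<lambda>p. - (fst p + snd p)"] unfolding x_def
    by (auto simp: not_less)
  have "fst y \<le> fst x \<and> snd y \<le> snd x" if "y \<in> S" for y
    using x(2)[OF that] assms(3)[OF x(1) that] assms(3)[OF that x(1)] unfolding antidiag_def by auto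
  then show ?thesis using x(1) by blast
qed

text \<open>The support of a weight tells which coordinate values occur, not at which points.
  Extreme values are all that can be read off from it, and this is enough to locate a common point
  of two normal multisets.\<close>

lemma least_value_cong:
  fixes f :: "'a \<Rightarrow> 'b::linorder"
  assumes vals: "\<And>i. (\<exists>v\<in>S. P v \<and> f v = i) \<longleftrightarrow> (\<exists>v\<in>T. P v \<and> f v = i)"
    and x: "x \<in> S" "P x" "\<And>y. y \<in> S \<Longrightarrow> P y \<Longrightarrow> f x \<le> f y"
    and x': "x' \<in> T" "P x'" "\<And>y. y \<in> T \<Longrightarrow> P y \<Longrightarrow> f x' \<le> f y"
  shows "f x = f x'"
proof (rule antisym)
  obtain v where "v \<in> S" "P v" "f v = f x'" using vals[of "f x'"] x' by blast
  then show "f x \<le> f x'" using x(3) by metis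
  obtain v where "v \<in> T" "P v" "f v = f x" using vals[of "f x"] x by blast
  then show "f x' \<le> f x" using x'(3) by metis
qed

lemma greatest_value_cong:
  fixes f :: "'a \<Rightarrow> 'b::linorder"
  assumes vals: "\<And>i. (\<exists>v\<in>S. P v \<and> f v = i) \<longleftrightarrow> (\<exists>v\<in>T. P v \<and> f v = i)"
    and x: "x \<in> S" "P x" "\<And>y. y \<in> S \<Longrightarrow> P y \<Longrightarrow> f y \<le> f x"
    and x': "x' \<in> T" "P x'" "\<And>y. y \<in> T \<Longrightarrow> P y \<Longrightarrow> f y \<le> f x'"
  shows "f x = f x'"
proof (rule antisym)
  obtain v where "v \<in> S" "P v" "f v = f x'" using vals[of "f x'"] x' by blast
  then show "f x' \<le> f x" using x(3) by metis
  obtain v where "v \<in> T" "P v" "f v = f x" using vals[of "f x"] x by blast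
  then show "f x \<le> f x'" using x'(3) by metis
qed

text \<open>The pattern occurs twice, for vertices and for lower left corners of cells, with
  different staircases. The hypotheses collect what both instances share: \<open>up\<close> bounds
  \<open>U\<close> from below, \<open>dn\<close> bounds \<open>L\<close> from above, and in the
  columns strictly between \<open>a\<close> and \<open>a'\<close> the latter stays below the
  former.\<close>

locale ring_regions =
  fixes a b a' b' mm nn :: int and up dn :: "int \<Rightarrow> int"
  assumes ab: "a < a'" "b < b'"
    and up_mono: "\<And>i i'. 1 \<le> i \<Longrightarrow> i \<le> i' \<Longrightarrow> i' < a' \<Longrightarrow> up i \<le> up i'"
    and up_low: "\<And>i. 1 \<le> i \<Longrightarrow> i \<le> a \<Longrightarrow> up i \<le> b + 1"
    and up_le: "\<And>i. 1 \<le> i \<Longrightarrow> i < a' \<Longrightarrow> up i \<le> b'"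
    and dn_mono: "\<And>i i'. a < i \<Longrightarrow> i \<le> i' \<Longrightarrow> i' \<le> mm \<Longrightarrow> dn i \<le> dn i'"
    and dn_high: "\<And>i. a' \<le> i \<Longrightarrow> i \<le> mm \<Longrightarrow> b' - 1 \<le> dn i"
    and dn_ge: "\<And>i. a < i \<Longrightarrow> i \<le> mm \<Longrightarrow> b \<le> dn i"
    and dn_up: "\<And>i. a < i \<Longrightarrow> i < a' \<Longrightarrow> dn i < up i"
    and pos: "0 \<le> a" "0 \<le> b" "a' \<le> mm + 1" "b' \<le> nn + 1"
begin

definition A :: "point set" where "A = {(i, j). 1 \<le> i \<and> i \<le> a \<and> 1 \<le> j \<and> j \<le> b}"
definition U :: "point set" where "U = {(i, j). 1 \<le> i \<and> i < a' \<and> b < j \<and> j \<le> nn \<and> up i \<le> j}"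
definition L :: "point set" where "L = {(i, j). a < i \<and> i \<le> mm \<and> 1 \<le> j \<and> j < b' \<and> j \<le> dn i}"
definition B :: "point set" where "B = {(i, j). a' \<le> i \<and> i \<le> mm \<and> b' \<le> j \<and> j \<le> nn}"
definition Z :: "point set" where "Z = A \<union> U \<union> L \<union> B"

lemmas region_defs = A_def U_def L_def B_def

lemma U_L_disjoint: "x \<in> U \<Longrightarrow> x \<in> L \<Longrightarrow> False"
  using dn_up unfolding U_def L_def by force

lemma regions_disjoint: "A \<inter> U = {}" "A \<inter> L = {}" "A \<inter> B = {}" "U \<inter> L = {}" "U \<inter> B = {}" "L \<inter> B = {}"
  using U_L_disjoint ab unfolding region_defs by auto

text \<open>The first index names the kind of coordinate: column in \<open>A \<union> U\<close>, row
  in \<open>A \<union> L\<close>, column in \<open>L \<union> B\<close>, row in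
  \<open>U \<union> B\<close>, then marks for \<open>A\<close> and for \<open>B\<close>. Without the
  marks, \<open>(i, j)\<close> in \<open>A\<close> and \<open>(k, l)\<close> in \<open>B\<close>
  would have the same total weight as \<open>(i, l)\<close> in \<open>U\<close> and
  \<open>(k, j)\<close> in \<open>L\<close>, although both pairs are normal.\<close>

definition W :: "point \<Rightarrow> weight" where
  "W v = (if v \<in> A then Poly_Mapping.single (0, fst v) 1 + Poly_Mapping.single (1, snd v) 1
            + Poly_Mapping.single (4, 0) 1
          else if v \<in> U then Poly_Mapping.single (0, fst v) 1 + Poly_Mapping.single (3, snd v) 1
          else if v \<in> L then Poly_Mapping.single (1, snd v) 1 + Poly_Mapping.single (2, fst v) 1
          else if v \<in> B then Poly_Mapping.single (2, fst v) 1 + Poly_Mapping.single (3, snd v) 1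
            + Poly_Mapping.single (5, 0) 1
          else 0)"

lemma W_region:
  "v \<in> A \<Longrightarrow> W v = Poly_Mapping.single (0, fst v) 1 + Poly_Mapping.single (1, snd v) 1
            + Poly_Mapping.single (4, 0) 1"
  "v \<in> U \<Longrightarrow> W v = Poly_Mapping.single (0, fst v) 1 + Poly_Mapping.single (3, snd v) 1"
  "v \<in> L \<Longrightarrow> W v = Poly_Mapping.single (1, snd v) 1 + Poly_Mapping.single (2, fst v) 1"
  "v \<in> B \<Longrightarrow> W v = Poly_Mapping.single (2, fst v) 1 + Poly_Mapping.single (3, snd v) 1
            + Poly_Mapping.single (5, 0) 1"
  using regions_disjoint unfolding W_def by auto

text \<open>Unless the pair spans the hole, exchanging coordinates stays within two regions
  \<open>R\<close> and \<open>S\<close> that are equal or neighbours around the ring. Neighbouring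
  regions share one kind of row or column coordinate in \<open>W\<close>, and that is the one
  permuted by the exchange.\<close>

lemma straighten_regions:
  assumes u: "u \<in> Z" and v: "v \<in> Z" and uv: "antidiag u v" and nb: "\<not> (u \<in> U \<and> v \<in> L)"
  obtains R S where "(R, S) \<in> {(A, A), (A, L), (A, U), (U, U), (U, B), (L, L), (L, B), (B, B)}"
    "(fst u, snd v) \<in> R" "(fst v, snd u) \<in> S"
    "u \<in> R \<and> v \<in> S \<or> u \<in> S \<and> v \<in> R"
proof -
  obtain x1 y1 x2 y2 where [simp]: "u = (x1, y1)" "v = (x2, y2)" by (cases u, cases v)
  have lt: "x1 < x2" "y2 < y1" using uv unfolding antidiag_def by auto
  show thesis
  proof (cases "u \<in> A")
    case uA: True
    show thesis
    proof (cases "v \<in> A")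
      case True
      then show thesis using uA lt by (intro that[of A A]) (auto simp: A_def)
    next
      case False
      have "v \<in> L" using v False uA lt ab unfolding Z_def region_defs by auto
      moreover have "y1 \<le> dn x2" using \<open>v \<in> L\<close> uA dn_ge[of x2] unfolding region_defs by auto
      ultimately show thesis using uA lt ab by (intro that[of A L]) (auto simp: region_defs)
    qed
  next
    case uA: False
    show thesis
    proof (cases "u \<in> U")
      case uU: True
      then consider "v \<in> A" | "v \<in> U" | "v \<in> B" using v nb unfolding Z_def by blast
      then show thesis
      proof cases
        case 1
        then have "up x2 \<le> y1" using uU up_low[of x2] unfolding region_defs by auto
        then show thesis using 1 uU lt ab by (intro that[of A U]) (auto simp: region_defs)
      next
        case 2
        then have "up x1 \<le> y2" "up x2 \<le> y1" using uU up_mono[of x1 x2] lt unfolding region_defs by auto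
        then show thesis using 2 uU lt ab by (intro that[of U U]) (auto simp: region_defs)
      next
        case 3
        then have "up x1 \<le> y2" using uU up_le[of x1] lt unfolding region_defs by auto
        then show thesis using 3 uU lt ab by (intro that[of U B]) (auto simp: region_defs)
      qed
    next
      case uU: False
      show thesis
      proof (cases "u \<in> L")
        case uL: True
        \<comment> \<open>No point of \<open>L\<close> lies strictly north-west of one of
          \<open>U\<close>: already in the column of \<open>u\<close> the staircase
          \<open>up\<close> is above \<open>dn\<close>, and it only rises further to the
          east.\<close>
        have "v \<notin> U"
        proof
          assume "v \<in> U"
          then have "up x1 \<le> y2" "dn x1 < up x1" "y1 \<le> dn x1"
            using uL up_mono[of x1 x2] dn_up[of x1] lt pos unfolding region_defs by auto
          then show False using lt by simp
        qed
        then have "v \<in> L" using v uL lt ab unfolding Z_def region_defs by auto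
        moreover have "y2 \<le> dn x1" "y1 \<le> dn x2"
          using uL \<open>v \<in> L\<close> dn_mono[of x1 x2] lt unfolding region_defs by auto
        ultimately show thesis using uL lt by (intro that[of L L]) (auto simp: region_defs)
      next
        case False
        then have uB: "u \<in> B" using u uA uU unfolding Z_def by auto
        show thesis
        proof (cases "v \<in> B")
          case True
          then show thesis using uB lt by (intro that[of B B]) (auto simp: region_defs)
        next
          case False
          then have vL: "v \<in> L" using v uB lt ab unfolding Z_def region_defs by auto
          moreover have "y2 \<le> dn x1" using vL uB dn_high[of x1] unfolding region_defs by auto
          ultimately show thesis using uB lt ab by (intro that[of L B]) (auto simp: region_defs)
        qed
      qed
    qed
  qed
qed

lemma straighten:
  assumes "u \<in> Z" "v \<in> Z" "antidiag u v" "\<not> (u \<in> U \<and> v \<in> L)"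
  shows straighten_Z: "(fst u, snd v) \<in> Z" "(fst v, snd u) \<in> Z"
    and straighten_W: "W u + W v = W (fst u, snd v) + W (fst v, snd u)"
proof -
  obtain R S where RS: "(R, S) \<in> {(A, A), (A, L), (A, U), (U, U), (U, B), (L, L), (L, B), (B, B)}"
    and in': "(fst u, snd v) \<in> R" "(fst v, snd u) \<in> S"
    and uv: "u \<in> R \<and> v \<in> S \<or> u \<in> S \<and> v \<in> R"
    using straighten_regions[OF assms] by blast
  show "(fst u, snd v) \<in> Z" "(fst v, snd u) \<in> Z" using RS in' unfolding Z_def by auto
  have lt: "fst u < fst v" "snd v < snd u" using assms(3) unfolding antidiag_def by auto
  show "W u + W v = W (fst u, snd v) + W (fst v, snd u)"
    using RS in' uv lt ab
    by (elim insertE emptyE; clarsimp simp only: prod.inject; elim disjE conjE;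
        simp add: W_region add_ac; (simp add: region_defs case_prod_beta)?)
qed

definition normal :: "point multiset \<Rightarrow> bool" where
  "normal M \<longleftrightarrow> set_mset M \<subseteq> Z \<and>
    (\<forall>u\<in>#M. \<forall>v\<in>#M. antidiag u v \<longrightarrow> u \<in> U \<and> v \<in> L)"

abbreviation WM :: "point multiset \<Rightarrow> weight" where
  "WM M \<equiv> sum_mset (image_mset W M)"

lemma lookup_WM_pos: "0 < Poly_Mapping.lookup (WM M) s \<longleftrightarrow> (\<exists>v\<in>#M. 0 < Poly_Mapping.lookup (W v) s)"
  by (induction M) (auto simp: lookup_add)

lemma W_pos:
  assumes "v \<in> Z"
  shows "0 < Poly_Mapping.lookup (W v) (0, i) \<longleftrightarrow> v \<in> A \<union> U \<and> fst v = i"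
    "0 < Poly_Mapping.lookup (W v) (Suc 0, i) \<longleftrightarrow> v \<in> A \<union> L \<and> snd v = i"
    "0 < Poly_Mapping.lookup (W v) (2, i) \<longleftrightarrow> v \<in> L \<union> B \<and> fst v = i"
    "0 < Poly_Mapping.lookup (W v) (3, i) \<longleftrightarrow> v \<in> U \<union> B \<and> snd v = i"
    "0 < Poly_Mapping.lookup (W v) (4, 0) \<longleftrightarrow> v \<in> A"
    "0 < Poly_Mapping.lookup (W v) (5, 0) \<longleftrightarrow> v \<in> B"
proof -
  consider "v \<in> A" | "v \<in> U" | "v \<in> L" | "v \<in> B" using assms unfolding Z_def by auto
  then have "(0 < Poly_Mapping.lookup (W v) (0, i) \<longleftrightarrow> v \<in> A \<union> U \<and> fst v = i) \<and>
    (0 < Poly_Mapping.lookup (W v) (Suc 0, i) \<longleftrightarrow> v \<in> A \<union> L \<and> snd v = i) \<and>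
    (0 < Poly_Mapping.lookup (W v) (2, i) \<longleftrightarrow> v \<in> L \<union> B \<and> fst v = i) \<and>
    (0 < Poly_Mapping.lookup (W v) (3, i) \<longleftrightarrow> v \<in> U \<union> B \<and> snd v = i) \<and>
    (0 < Poly_Mapping.lookup (W v) (4, 0) \<longleftrightarrow> v \<in> A) \<and>
    (0 < Poly_Mapping.lookup (W v) (5, 0) \<longleftrightarrow> v \<in> B)"
    using regions_disjoint
    by cases (auto simp: W_region lookup_add lookup_single when_def)
  then show "0 < Poly_Mapping.lookup (W v) (0, i) \<longleftrightarrow> v \<in> A \<union> U \<and> fst v = i"
    "0 < Poly_Mapping.lookup (W v) (Suc 0, i) \<longleftrightarrow> v \<in> A \<union> L \<and> snd v = i"
    "0 < Poly_Mapping.lookup (W v) (2, i) \<longleftrightarrow> v \<in> L \<union> B \<and> fst v = i"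
    "0 < Poly_Mapping.lookup (W v) (3, i) \<longleftrightarrow> v \<in> U \<union> B \<and> snd v = i"
    "0 < Poly_Mapping.lookup (W v) (4, 0) \<longleftrightarrow> v \<in> A"
    "0 < Poly_Mapping.lookup (W v) (5, 0) \<longleftrightarrow> v \<in> B" by blast+
qed

text \<open>A point of \<open>U\<close> further left than the least point of the chain in
  \<open>A\<close> would lie above it and form a forbidden pair with it; likewise a point of
  \<open>L\<close> further down. So the coordinates of that least point are minima over all of
  \<open>A \<union> U\<close> and \<open>A \<union> L\<close>, visible in the weight.\<close>

lemma normal_least_A:
  assumes "normal M" "\<exists>x\<in>#M. x \<in> A"
  shows "\<exists>x\<in>#M. x \<in> A \<and> (\<forall>y\<in>#M. y \<in> A \<union> U \<longrightarrow> fst x \<le> fst y) \<and> (\<forall>y\<in>#M. y \<in> A \<union> L \<longrightarrow> snd x \<le> snd y)"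
proof -
  have "\<exists>x\<in>set_mset M \<inter> A. \<forall>y\<in>set_mset M \<inter> A. fst x \<le> fst y \<and> snd x \<le> snd y"
    by (rule chain_has_least) (use assms regions_disjoint in \<open>auto simp: normal_def\<close>)
  then obtain x where x: "x \<in># M" "x \<in> A" "\<And>y. y \<in># M \<Longrightarrow> y \<in> A \<Longrightarrow> fst x \<le> fst y \<and> snd x \<le> snd y" by blast
  have "fst x \<le> fst y" if "y \<in># M" "y \<in> U" for y
  proof (rule ccontr)
    assume "\<not> fst x \<le> fst y"
    then have "antidiag y x" using that x(2) unfolding antidiag_def region_defs by auto
    then show False using assms(1) that x regions_disjoint unfolding normal_def by blast
  qed
  moreover have "snd x \<le> snd y" if "y \<in># M" "y \<in> L" for y
  proof (rule ccontr)
    assume "\<not> snd x \<le> snd y"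
    then have "antidiag x y" using that x(2) unfolding antidiag_def region_defs by auto
    then show False using assms(1) that x regions_disjoint unfolding normal_def by blast
  qed
  ultimately show ?thesis using x by blast
qed

lemma normal_greatest_B:
  assumes "normal M" "\<exists>x\<in>#M. x \<in> B"
  shows "\<exists>x\<in>#M. x \<in> B \<and> (\<forall>y\<in>#M. y \<in> L \<union> B \<longrightarrow> fst y \<le> fst x) \<and> (\<forall>y\<in>#M. y \<in> U \<union> B \<longrightarrow> snd y \<le> snd x)"
proof -
  have "\<exists>x\<in>set_mset M \<inter> B. \<forall>y\<in>set_mset M \<inter> B. fst y \<le> fst x \<and> snd y \<le> snd x"
  proof (rule chain_has_greatest)
    fix x y assume "x \<in> set_mset M \<inter> B" "y \<in> set_mset M \<inter> B"
    then show "\<not> antidiag x y" using assms(1) regions_disjoint unfolding normal_def by blast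
  qed (use assms in auto)
  then obtain x where x: "x \<in># M" "x \<in> B" "\<And>y. y \<in># M \<Longrightarrow> y \<in> B \<Longrightarrow> fst y \<le> fst x \<and> snd y \<le> snd x" by blast
  have "fst y \<le> fst x" if "y \<in># M" "y \<in> L" for y
  proof (rule ccontr)
    assume "\<not> fst y \<le> fst x"
    then have "antidiag x y" using that x(2) unfolding antidiag_def region_defs by auto
    then show False using assms(1) that x regions_disjoint unfolding normal_def by blast
  qed
  moreover have "snd y \<le> snd x" if "y \<in># M" "y \<in> U" for y
  proof (rule ccontr)
    assume "\<not> snd y \<le> snd x"
    then have "antidiag y x" using that x(2) unfolding antidiag_def region_defs by auto
    then show False using assms(1) that x regions_disjoint unfolding normal_def by blast
  qed
  ultimately show ?thesis using x by blast
qed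

lemma normal_least_in:
  assumes "normal M" "\<exists>x\<in>#M. x \<in> R" "R = U \<or> R = L"
  shows "\<exists>x\<in>#M. x \<in> R \<and> (\<forall>y\<in>#M. y \<in> R \<longrightarrow> fst x \<le> fst y \<and> snd x \<le> snd y)"
proof -
  have "\<exists>x\<in>set_mset M \<inter> R. \<forall>y\<in>set_mset M \<inter> R. fst x \<le> fst y \<and> snd x \<le> snd y"
  proof (rule chain_has_least)
    fix x y assume "x \<in> set_mset M \<inter> R" "y \<in> set_mset M \<inter> R"
    then show "\<not> antidiag x y" using assms(1,3) regions_disjoint unfolding normal_def by blast
  qed (use assms in auto)
  then show ?thesis by blast
qed

text \<open>Only supports of weights are compared. The marks decide whether \<open>A\<close> or
  \<open>B\<close> is met, and then its extreme point is determined by two kinds of coordinates. If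
  neither is met, the kinds 0 and 3 see only \<open>U\<close>, and the kinds 1 and 2 see only
  \<open>L\<close>. Uniqueness follows by cancelling the common point.\<close>

lemma normal_common:
  assumes M: "normal M" and N: "normal N" and eq: "WM M = WM N" and ne: "M \<noteq> {#}"
  shows "\<exists>x. x \<in># M \<and> x \<in># N"
proof -
  have Z: "v \<in> Z" if "v \<in># M \<or> v \<in># N" for v using that M N unfolding normal_def by auto
  have w: "(\<exists>v\<in>#M. 0 < Poly_Mapping.lookup (W v) s) \<longleftrightarrow> (\<exists>v\<in>#N. 0 < Poly_Mapping.lookup (W v) s)" for s
    using lookup_WM_pos[of M s] lookup_WM_pos[of N s] eq by simp
  have w0: "(\<exists>v\<in>#M. v \<in> A \<union> U \<and> fst v = i) \<longleftrightarrow> (\<exists>v\<in>#N. v \<in> A \<union> U \<and> fst v = i)" for i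
    using w[of "(0, i)"] W_pos(1) Z by blast
  have w1: "(\<exists>v\<in>#M. v \<in> A \<union> L \<and> snd v = i) \<longleftrightarrow> (\<exists>v\<in>#N. v \<in> A \<union> L \<and> snd v = i)" for i
    using w[of "(Suc 0, i)"] W_pos(2) Z by blast
  have w2: "(\<exists>v\<in>#M. v \<in> L \<union> B \<and> fst v = i) \<longleftrightarrow> (\<exists>v\<in>#N. v \<in> L \<union> B \<and> fst v = i)" for i
    using w[of "(2, i)"] W_pos(3) Z by blast
  have w3: "(\<exists>v\<in>#M. v \<in> U \<union> B \<and> snd v = i) \<longleftrightarrow> (\<exists>v\<in>#N. v \<in> U \<union> B \<and> snd v = i)" for i
    using w[of "(3, i)"] W_pos(4) Z by blast
  have w4: "(\<exists>v\<in>#M. v \<in> A) \<longleftrightarrow> (\<exists>v\<in>#N. v \<in> A)" using w[of "(4, 0)"] W_pos(5) Z by blast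
  have w5: "(\<exists>v\<in>#M. v \<in> B) \<longleftrightarrow> (\<exists>v\<in>#N. v \<in> B)" using w[of "(5, 0)"] W_pos(6) Z by blast
  consider "\<exists>x\<in>#M. x \<in> A" | "\<exists>x\<in>#M. x \<in> B"
    | "\<forall>x\<in>#M. x \<in> U \<union> L" "\<exists>x\<in>#M. x \<in> U" | "\<forall>x\<in>#M. x \<in> U \<union> L" "\<exists>x\<in>#M. x \<in> L"
    using ne Z unfolding Z_def by blast
  then show ?thesis
  proof cases
    case 1
    obtain x where x: "x \<in># M" "x \<in> A" "\<And>y. y \<in># M \<Longrightarrow> y \<in> A \<union> U \<Longrightarrow> fst x \<le> fst y"
      "\<And>y. y \<in># M \<Longrightarrow> y \<in> A \<union> L \<Longrightarrow> snd x \<le> snd y"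
      using normal_least_A[OF M 1] by blast
    obtain x' where x': "x' \<in># N" "x' \<in> A" "\<And>y. y \<in># N \<Longrightarrow> y \<in> A \<union> U \<Longrightarrow> fst x' \<le> fst y"
      "\<And>y. y \<in># N \<Longrightarrow> y \<in> A \<union> L \<Longrightarrow> snd x' \<le> snd y"
      using normal_least_A[OF N] 1 w4 by blast
    have "fst x = fst x'" by (rule least_value_cong[OF w0]) (use x x' in auto)
    moreover have "snd x = snd x'" by (rule least_value_cong[OF w1]) (use x x' in auto)
    ultimately show ?thesis using x x' by (metis prod_eqI)
  next
    case 2
    obtain x where x: "x \<in># M" "x \<in> B" "\<And>y. y \<in># M \<Longrightarrow> y \<in> L \<union> B \<Longrightarrow> fst y \<le> fst x"
      "\<And>y. y \<in># M \<Longrightarrow> y \<in> U \<union> B \<Longrightarrow> snd y \<le> snd x"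
      using normal_greatest_B[OF M 2] by blast
    obtain x' where x': "x' \<in># N" "x' \<in> B" "\<And>y. y \<in># N \<Longrightarrow> y \<in> L \<union> B \<Longrightarrow> fst y \<le> fst x'"
      "\<And>y. y \<in># N \<Longrightarrow> y \<in> U \<union> B \<Longrightarrow> snd y \<le> snd x'"
      using normal_greatest_B[OF N] 2 w5 by blast
    have "fst x = fst x'" by (rule greatest_value_cong[OF w2]) (use x x' in auto)
    moreover have "snd x = snd x'" by (rule greatest_value_cong[OF w3]) (use x x' in auto)
    ultimately show ?thesis using x x' by (metis prod_eqI)
  next
    case 3
    have M': "y \<notin> A" "y \<notin> B" if "y \<in># M" for y
      using that 3(1) regions_disjoint by blast+
    then have N': "y \<notin> A" "y \<notin> B" if "y \<in># N" for y
      using that w4 w5 by blast+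
    obtain x where x: "x \<in># M" "x \<in> U" "\<And>y. y \<in># M \<Longrightarrow> y \<in> U \<Longrightarrow> fst x \<le> fst y \<and> snd x \<le> snd y"
      using normal_least_in[OF M 3(2)] by blast
    have "\<exists>x\<in>#N. x \<in> U" using w0[of "fst x"] x N' by blast
    then obtain x' where x': "x' \<in># N" "x' \<in> U" "\<And>y. y \<in># N \<Longrightarrow> y \<in> U \<Longrightarrow> fst x' \<le> fst y \<and> snd x' \<le> snd y"
      using normal_least_in[OF N, of U] by blast
    have "fst x = fst x'" by (rule least_value_cong[OF w0]) (use x x' M' N' in auto)
    moreover have "snd x = snd x'" by (rule least_value_cong[OF w3]) (use x x' M' N' in auto)
    ultimately show ?thesis using x x' by (metis prod_eqI)
  next
    case 4
    have M': "y \<notin> A" "y \<notin> B" if "y \<in># M" for y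
      using that 4(1) regions_disjoint by blast+
    then have N': "y \<notin> A" "y \<notin> B" if "y \<in># N" for y
      using that w4 w5 by blast+
    obtain x where x: "x \<in># M" "x \<in> L" "\<And>y. y \<in># M \<Longrightarrow> y \<in> L \<Longrightarrow> fst x \<le> fst y \<and> snd x \<le> snd y"
      using normal_least_in[OF M 4(2)] by blast
    have "\<exists>x\<in>#N. x \<in> L" using w1[of "snd x"] x N' by blast
    then obtain x' where x': "x' \<in># N" "x' \<in> L" "\<And>y. y \<in># N \<Longrightarrow> y \<in> L \<Longrightarrow> fst x' \<le> fst y \<and> snd x' \<le> snd y"
      using normal_least_in[OF N, of L] by blast
    have "fst x = fst x'" by (rule least_value_cong[OF w2]) (use x x' M' N' in auto)
    moreover have "snd x = snd x'" by (rule least_value_cong[OF w1]) (use x x' M' N' in auto)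
    ultimately show ?thesis using x x' by (metis prod_eqI)
  qed
qed

lemma WM_eq_0: "set_mset M \<subseteq> Z \<Longrightarrow> WM M = 0 \<Longrightarrow> M = {#}"
proof (rule ccontr)
  assume sub: "set_mset M \<subseteq> Z" and 0: "WM M = 0" and "M \<noteq> {#}"
  then obtain v where v: "v \<in># M" "v \<in> Z" by (meson multiset_nonemptyE subsetD)
  have "\<not> 0 < Poly_Mapping.lookup (W v) s" for s using lookup_WM_pos[of M s] 0 v by auto
  then show False using W_pos[OF v(2)] v(2) unfolding Z_def by blast
qed

lemma normal_unique:
  assumes "normal M" "normal N" "WM M = WM N"
  shows "M = N"
  using assms
proof (induction "size M" arbitrary: M N)
  case 0
  then show ?case using WM_eq_0[of N] unfolding normal_def by simp
next
  case (Suc k)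
  then have "M \<noteq> {#}" by auto
  then obtain x where x: "x \<in># M" "x \<in># N" using normal_common Suc.prems by blast
  then obtain M' N' where MN: "M = add_mset x M'" "N = add_mset x N'" by (meson multi_member_split)
  have "M' = N'"
    by (rule Suc.hyps(1)) (use Suc MN in \<open>auto simp: normal_def\<close>)
  then show ?case using MN by simp
qed

end

section \<open>The geometry of frame polyominoes\<close>

text \<open>The hole described by columns: column \<open>p\<close> holds the cells in rows
  \<open>lo p\<close> to \<open>hi p - 1\<close>. By \<open>overlap\<close> consecutive columns
  share a row; \<open>lo_start\<close> and \<open>hi_end\<close> say that the two extreme corner
  cells belong to the hole.\<close>

locale frame_data =
  fixes m n a0 ak b0 bk :: int and lo hi :: "int \<Rightarrow> int" and H P :: "cell set"
  assumes bounds: "1 < a0" "a0 < ak" "ak < m" "1 < b0" "b0 < bk" "bk < n"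
    and lo_mono: "\<And>p p'. a0 \<le> p \<Longrightarrow> p \<le> p' \<Longrightarrow> p' < ak \<Longrightarrow> lo p \<le> lo p'"
    and hi_mono: "\<And>p p'. a0 \<le> p \<Longrightarrow> p \<le> p' \<Longrightarrow> p' < ak \<Longrightarrow> hi p \<le> hi p'"
    and lo_hi: "\<And>p. a0 \<le> p \<Longrightarrow> p < ak \<Longrightarrow> lo p < hi p"
    and overlap: "\<And>p. a0 \<le> p \<Longrightarrow> p + 1 < ak \<Longrightarrow> lo (p + 1) < hi p"
    and lo_start: "lo a0 = b0" and hi_end: "hi (ak - 1) = bk"
    and H_eq: "H = {(p, q). a0 \<le> p \<and> p < ak \<and> lo p \<le> q \<and> q < hi p}"
    and P_eq: "P = cells_in (interval (1, 1) (m, n)) - H"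

section \<open>North-east paths and the column heights of the hole\<close>

lemma ne_path_step:
  assumes "north_east_path S" "Suc i < length S"
  shows "S ! Suc i = (fst (S ! i) + 1, snd (S ! i)) \<or> S ! Suc i = (fst (S ! i), snd (S ! i) + 1)"
  using assms unfolding north_east_path_def by (cases "S ! Suc i"; cases "S ! i") force

lemma ne_path_mono:
  assumes "north_east_path S" "i \<le> j" "j < length S"
  shows "fst (S ! i) \<le> fst (S ! j) \<and> snd (S ! i) \<le> snd (S ! j)"
  using assms(2,3)
proof (induction j rule: dec_induct)
  case (step k)
  then show ?case using ne_path_step[OF assms(1), of k] by auto
qed simp

lemma ne_path_bounds:
  assumes "north_east_path S" "i < length S"
  shows "fst (hd S) \<le> fst (S ! i)" "snd (hd S) \<le> snd (S ! i)"
    "fst (S ! i) \<le> fst (last S)" "snd (S ! i) \<le> snd (last S)"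
proof -
  have "S \<noteq> []" using assms by auto
  then show "fst (hd S) \<le> fst (S ! i)" "snd (hd S) \<le> snd (S ! i)"
    "fst (S ! i) \<le> fst (last S)" "snd (S ! i) \<le> snd (last S)"
    using ne_path_mono[OF assms(1), of 0 i] ne_path_mono[OF assms(1), of i "length S - 1"] assms(2)
    by (auto simp: hd_conv_nth last_conv_nth)
qed

text \<open>The step into the first point with abscissa at least \<open>p + 1\<close> has to be the
  east step over this column.\<close>

lemma east_step_exists:
  assumes "north_east_path S" "fst (hd S) \<le> p" "p < fst (last S)"
  shows "\<exists>y. east_step S p y"
proof -
  have ne: "S \<noteq> []" using assms(1) unfolding north_east_path_def by simp
  define k where "k = (LEAST k. k < length S \<and> p + 1 \<le> fst (S ! k))"
  have "length S - 1 < length S \<and> p + 1 \<le> fst (S ! (length S - 1))"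
    using assms ne by (auto simp: last_conv_nth)
  then have k: "k < length S" "p + 1 \<le> fst (S ! k)"
    unfolding k_def by (metis (mono_tags, lifting) LeastI)+
  have "k \<noteq> 0"
  proof
    assume "k = 0"
    then show False using k assms(2) ne by (auto simp: hd_conv_nth)
  qed
  then obtain i where i: "k = Suc i" by (cases k) auto
  have "\<not> (i < length S \<and> p + 1 \<le> fst (S ! i))"
    using not_less_Least[of i "\<lambda>k. k < length S \<and> p + 1 \<le> fst (S ! k)"] i unfolding k_def by simp
  then have "fst (S ! i) \<le> p" using k i by auto
  then have "S ! i = (p, snd (S ! i)) \<and> S ! Suc i = (p + 1, snd (S ! i))"
    using ne_path_step[OF assms(1), of i] k i by (auto intro: prod_eqI)
  then show ?thesis using k i unfolding east_step_def by blast
qed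

lemma east_step_le:
  assumes S: "north_east_path S" and "east_step S p y" "east_step S p' y'" "p \<le> p'"
  shows "y \<le> y'"
proof -
  obtain i i' where i: "Suc i < length S" "S ! i = (p, y)" "S ! Suc i = (p + 1, y)"
    and i': "Suc i' < length S" "S ! i' = (p', y')" "S ! Suc i' = (p' + 1, y')"
    using assms unfolding east_step_def by blast
  have "i \<le> i'"
  proof (rule ccontr)
    assume "\<not> i \<le> i'"
    then show False using ne_path_mono[OF S, of "Suc i'" i] i i' assms(4) by auto
  qed
  then show ?thesis using ne_path_mono[OF S, of i i'] i i' by auto
qed

lemma east_step_unique:
  "north_east_path S \<Longrightarrow> east_step S p y \<Longrightarrow> east_step S p y' \<Longrightarrow> y = y'"
  using east_step_le[of S p y p y'] east_step_le[of S p y' p y] by simp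

text \<open>This gives \<open>lo a0 = b0\<close>: if the lower path began with a north step, so
  would the upper one, and both would pass through the same second point, against
  \<open>lies_above\<close>. The lemma on last steps does the same for
  \<open>hi (ak - 1) = bk\<close>.\<close>

lemma ne_path_first_north:
  assumes S: "north_east_path S" and e: "east_step S (fst (hd S)) y" and y: "snd (hd S) < y"
  shows "2 < length S" "S ! 1 = (fst (hd S), snd (hd S) + 1)"
proof -
  obtain i where i: "Suc i < length S" "S ! i = (fst (hd S), y)"
    using e unfolding east_step_def by blast
  have "i \<noteq> 0" using i y S by (metis hd_conv_nth less_irrefl north_east_path_def snd_conv)
  then show l: "2 < length S" using i by auto
  have h: "S ! 0 = hd S" using i by (cases S) auto
  have "fst (S ! 1) \<le> fst (S ! i)" using ne_path_mono[OF S, of 1 i] i \<open>i \<noteq> 0\<close> by auto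
  then show "S ! 1 = (fst (hd S), snd (hd S) + 1)"
    using ne_path_step[OF S, of 0] l i h by auto
qed

lemma ne_path_last_north:
  assumes S: "north_east_path S" and e: "east_step S (fst (last S) - 1) y" and y: "y < snd (last S)"
  shows "2 < length S" "S ! (length S - 2) = (fst (last S), snd (last S) - 1)"
proof -
  obtain i where i: "Suc i < length S" "S ! Suc i = (fst (last S), y)"
    using e unfolding east_step_def by auto
  have "S \<noteq> []" using i by auto
  then have last: "last S = S ! (length S - 1)" by (rule last_conv_nth)
  have ne: "Suc i \<noteq> length S - 1" using i y last by (metis less_irrefl snd_conv)
  then show l: "2 < length S" using i by auto
  have "fst (S ! Suc i) \<le> fst (S ! (length S - 2))"
    using ne_path_mono[OF S, of "Suc i" "length S - 2"] i ne by auto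
  moreover have "Suc (length S - 2) = length S - 1" using l by auto
  then have "S ! (length S - 1) = (fst (S ! (length S - 2)) + 1, snd (S ! (length S - 2))) \<or>
      S ! (length S - 1) = (fst (S ! (length S - 2)), snd (S ! (length S - 2)) + 1)"
    using ne_path_step[OF S, of "length S - 2"] l by simp
  moreover have "fst (S ! Suc i) = fst (S ! (length S - 1))" using i last by simp
  ultimately show "S ! (length S - 2) = (fst (last S), snd (last S) - 1)"
    unfolding last by (auto intro!: prod_eqI)
qed

lemma frame_polyomino_data:
  assumes "frame_polyomino P"
  shows "\<exists>m n a0 ak b0 bk lo hi H. frame_data m n a0 ak b0 bk lo hi H P"
proof -
  obtain m n S1 S2 H where par: "parallelogram_polyomino S1 S2 H"
    and b: "1 < fst (hd S1)" "fst (hd S1) < fst (last S1)" "fst (last S1) < m"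
      "1 < snd (hd S1)" "snd (hd S1) < snd (last S1)" "snd (last S1) < n"
    and P: "P = cells_in (interval (1, 1) (m, n)) - H"
    using assms unfolding frame_polyomino_def by blast
  have S1: "north_east_path S1" and S2: "north_east_path S2" and len: "length S1 = length S2"
    and hd: "hd S1 = hd S2" and last: "last S1 = last S2" and above: "lies_above S1 S2"
    and H: "H = region_between S1 S2" and poly: "polyomino H"
    using par unfolding parallelogram_polyomino_def by auto
  define a0 ak b0 bk where ab: "a0 = fst (hd S1)" "ak = fst (last S1)" "b0 = snd (hd S1)" "bk = snd (last S1)"
  define hi lo where "hi p = (THE y. east_step S1 p y)" and "lo p = (THE y. east_step S2 p y)" for p
  have hi: "east_step S1 p y \<longleftrightarrow> y = hi p" and lo: "east_step S2 p y \<longleftrightarrow> y = lo p"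
    if "a0 \<le> p" "p < ak" for p y
  proof -
    have "\<exists>!y. east_step S1 p y" "\<exists>!y. east_step S2 p y"
      using east_step_exists[OF S1, of p] east_step_exists[OF S2, of p] that ab hd last
        east_step_unique[OF S1, of p] east_step_unique[OF S2, of p] by auto
    then show "east_step S1 p y \<longleftrightarrow> y = hi p" "east_step S2 p y \<longleftrightarrow> y = lo p"
      unfolding hi_def lo_def by (metis theI')+
  qed
  have range: "a0 \<le> p \<and> p < ak" if "east_step S1 p y \<or> east_step S2 p y" for p y
  proof -
    have "a0 \<le> p \<and> p + 1 \<le> ak"
      using that
    proof
      assume "east_step S1 p y"
      then obtain i where "Suc i < length S1" "S1 ! i = (p, y)" "S1 ! Suc i = (p + 1, y)"
        unfolding east_step_def by blast
      then show ?thesis using ne_path_bounds[OF S1, of i] ne_path_bounds[OF S1, of "Suc i"] ab by auto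
    next
      assume "east_step S2 p y"
      then obtain i where "Suc i < length S2" "S2 ! i = (p, y)" "S2 ! Suc i = (p + 1, y)"
        unfolding east_step_def by blast
      then show ?thesis using ne_path_bounds[OF S2, of i] ne_path_bounds[OF S2, of "Suc i"] ab hd last by auto
    qed
    then show ?thesis by simp
  qed
  have H_eq: "H = {(p, q). a0 \<le> p \<and> p < ak \<and> lo p \<le> q \<and> q < hi p}"
  proof -
    have "(p, q) \<in> H \<longleftrightarrow> a0 \<le> p \<and> p < ak \<and> lo p \<le> q \<and> q < hi p" for p q
    proof (cases "a0 \<le> p \<and> p < ak")
      case True
      then show ?thesis unfolding H region_between_def by (auto simp: hi lo)
    next
      case False
      then show ?thesis unfolding H region_between_def using range by blast
    qed
    then show ?thesis by auto
  qed
  have above': "snd (S2 ! j) < snd (S1 ! i)"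
    if "1 \<le> i" "i < length S1 - 1" "1 \<le> j" "j < length S2 - 1" "fst (S1 ! i) = fst (S2 ! j)" for i j
    using above that unfolding lies_above_def by blast
  \<comment> \<open>\<open>lies_above\<close> speaks only of points that are not end points, so it
    is recorded here when the ends of the two east steps are of that kind.\<close>
  have steps: "\<exists>i j. Suc i < length S1 \<and> S1 ! i = (p, hi p) \<and> S1 ! Suc i = (p + 1, hi p) \<and>
     Suc j < length S2 \<and> S2 ! j = (p, lo p) \<and> S2 ! Suc j = (p + 1, lo p) \<and>
     (a0 < p \<longrightarrow> 1 \<le> i \<and> 1 \<le> j) \<and> (p + 1 < ak \<longrightarrow> Suc i < length S1 - 1 \<and> Suc j < length S2 - 1)"
    if p: "a0 \<le> p" "p < ak" for p
  proof -
    obtain i where i: "Suc i < length S1" "S1 ! i = (p, hi p)" "S1 ! Suc i = (p + 1, hi p)"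
      using hi[OF p, of "hi p"] unfolding east_step_def by auto
    obtain j where j: "Suc j < length S2" "S2 ! j = (p, lo p)" "S2 ! Suc j = (p + 1, lo p)"
      using lo[OF p, of "lo p"] unfolding east_step_def by auto
    have ne: "S1 \<noteq> []" "S2 \<noteq> []" using i j by auto
    have "i \<noteq> 0 \<and> j \<noteq> 0" if "a0 < p"
      using that i j ab hd ne by (metis fst_conv hd_conv_nth less_irrefl)
    moreover have "Suc i \<noteq> length S1 - 1 \<and> Suc j \<noteq> length S2 - 1" if "p + 1 < ak"
      using that i j ab last ne by (metis fst_conv last_conv_nth less_irrefl)
    ultimately have "(a0 < p \<longrightarrow> 1 \<le> i \<and> 1 \<le> j) \<and> (p + 1 < ak \<longrightarrow> Suc i < length S1 - 1 \<and> Suc j < length S2 - 1)"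
      using i j by linarith
    then show ?thesis using i j by blast
  qed
  have lo_hi: "lo p < hi p" if p: "a0 \<le> p" "p < ak" for p
  proof -
    obtain i j where ij: "Suc i < length S1" "S1 ! i = (p, hi p)" "S1 ! Suc i = (p + 1, hi p)"
     "Suc j < length S2" "S2 ! j = (p, lo p)" "S2 ! Suc j = (p + 1, lo p)"
     "a0 < p \<longrightarrow> 1 \<le> i \<and> 1 \<le> j" "p + 1 < ak \<longrightarrow> Suc i < length S1 - 1 \<and> Suc j < length S2 - 1"
      using steps[OF p] by blast
    consider "a0 < p" | "p + 1 < ak" | "p = a0" "ak = a0 + 1" using p by linarith
    then show ?thesis
    proof cases
      case 1
      then show ?thesis using above'[of i j] ij by auto
    next
      case 2
      then show ?thesis using above'[of "Suc i" "Suc j"] ij by auto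
    next
      \<comment> \<open>For a hole one column wide \<open>lies_above\<close> may hold vacuously; the
        inequality comes from the hole being nonempty.\<close>
      case 3
      have "H \<noteq> {}" using poly unfolding polyomino_def by simp
      then obtain p' q where "a0 \<le> p'" "p' < ak" "lo p' \<le> q" "q < hi p'" using H_eq by auto
      then show ?thesis using 3 by auto
    qed
  qed
  have overlap: "lo (p + 1) < hi p" if p: "a0 \<le> p" "p + 1 < ak" for p
  proof -
    \<comment> \<open>The end of the upper east step over \<open>p\<close> and the start of the
      lower one over \<open>p + 1\<close> are inner points of the paths with the same
      abscissa.\<close>
    obtain i where i: "Suc i < length S1" "S1 ! Suc i = (p + 1, hi p)" "Suc i < length S1 - 1"
      using steps[of p] p by auto
    obtain j where j: "Suc j < length S2" "S2 ! j = (p + 1, lo (p + 1))" "1 \<le> j"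
      using steps[of "p + 1"] p by auto
    show ?thesis using above'[of "Suc i" j] i j by auto
  qed
  have "a0 < ak" using b ab by auto
  have lo_ge: "b0 \<le> lo a0"
  proof -
    obtain j where "Suc j < length S2" "S2 ! j = (a0, lo a0)" using steps[of a0] \<open>a0 < ak\<close> by blast
    then show ?thesis using ne_path_bounds(2)[OF S2, of j] ab hd by simp
  qed
  have hi_le: "hi (ak - 1) \<le> bk"
  proof -
    obtain j where "Suc j < length S1" "S1 ! j = (ak - 1, hi (ak - 1))"
      using steps[of "ak - 1"] \<open>a0 < ak\<close> by auto
    then show ?thesis using ne_path_bounds(4)[OF S1, of j] ab by simp
  qed
  have lo_start: "lo a0 = b0"
  proof (rule ccontr)
    assume "lo a0 \<noteq> b0"
    then have lt: "b0 < lo a0" "b0 < hi a0" using lo_ge lo_hi[of a0] \<open>a0 < ak\<close> by auto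
    have "east_step S2 (fst (hd S2)) (lo a0)" "east_step S1 (fst (hd S1)) (hi a0)"
      using lo hi \<open>a0 < ak\<close> ab hd by auto
    then have "S1 ! 1 = (a0, b0 + 1)" "S2 ! 1 = (a0, b0 + 1)" "2 < length S1" "2 < length S2"
      using ne_path_first_north[OF S1] ne_path_first_north[OF S2] lt ab hd by auto
    moreover from this have "1 < length S1 - 1" "1 < length S2 - 1" by linarith+
    ultimately show False using above'[of 1 1] by simp
  qed
  have hi_end: "hi (ak - 1) = bk"
  proof (rule ccontr)
    assume "hi (ak - 1) \<noteq> bk"
    then have lt: "hi (ak - 1) < bk" "lo (ak - 1) < bk" using hi_le lo_hi[of "ak - 1"] \<open>a0 < ak\<close> by auto
    have "east_step S2 (fst (last S2) - 1) (lo (ak - 1))" "east_step S1 (fst (last S1) - 1) (hi (ak - 1))"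
      using lo hi \<open>a0 < ak\<close> ab last by auto
    then have "S1 ! (length S1 - 2) = (ak, bk - 1)" "S2 ! (length S2 - 2) = (ak, bk - 1)"
      "2 < length S1" "2 < length S2"
      using ne_path_last_north[OF S1] ne_path_last_north[OF S2] lt ab last by auto
    moreover from this have "1 \<le> length S1 - 2" "length S1 - 2 < length S1 - 1"
      "1 \<le> length S2 - 2" "length S2 - 2 < length S2 - 1" by linarith+
    ultimately show False using above'[of "length S1 - 2" "length S2 - 2"] by simp
  qed
  have "frame_data m n a0 ak b0 bk lo hi H P"
  proof
    show "lo p \<le> lo p'" if "a0 \<le> p" "p \<le> p'" "p' < ak" for p p'
      using east_step_le[OF S2, of p _ p'] lo that by auto
    show "hi p \<le> hi p'" if "a0 \<le> p" "p \<le> p'" "p' < ak" for p p'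
      using east_step_le[OF S1, of p _ p'] hi that by auto
  qed (use b ab lo_hi overlap lo_start hi_end H_eq P in auto)
  then show ?thesis by blast
qed

section \<open>The regions around the hole, for vertices and for cells\<close>

context frame_data
begin

text \<open>Vertices in column \<open>i\<close> touch the cell columns \<open>i - 1\<close> and
  \<open>i\<close>. Both boundaries being monotone, the binding upper one is that of
  \<open>i - 1\<close> and the binding lower one that of \<open>i\<close>. The constant values only
  separate \<open>U\<close> from \<open>A\<close> and \<open>L\<close> from
  \<open>B\<close>.\<close>

definition upV :: "int \<Rightarrow> int" where "upV i = (if i \<le> a0 then b0 + 1 else hi (i - 1))"
definition dnV :: "int \<Rightarrow> int" where "dnV i = (if i < ak then lo i else bk - 1)"
definition upC :: "int \<Rightarrow> int" where "upC p = (if p < a0 then b0 else hi p)"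
definition dnC :: "int \<Rightarrow> int" where "dnC p = (if p < ak then lo p - 1 else bk - 1)"

lemma lo_ge: "a0 \<le> p \<Longrightarrow> p < ak \<Longrightarrow> b0 \<le> lo p"
  using lo_mono[of a0 p] lo_start by simp

lemma hi_le: "a0 \<le> p \<Longrightarrow> p < ak \<Longrightarrow> hi p \<le> bk"
  using hi_mono[of p "ak - 1"] hi_end by simp

lemma hi_gt: "a0 \<le> p \<Longrightarrow> p < ak \<Longrightarrow> b0 < hi p"
  using lo_ge[of p] lo_hi[of p] by simp

lemma lo_lt: "a0 \<le> p \<Longrightarrow> p < ak \<Longrightarrow> lo p < bk"
  using hi_le[of p] lo_hi[of p] by simp

sublocale V: ring_regions a0 b0 ak bk m n upV dnV
proof
  show "upV i \<le> upV i'" if "1 \<le> i" "i \<le> i'" "i' < ak" for i i'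
    using that hi_mono[of "i - 1" "i' - 1"] hi_gt[of "i' - 1"] unfolding upV_def by auto
  show "upV i \<le> bk" if "1 \<le> i" "i < ak" for i
    using that hi_le[of "i - 1"] bounds unfolding upV_def by auto
  show "dnV i \<le> dnV i'" if "a0 < i" "i \<le> i'" "i' \<le> m" for i i'
    using that lo_mono[of i i'] lo_lt[of i] unfolding dnV_def by auto
  show "b0 \<le> dnV i" if "a0 < i" "i \<le> m" for i
    using that lo_ge[of i] bounds unfolding dnV_def by auto
  show "dnV i < upV i" if "a0 < i" "i < ak" for i
    using that overlap[of "i - 1"] unfolding dnV_def upV_def by auto
qed (use bounds in \<open>auto simp: upV_def dnV_def\<close>)

text \<open>For cells the corner region ends at \<open>a0 - 1\<close> and \<open>b0 - 1\<close>:
  vertices with abscissa \<open>a0\<close> still lie on the west border of the hole, but cells with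
  that lower left abscissa lie in its first column. The bounds \<open>m - 1\<close> and
  \<open>n - 1\<close> are those of lower left corners.\<close>

sublocale C: ring_regions "a0 - 1" "b0 - 1" ak bk "m - 1" "n - 1" upC dnC
proof
  show "upC i \<le> upC i'" if "1 \<le> i" "i \<le> i'" "i' < ak" for i i'
    using that hi_mono[of i i'] hi_gt[of i'] unfolding upC_def by auto
  show "upC i \<le> bk" if "1 \<le> i" "i < ak" for i
    using that hi_le[of i] bounds unfolding upC_def by auto
  show "dnC i \<le> dnC i'" if "a0 - 1 < i" "i \<le> i'" "i' \<le> m - 1" for i i'
    using that lo_mono[of i i'] lo_lt[of i] unfolding dnC_def by auto
  show "b0 - 1 \<le> dnC i" if "a0 - 1 < i" "i \<le> m - 1" for i
    using that lo_ge[of i] bounds unfolding dnC_def by auto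
  show "dnC i < upC i" if "a0 - 1 < i" "i < ak" for i
    using that lo_hi[of i] unfolding dnC_def upC_def by auto
qed (use bounds in \<open>auto simp: upC_def dnC_def\<close>)

lemma cells_in_interval:
  "cells_in (interval (i, j) (k, l)) = {(p, q). i \<le> p \<and> p < k \<and> j \<le> q \<and> q < l}"
proof -
  have "cell_vertices (p, q) \<subseteq> interval (i, j) (k, l) \<longleftrightarrow> i \<le> p \<and> p < k \<and> j \<le> q \<and> q < l" for p q
  proof
    assume "cell_vertices (p, q) \<subseteq> interval (i, j) (k, l)"
    moreover have "(p, q) \<in> cell_vertices (p, q)" "(p + 1, q + 1) \<in> cell_vertices (p, q)"
      by (auto simp: cell_vertices_def interval_def)
    ultimately show "i \<le> p \<and> p < k \<and> j \<le> q \<and> q < l" by (auto simp: interval_def)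
  qed (auto simp: cell_vertices_def interval_def)
  then show ?thesis unfolding cells_in_def by auto
qed

lemma mem_P: "(p, q) \<in> P \<longleftrightarrow> 1 \<le> p \<and> p < m \<and> 1 \<le> q \<and> q < n \<and> (p, q) \<notin> H"
  unfolding P_eq cells_in_interval by auto

lemma mem_H: "(p, q) \<in> H \<longleftrightarrow> a0 \<le> p \<and> p < ak \<and> lo p \<le> q \<and> q < hi p"
  unfolding H_eq by auto

lemma finite_P: "finite P"
proof (rule finite_subset)
  show "P \<subseteq> {1..m} \<times> {1..n}" using mem_P by auto
qed simp

lemma cells_eq: "P = C.Z"
proof -
  have "(p, q) \<in> P \<longleftrightarrow> (p, q) \<in> C.Z" for p q
  proof -
    consider "p < a0" | "a0 \<le> p" "p < ak" | "ak \<le> p" by linarith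
    then show ?thesis
    proof cases
      case 2
      then show ?thesis using bounds lo_ge[of p] hi_le[of p] lo_hi[of p]
        unfolding mem_P mem_H C.Z_def C.region_defs upC_def dnC_def by auto
    qed (use bounds in \<open>auto simp: mem_P mem_H C.Z_def C.region_defs upC_def dnC_def\<close>)
  qed
  then show ?thesis by auto
qed

text \<open>The points excluded by the last condition are those all of whose four cells lie in the
  hole.\<close>

lemma mem_VZ: "(i, j) \<in> V.Z \<longleftrightarrow> 1 \<le> i \<and> i \<le> m \<and> 1 \<le> j \<and> j \<le> n \<and>
  \<not> (a0 < i \<and> i < ak \<and> lo i < j \<and> j < hi (i - 1))"
proof -
  consider "i \<le> a0" | "a0 < i" "i < ak" | "ak \<le> i" by linarith
  then show ?thesis
  proof cases
    case 2
    then show ?thesis using bounds lo_lt[of i] hi_gt[of "i - 1"] overlap[of "i - 1"]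
      unfolding V.Z_def V.region_defs upV_def dnV_def by auto
  qed (use bounds in \<open>auto simp: V.Z_def V.region_defs upV_def dnV_def\<close>)
qed

lemma mem_vertex_set: "(i, j) \<in> vertex_set P \<longleftrightarrow>
  (\<exists>p q. (p, q) \<in> P \<and> (i = p \<or> i = p + 1) \<and> (j = q \<or> j = q + 1))"
proof -
  have "(i, j) \<in> cell_vertices (p, q) \<longleftrightarrow> (i = p \<or> i = p + 1) \<and> (j = q \<or> j = q + 1)" for p q
    unfolding cell_vertices_def interval_def by auto
  then show ?thesis unfolding vertex_set_def by auto
qed

lemma in_vertex_set:
  "(p, q) \<in> P \<Longrightarrow> i = p \<or> i = p + 1 \<Longrightarrow> j = q \<or> j = q + 1 \<Longrightarrow> (i, j) \<in> vertex_set P"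
  unfolding mem_vertex_set by blast

lemma vertices_eq: "vertex_set P = V.Z"
proof -
  have "(i, j) \<in> vertex_set P \<longleftrightarrow> (i, j) \<in> V.Z" for i j
  proof
    assume "(i, j) \<in> vertex_set P"
    then obtain p q where pq: "(p, q) \<in> P" "i = p \<or> i = p + 1" "j = q \<or> j = q + 1"
      using mem_vertex_set by blast
    have "(p, q) \<in> H" if "a0 < i" "i < ak" "lo i < j" "j < hi (i - 1)"
      using that pq lo_mono[of "i - 1" i] hi_mono[of "i - 1" i] unfolding mem_H by auto
    then show "(i, j) \<in> V.Z" using pq unfolding mem_VZ mem_P by auto
  next
    assume ij: "(i, j) \<in> V.Z"
    then have r: "1 \<le> i" "i \<le> m" "1 \<le> j" "j \<le> n" "\<not> (a0 < i \<and> i < ak \<and> lo i < j \<and> j < hi (i - 1))"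
      unfolding mem_VZ by auto
    consider "i \<le> a0" | "ak \<le> i" | "a0 < i" "i < ak" "j \<le> lo i" | "a0 < i" "i < ak" "hi (i - 1) \<le> j"
      using r by linarith
    then show "(i, j) \<in> vertex_set P"
    proof cases
      case 1
      then have "(max (i - 1) 1, max (j - 1) 1) \<in> P" using r bounds by (auto simp: mem_P mem_H)
      then show ?thesis by (rule in_vertex_set) (use r in auto)
    next
      case 2
      then have "(min i (m - 1), max (j - 1) 1) \<in> P" using r bounds by (auto simp: mem_P mem_H)
      then show ?thesis by (rule in_vertex_set) (use r in auto)
    next
      case 3
      then have "(i, max (j - 1) 1) \<in> P" using r bounds lo_ge[of i] by (auto simp: mem_P mem_H)
      then show ?thesis by (rule in_vertex_set) (use r in auto)
    next
      case 4
      then have "(i - 1, min j (n - 1)) \<in> P" using r bounds hi_gt[of "i - 1"] hi_le[of "i - 1"] by (auto simp: mem_P mem_H)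
      then show ?thesis by (rule in_vertex_set) (use r in auto)
    qed
  qed
  then show ?thesis by auto
qed

text \<open>Discrete intermediate value argument: the last column whose lower boundary is at most
  height \<open>y\<close> either is \<open>p1\<close> or has, by the overlap of consecutive columns, its top above \<open>y\<close>.\<close>

lemma hole_meets:
  assumes p: "a0 \<le> p0" "p0 \<le> p1" "p1 < ak" and lo0: "lo p0 \<le> y" and hi1: "y' < hi p1" and y: "y' \<le> y"
  shows "\<exists>p q. p0 \<le> p \<and> p \<le> p1 \<and> y' \<le> q \<and> q \<le> y \<and> (p, q) \<in> H"
proof -
  have "\<exists>p. p0 \<le> p \<and> p \<le> p1 \<and> lo p \<le> y \<and> y' < hi p"
    using p(2) p(1) lo0
  proof (induction p0 rule: int_le_induct)
    case base
    then show ?case using hi1 by auto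
  next
    case (step i)
    show ?case
    proof (cases "lo i \<le> y")
      case True
      then obtain p where "i \<le> p" "p \<le> p1" "lo p \<le> y" "y' < hi p" using step by auto
      then show ?thesis by (intro exI[of _ p]) auto
    next
      case False
      then have "y' < hi (i - 1)" using overlap[of "i - 1"] step y p by auto
      then show ?thesis using step by (intro exI[of _ "i - 1"]) auto
    qed
  qed
  then obtain q where q: "p0 \<le> q" "q \<le> p1" "lo q \<le> y" "y' < hi q" by blast
  then have "(q, max (lo q) y') \<in> H" using p lo_hi[of q] by (auto simp: mem_H)
  then show ?thesis using q y by (intro exI[of _ q] exI[of _ "max (lo q) y'"]) auto
qed

text \<open>If \<open>v\<close> is not in \<open>L\<close>, all hole cells west of \<open>v\<close>
  lie below it; if \<open>u\<close> is not in \<open>U\<close>, all hole cells east of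
  \<open>u\<close> lie above it. Either way the rectangle misses the hole.\<close>

lemma V_hole_free:
  assumes u: "u \<in> V.Z" and v: "v \<in> V.Z" and uv: "antidiag u v" and nb: "\<not> (u \<in> V.U \<and> v \<in> V.L)"
    and pq: "fst u \<le> p" "p < fst v" "snd v \<le> q" "q < snd u"
  shows "(p, q) \<notin> H"
proof
  assume "(p, q) \<in> H"
  then have h: "a0 \<le> p" "p < ak" "lo p \<le> q" "q < hi p" by (auto simp: mem_H)
  show False
  proof (cases "v \<in> V.L")
    case False
    then have "v \<in> V.A \<or> v \<in> V.U \<or> v \<in> V.B" using v unfolding V.Z_def by auto
    then show False
      using h pq hi_mono[of p "fst v - 1"] hi_le[of p] unfolding V.region_defs upV_def
      by (auto split: if_splits)
  next
    case True
    then have "u \<in> V.A \<or> u \<in> V.L \<or> u \<in> V.B" using u nb unfolding V.Z_def by auto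
    then show False
      using h pq lo_mono[of "fst u" p] lo_ge[of p] unfolding V.region_defs dnV_def
      by (auto split: if_splits)
  qed
qed

lemma V_hole_hit:
  assumes u: "u \<in> V.U" and v: "v \<in> V.L" and uv: "antidiag u v"
  shows "\<exists>p q. fst u \<le> p \<and> p < fst v \<and> snd v \<le> q \<and> q < snd u \<and> (p, q) \<in> H"
proof -
  \<comment> \<open>The cell columns common to the rectangle and the hole; clipping is needed since
    \<open>u\<close> may lie west of the hole and \<open>v\<close> east of it.\<close>
  define p0 p1 where "p0 = max (fst u) a0" and "p1 = min (fst v) ak - 1"
  have lt: "fst u < fst v" "snd v < snd u" using uv unfolding antidiag_def by auto
  have r: "a0 \<le> p0" "p0 \<le> p1" "p1 < ak" "fst u < ak" "a0 < fst v"
    using u v lt bounds unfolding p0_def p1_def V.region_defs by auto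
  have "lo p0 < snd u"
  proof (cases "fst u \<le> a0")
    case True
    then show ?thesis using u lo_start unfolding p0_def V.region_defs by auto
  next
    case False
    then show ?thesis using u r overlap[of "fst u - 1"] unfolding p0_def V.region_defs upV_def by auto
  qed
  moreover have "snd v < hi p1"
  proof (cases "ak \<le> fst v")
    case True
    then show ?thesis using v hi_end unfolding p1_def V.region_defs by auto
  next
    case False
    then show ?thesis using v r overlap[of "fst v - 1"] unfolding p1_def V.region_defs dnV_def by auto
  qed
  ultimately have "\<exists>p q. p0 \<le> p \<and> p \<le> p1 \<and> snd v \<le> q \<and> q \<le> snd u - 1 \<and> (p, q) \<in> H"
    using r lt by (intro hole_meets) auto
  then show ?thesis unfolding p0_def p1_def by force
qed

lemma C_hole_free:
  assumes u: "u \<in> P" and v: "v \<in> P" and nb: "\<not> (u \<in> C.U \<and> v \<in> C.L)"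
    and pq: "fst u \<le> p" "p \<le> fst v" "snd v \<le> q" "q \<le> snd u"
  shows "(p, q) \<notin> H"
proof
  assume "(p, q) \<in> H"
  then have h: "a0 \<le> p" "p < ak" "lo p \<le> q" "q < hi p" by (auto simp: mem_H)
  show False
  proof (cases "v \<in> C.L")
    case False
    then have "v \<in> C.A \<or> v \<in> C.U \<or> v \<in> C.B" using v unfolding cells_eq C.Z_def by auto
    then show False
      using h pq hi_mono[of p "fst v"] hi_le[of p] unfolding C.region_defs upC_def
      by (auto split: if_splits)
  next
    case True
    then have "u \<in> C.A \<or> u \<in> C.L \<or> u \<in> C.B" using u nb unfolding cells_eq C.Z_def by auto
    then show False
      using h pq lo_mono[of "fst u" p] lo_ge[of p] unfolding C.region_defs dnC_def
      by (auto split: if_splits)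
  qed
qed

lemma C_hole_hit:
  assumes u: "u \<in> C.U" and v: "v \<in> C.L" and lt: "fst u \<le> fst v" "snd v \<le> snd u"
  shows "\<exists>p q. fst u \<le> p \<and> p \<le> fst v \<and> snd v \<le> q \<and> q \<le> snd u \<and> (p, q) \<in> H"
proof -
  define p0 p1 where "p0 = max (fst u) a0" and "p1 = min (fst v) (ak - 1)"
  have r: "a0 \<le> p0" "p0 \<le> p1" "p1 < ak" "fst u < ak" "a0 \<le> fst v"
    using u v lt bounds unfolding p0_def p1_def C.region_defs by auto
  have "lo p0 \<le> snd u"
  proof (cases "fst u < a0")
    case True
    then show ?thesis using u lo_start unfolding p0_def C.region_defs by auto
  next
    case False
    then show ?thesis using u r lo_hi[of "fst u"] unfolding p0_def C.region_defs upC_def by auto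
  qed
  moreover have "snd v < hi p1"
  proof (cases "ak \<le> fst v")
    case True
    then show ?thesis using v hi_end unfolding p1_def C.region_defs by auto
  next
    case False
    then show ?thesis using v r lo_hi[of "fst v"] unfolding p1_def C.region_defs dnC_def by auto
  qed
  ultimately have "\<exists>p q. p0 \<le> p \<and> p \<le> p1 \<and> snd v \<le> q \<and> q \<le> snd u \<and> (p, q) \<in> H"
    using r lt by (intro hole_meets) auto
  then show ?thesis unfolding p0_def p1_def by force
qed

lemma inner_interval_vertices:
  assumes "inner_interval P (i, j) (k, l)"
  shows "i < k" "j < l" "(i, j) \<in> V.Z" "(k, l) \<in> V.Z" "(i, l) \<in> V.Z" "(k, j) \<in> V.Z"
    "\<not> ((i, l) \<in> V.U \<and> (k, j) \<in> V.L)"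
proof -
  show lt: "i < k" "j < l" using assms unfolding inner_interval_def proper_corners_def by auto
  have sub: "(p, q) \<in> P" if "i \<le> p" "p < k" "j \<le> q" "q < l" for p q
    using assms that unfolding inner_interval_def cells_in_interval by auto
  have "(i, j) \<in> P" "(i, l - 1) \<in> P" "(k - 1, j) \<in> P" "(k - 1, l - 1) \<in> P"
    using sub lt by auto
  then show "(i, j) \<in> V.Z" "(k, l) \<in> V.Z" "(i, l) \<in> V.Z" "(k, j) \<in> V.Z"
    unfolding vertices_eq[symmetric] mem_vertex_set by (metis diff_add_cancel)+
  show "\<not> ((i, l) \<in> V.U \<and> (k, j) \<in> V.L)"
    using V_hole_hit[of "(i, l)" "(k, j)"] lt sub mem_P unfolding antidiag_def by auto
qed

text \<open>Every admissible rewriting step thus comes from a generator of the ideal.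
  \<open>inner_interval_vertices\<close> gives the converse, so that generators and rewriting steps
  correspond.\<close>

lemma V_inner_interval:
  assumes "u \<in> V.Z" "v \<in> V.Z" "antidiag u v" "\<not> (u \<in> V.U \<and> v \<in> V.L)"
  shows "inner_interval P (fst u, snd v) (fst v, snd u)"
proof -
  obtain i l k j where uv: "u = (i, l)" "v = (k, j)" by (cases u, cases v)
  have "(p, q) \<in> P" if "i \<le> p" "p < k" "j \<le> q" "q < l" for p q
    using that V_hole_free[OF assms, of p q] assms(1,2)[unfolded uv mem_VZ] uv unfolding mem_P by auto
  then show ?thesis using assms(3) uv
    unfolding inner_interval_def proper_corners_def cells_in_interval antidiag_def by auto
qed

end

section \<open>The clique identity for frames\<close>

context frame_data
begin

text \<open>Its cliques are to be the supports of normal multisets, so comparability is weak. For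
  \<open>adjC\<close> it is strict, because rooks on a common line attack each other unless the hole
  separates them.\<close>

definition adjV :: "point \<Rightarrow> point \<Rightarrow> bool" where
  "adjV x y \<longleftrightarrow> (antidiag x y \<longrightarrow> x \<in> V.U \<and> y \<in> V.L) \<and> (antidiag y x \<longrightarrow> y \<in> V.U \<and> x \<in> V.L)"

definition adjC :: "cell \<Rightarrow> cell \<Rightarrow> bool" where
  "adjC x y \<longleftrightarrow> fst x < fst y \<and> snd x < snd y \<or> fst y < fst x \<and> snd y < snd x
     \<or> x \<in> C.U \<and> y \<in> C.L \<or> y \<in> C.U \<and> x \<in> C.L"

lemma symp_adjV: "symp adjV" unfolding symp_def adjV_def by auto
lemma symp_adjC: "symp adjC" unfolding symp_def adjC_def by auto

lemma adjV_no_UL: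
  assumes "\<not> (x \<in> V.U \<and> y \<in> V.L)" "\<not> (y \<in> V.U \<and> x \<in> V.L)"
  shows "adjV x y \<longleftrightarrow> \<not> antidiag x y \<and> \<not> antidiag y x"
  using assms unfolding adjV_def by auto

lemma adjC_no_UL:
  assumes "\<not> (x \<in> C.U \<and> y \<in> C.L)" "\<not> (y \<in> C.U \<and> x \<in> C.L)"
  shows "adjC x y \<longleftrightarrow> fst x < fst y \<and> snd x < snd y \<or> fst y < fst x \<and> snd y < snd x"
  using assms unfolding adjC_def by auto

lemma adjV_same:
  assumes "x \<in> R" "y \<in> R" "R \<in> {V.A, V.U, V.L, V.B}" "x \<noteq> y"
  shows "adjV x y \<longleftrightarrow> fst x \<le> fst y \<and> snd x \<le> snd y \<or> fst y \<le> fst x \<and> snd y \<le> snd x"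
proof -
  have "x \<in> V.A \<and> y \<in> V.A \<or> x \<in> V.U \<and> y \<in> V.U \<or> x \<in> V.L \<and> y \<in> V.L \<or> x \<in> V.B \<and> y \<in> V.B"
    using assms by auto
  then have "\<not> (x \<in> V.U \<and> y \<in> V.L)" "\<not> (y \<in> V.U \<and> x \<in> V.L)"
    using V.regions_disjoint by blast+
  then have "adjV x y \<longleftrightarrow> \<not> antidiag x y \<and> \<not> antidiag y x"
    by (rule adjV_no_UL)
  then show ?thesis using assms(4) unfolding antidiag_def by (cases x; cases y) auto
qed

lemma adjC_same:
  assumes "x \<in> R" "y \<in> R" "R \<in> {C.A, C.U, C.L, C.B}"
  shows "adjC x y \<longleftrightarrow> fst x < fst y \<and> snd x < snd y \<or> fst y < fst x \<and> snd y < snd x"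
proof -
  have "x \<in> C.A \<and> y \<in> C.A \<or> x \<in> C.U \<and> y \<in> C.U \<or> x \<in> C.L \<and> y \<in> C.L \<or> x \<in> C.B \<and> y \<in> C.B"
    using assms by auto
  then have "\<not> (x \<in> C.U \<and> y \<in> C.L)" "\<not> (y \<in> C.U \<and> x \<in> C.L)"
    using C.regions_disjoint by blast+
  then show ?thesis by (rule adjC_no_UL)
qed

lemma adjV_UA:
  assumes "u \<in> V.U" "x \<in> V.A"
  shows "adjV u x \<longleftrightarrow> fst x \<le> fst u"
proof -
  have "adjV u x \<longleftrightarrow> \<not> antidiag u x \<and> \<not> antidiag x u"
    by (rule adjV_no_UL) (use assms V.regions_disjoint in blast)+
  then show ?thesis using assms bounds unfolding antidiag_def V.region_defs by auto
qed

lemma adjV_UB: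
  assumes "u \<in> V.U" "x \<in> V.B"
  shows "adjV u x \<longleftrightarrow> snd u \<le> snd x"
proof -
  have "adjV u x \<longleftrightarrow> \<not> antidiag u x \<and> \<not> antidiag x u"
    by (rule adjV_no_UL) (use assms V.regions_disjoint in blast)+
  then show ?thesis using assms bounds unfolding antidiag_def V.region_defs by auto
qed

lemma adjV_LA:
  assumes "u \<in> V.L" "x \<in> V.A"
  shows "adjV u x \<longleftrightarrow> snd x \<le> snd u"
proof -
  have "adjV u x \<longleftrightarrow> \<not> antidiag u x \<and> \<not> antidiag x u"
    by (rule adjV_no_UL) (use assms V.regions_disjoint in blast)+
  then show ?thesis using assms bounds unfolding antidiag_def V.region_defs by auto
qed

lemma adjV_LB:
  assumes "u \<in> V.L" "x \<in> V.B"
  shows "adjV u x \<longleftrightarrow> fst u \<le> fst x"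
proof -
  have "adjV u x \<longleftrightarrow> \<not> antidiag u x \<and> \<not> antidiag x u"
    by (rule adjV_no_UL) (use assms V.regions_disjoint in blast)+
  then show ?thesis using assms bounds unfolding antidiag_def V.region_defs by auto
qed

text \<open>One anti-diagonal order is allowed by definition, the other is impossible since
  \<open>dn\<close> stays below the monotone \<open>up\<close>. Hence \<open>U\<close> can be
  carried along unchanged in the rest while \<open>L\<close> is treated.\<close>

lemma adjV_LU: "u \<in> V.L \<Longrightarrow> x \<in> V.U \<Longrightarrow> adjV u x"
proof -
  assume u: "u \<in> V.L" and x: "x \<in> V.U"
  have "\<not> antidiag u x"
  proof
    assume "antidiag u x"
    then show False
      using u x V.dn_up[of "fst u"] V.up_mono[of "fst u" "fst x"] bounds
      unfolding antidiag_def V.region_defs by auto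
  qed
  then show ?thesis using u x unfolding adjV_def by auto
qed

lemma adjV_AB:
  assumes "u \<in> V.A" "x \<in> V.B"
  shows "adjV u x"
proof -
  have "adjV u x \<longleftrightarrow> \<not> antidiag u x \<and> \<not> antidiag x u"
    by (rule adjV_no_UL) (use assms V.regions_disjoint in blast)+
  then show ?thesis using assms bounds unfolding antidiag_def V.region_defs by auto
qed

lemma adjC_UA:
  assumes "u \<in> C.U" "x \<in> C.A"
  shows "adjC u x \<longleftrightarrow> fst x < fst u"
proof -
  have "adjC u x \<longleftrightarrow> fst u < fst x \<and> snd u < snd x \<or> fst x < fst u \<and> snd x < snd u"
    by (rule adjC_no_UL) (use assms C.regions_disjoint in blast)+
  then show ?thesis using assms bounds unfolding C.region_defs by auto
qed

lemma adjC_UB: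
  assumes "u \<in> C.U" "x \<in> C.B"
  shows "adjC u x \<longleftrightarrow> snd u < snd x"
proof -
  have "adjC u x \<longleftrightarrow> fst u < fst x \<and> snd u < snd x \<or> fst x < fst u \<and> snd x < snd u"
    by (rule adjC_no_UL) (use assms C.regions_disjoint in blast)+
  then show ?thesis using assms bounds unfolding C.region_defs by auto
qed

lemma adjC_LA:
  assumes "u \<in> C.L" "x \<in> C.A"
  shows "adjC u x \<longleftrightarrow> snd x < snd u"
proof -
  have "adjC u x \<longleftrightarrow> fst u < fst x \<and> snd u < snd x \<or> fst x < fst u \<and> snd x < snd u"
    by (rule adjC_no_UL) (use assms C.regions_disjoint in blast)+
  then show ?thesis using assms bounds unfolding C.region_defs by auto
qed

lemma adjC_LB:
  assumes "u \<in> C.L" "x \<in> C.B"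
  shows "adjC u x \<longleftrightarrow> fst u < fst x"
proof -
  have "adjC u x \<longleftrightarrow> fst u < fst x \<and> snd u < snd x \<or> fst x < fst u \<and> snd x < snd u"
    by (rule adjC_no_UL) (use assms C.regions_disjoint in blast)+
  then show ?thesis using assms bounds unfolding C.region_defs by auto
qed

lemma adjC_LU: "u \<in> C.L \<Longrightarrow> x \<in> C.U \<Longrightarrow> adjC u x"
  unfolding adjC_def by auto

lemma adjC_AB: "u \<in> C.A \<Longrightarrow> x \<in> C.B \<Longrightarrow> adjC u x"
  using bounds unfolding adjC_def C.region_defs by auto

lemma adjV_grid:
  assumes "G \<subseteq> V.A \<or> G \<subseteq> V.B" "x \<in> G" "y \<in> G" "x \<noteq> y"
  shows "adjV x y \<longleftrightarrow> fst x \<le> fst y \<and> snd x \<le> snd y \<or> fst y \<le> fst x \<and> snd y \<le> snd x"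
  using assms(1)
proof
  assume "G \<subseteq> V.A"
  then have "x \<in> V.A" "y \<in> V.A" using assms(2,3) by auto
  then show ?thesis by (rule adjV_same) (use assms(4) in simp_all)
next
  assume "G \<subseteq> V.B"
  then have "x \<in> V.B" "y \<in> V.B" using assms(2,3) by auto
  then show ?thesis by (rule adjV_same) (use assms(4) in simp_all)
qed

lemma adjC_grid:
  assumes "G \<subseteq> C.A \<or> G \<subseteq> C.B" "x \<in> G" "y \<in> G"
  shows "adjC x y \<longleftrightarrow> fst x < fst y \<and> snd x < snd y \<or> fst y < fst x \<and> snd y < snd x"
  using assms(1)
proof
  assume "G \<subseteq> C.A"
  then have "x \<in> C.A" "y \<in> C.A" using assms(2,3) by auto
  then show ?thesis by (rule adjC_same) (use assms(2) in simp_all)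
next
  assume "G \<subseteq> C.B"
  then have "x \<in> C.B" "y \<in> C.B" using assms(2,3) by auto
  then show ?thesis by (rule adjC_same) (use assms(2) in simp_all)
qed

text \<open>The staircase of \<open>L\<close> read by rows: for \<open>j < bk\<close>,
  \<open>lft j\<close> is its first column in row \<open>j\<close>. Counting the columns whose lower
  boundary is below \<open>j\<close> yields it because \<open>lo\<close> is monotone. With
  \<open>lft_le_iff\<close> as the translation, \<open>L\<close> becomes a region of the same shape
  as \<open>U\<close> with the axes exchanged.\<close>

definition lft :: "int \<Rightarrow> int" where
  "lft j = a0 + 1 + int (card {p. a0 < p \<and> p < ak \<and> lo p < j})"

lemma lft_gt: "a0 < lft j" unfolding lft_def by simp

lemma lft_le_iff:
  assumes "a0 < i"
  shows "lft j \<le> i \<longleftrightarrow> ak \<le> i \<or> j \<le> lo i"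
proof -
  let ?S = "{p. a0 < p \<and> p < ak \<and> lo p < j}"
  have fin: "finite ?S" by (rule finite_subset[of _ "{a0..ak}"]) auto
  consider "ak \<le> i" | "i < ak" "j \<le> lo i" | "i < ak" "lo i < j" by linarith
  then show ?thesis
  proof cases
    case 1
    have "card ?S \<le> card {a0<..<ak}" by (rule card_mono) auto
    then show ?thesis using 1 bounds unfolding lft_def by auto
  next
    case 2
    have "p < i" if "a0 < p" "p < ak" "lo p < j" for p
      using that 2 lo_mono[of i p] assms by (cases "i \<le> p") auto
    then have "?S \<subseteq> {a0<..<i}" by auto
    then have "card ?S \<le> card {a0<..<i}" by (intro card_mono) auto
    then show ?thesis using 2 assms unfolding lft_def by auto
  next
    case 3
    have "lo p < j" if "a0 < p" "p \<le> i" for p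
      using that 3 lo_mono[of p i] assms by auto
    then have "{a0<..i} \<subseteq> ?S" using 3 by auto
    then have "card {a0<..i} \<le> card ?S" using fin by (intro card_mono)
    then show ?thesis using 3 assms unfolding lft_def by auto
  qed
qed

lemma lft_mono: "j \<le> j' \<Longrightarrow> lft j \<le> lft j'"
proof -
  assume "j \<le> j'"
  moreover have "finite {p. a0 < p \<and> p < ak \<and> lo p < j'}" by (rule finite_subset[of _ "{a0..ak}"]) auto
  ultimately have "card {p. a0 < p \<and> p < ak \<and> lo p < j} \<le> card {p. a0 < p \<and> p < ak \<and> lo p < j'}"
    by (intro card_mono) auto
  then show ?thesis unfolding lft_def by simp
qed

lemma lft_low: "j \<le> b0 \<Longrightarrow> lft j = a0 + 1"
  using lft_gt[of j] lft_le_iff[of "a0 + 1" j] lo_ge[of "a0 + 1"] bounds by (cases "ak \<le> a0 + 1") auto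

lemma lft_end: "lft bk = ak"
proof -
  have "lft bk \<le> ak" using lft_le_iff[of ak bk] bounds by auto
  moreover have "\<not> lft bk \<le> ak - 1"
  proof
    assume h: "lft bk \<le> ak - 1"
    then have "a0 < ak - 1" using lft_gt[of bk] by auto
    then show False using h lft_le_iff[of "ak - 1" bk] lo_lt[of "ak - 1"] by auto
  qed
  ultimately show ?thesis by simp
qed

text \<open>The two corners truncated by chosen vertices or cells. The bounds in \<open>AC\<close>
  are strict, since a cell adjacent to one of \<open>U\<close> in column \<open>k\<close> must lie
  strictly to its left; in \<open>BC\<close> the same strictness appears as a shift by one of the
  argument.\<close>

definition AV :: "int \<Rightarrow> int \<Rightarrow> point set" where "AV k l = {(i, j). 1 \<le> i \<and> i \<le> k \<and> 1 \<le> j \<and> j \<le> l}"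
definition BV :: "int \<Rightarrow> int \<Rightarrow> point set" where "BV x y = {(i, j). x \<le> i \<and> i \<le> m \<and> y \<le> j \<and> j \<le> n}"
definition AC :: "int \<Rightarrow> int \<Rightarrow> cell set" where "AC k l = {(i, j). 1 \<le> i \<and> i < k \<and> 1 \<le> j \<and> j < l}"
definition BC :: "int \<Rightarrow> int \<Rightarrow> cell set" where "BC x y = {(i, j). x \<le> i \<and> i < m \<and> y \<le> j \<and> j < n}"

lemma AV_sub: "k \<le> a0 \<Longrightarrow> l \<le> b0 \<Longrightarrow> AV k l \<subseteq> V.A" unfolding AV_def V.A_def by auto
lemma BV_sub: "ak \<le> x \<Longrightarrow> bk \<le> y \<Longrightarrow> BV x y \<subseteq> V.B" unfolding BV_def V.B_def by auto
lemma AC_sub: "k \<le> a0 \<Longrightarrow> l \<le> b0 \<Longrightarrow> AC k l \<subseteq> C.A" unfolding AC_def C.A_def by auto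
lemma BC_sub: "ak \<le> x \<Longrightarrow> bk \<le> y \<Longrightarrow> BC x y \<subseteq> C.B" unfolding BC_def C.B_def by auto

lemma AV_BV_disj: "k \<le> a0 \<Longrightarrow> ak \<le> x \<Longrightarrow> AV k l \<inter> BV x y = {}"
  using bounds unfolding AV_def BV_def by auto
lemma AC_BC_disj: "k \<le> a0 \<Longrightarrow> ak \<le> x \<Longrightarrow> AC k l \<inter> BC x y = {}"
  using bounds unfolding AC_def BC_def by auto

end

section \<open>Balance of grids, of the upper side and of the whole frame\<close>

locale frame_balance = frame_data +
  fixes t u :: "'r::comm_ring_1"
  assumes tu: "u * (1 - t) = 1"
begin

sublocale clique_pair adjV adjC t u
  by standard (use symp_adjV symp_adjC tu in auto)

text \<open>The dimension is the number of points of a maximal chain in the rectangle. A vertex of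
  the first column in row \<open>s\<close> leaves the later columns from row \<open>s\<close> on, so
  only the lowest vertex of the column is a cone point.\<close>

lemma balanced_grid:
  fixes x1 x2 y1 y2 :: int
  assumes "x1 \<le> x2" "y1 \<le> y2"
    and "{x1..x2} \<times> {y1..y2} \<subseteq> V.A \<or> {x1..x2} \<times> {y1..y2} \<subseteq> V.B"
    and "{x1..<x2} \<times> {y1..<y2} \<subseteq> C.A \<or> {x1..<x2} \<times> {y1..<y2} \<subseteq> C.B"
  shows "balanced ({x1..x2} \<times> {y1..y2}) ({x1..<x2} \<times> {y1..<y2}) (x2 - x1 + y2 - y1 + 1)"
  using assms
proof (induction x1 arbitrary: y1 rule: int_le_induct)
  case base
  have adj: "adjV x y" if "x \<in> {x2..x2} \<times> {y1..y2}" "y \<in> {x2..x2} \<times> {y1..y2}" "x \<noteq> y" for x y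
    using adjV_grid[OF base(2) that] that by auto
  have "balanced ({x2..x2} \<times> {y1..y2} \<union> {}) {} (0 + int (card ({x2..x2} \<times> {y1..y2})))"
    by (rule balanced_cones[OF balanced_empty]) (use adj in auto)
  then show ?case using base by simp
next
  case (step x0)
  define x1 where "x1 = x0 - 1"
  have x0: "x0 = x1 + 1" by (simp add: x1_def)
  have adjV: "adjV x y \<longleftrightarrow> fst x \<le> fst y \<and> snd x \<le> snd y \<or> fst y \<le> fst x \<and> snd y \<le> snd x"
    if "x \<in> {x1..x2} \<times> {y1..y2}" "y \<in> {x1..x2} \<times> {y1..y2}" "x \<noteq> y" for x y
    using adjV_grid[OF step.prems(2)] that unfolding x1_def by blast
  have adjC: "adjC x y \<longleftrightarrow> fst x < fst y \<and> snd x < snd y \<or> fst y < fst x \<and> snd y < snd x"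
    if "x \<in> {x1..<x2} \<times> {y1..<y2}" "y \<in> {x1..<x2} \<times> {y1..<y2}" for x y
    using adjC_grid[OF step.prems(3)] that unfolding x1_def by blast
  have "balanced ((\<lambda>s. (x1, s)) ` {y1..y2} \<union> {x1 + 1..x2} \<times> {y1..y2})
      ((\<lambda>s. (x1, s - 1)) ` {y1<..y2} \<union> {x1 + 1..<x2} \<times> {y1..<y2}) (x2 - x1 + y2 - y1 + y1 - y1 + 1)"
  proof (rule balanced_column[where W = "\<lambda>s. {x1 + 1..x2} \<times> {s..y2}" and C = "\<lambda>s. {x1 + 1..<x2} \<times> {s..<y2}"])
    fix s assume s: "y1 \<le> s" "s \<le> y2"
    have sub: "{x0..x2} \<times> {s..y2} \<subseteq> {x0 - 1..x2} \<times> {y1..y2}" "{x0..<x2} \<times> {s..<y2} \<subseteq> {x0 - 1..<x2} \<times> {y1..<y2}"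
      using s by auto
    have "balanced ({x0..x2} \<times> {s..y2}) ({x0..<x2} \<times> {s..<y2}) (x2 - x0 + y2 - s + 1)"
    proof (rule step.IH)
      show "{x0..x2} \<times> {s..y2} \<subseteq> V.A \<or> {x0..x2} \<times> {s..y2} \<subseteq> V.B"
        using step.prems(2) sub(1) by (meson subset_trans)
      show "{x0..<x2} \<times> {s..<y2} \<subseteq> C.A \<or> {x0..<x2} \<times> {s..<y2} \<subseteq> C.B"
        using step.prems(3) sub(2) by (meson subset_trans)
    qed (use s in auto)
    then show "balanced ({x1 + 1..x2} \<times> {s..y2}) ({x1 + 1..<x2} \<times> {s..<y2}) (x2 - x1 + y2 - y1 + y1 - s)"
      unfolding x0 by (simp add: algebra_simps)
  next
    fix s assume "y1 < s" "s \<le> y2"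
    then show "{x \<in> {x1 + 1..x2} \<times> {y1..y2}. adjV (x1, s) x} = {x1 + 1..x2} \<times> {s..y2}"
      using adjV[of "(x1, s)"] step.hyps x0 by auto
  next
    fix s assume "y1 < s" "s \<le> y2"
    then show "{x \<in> {x1 + 1..<x2} \<times> {y1..<y2}. adjC (x1, s - 1) x} = {x1 + 1..<x2} \<times> {s..<y2}"
      using adjC[of "(x1, s - 1)"] step.hyps x0 by auto
  qed (use step.prems step.hyps x0 adjV adjC in \<open>auto simp: inj_on_def\<close>)
  moreover have "(\<lambda>s. (x1, s)) ` {y1..y2} \<union> {x1 + 1..x2} \<times> {y1..y2} = {x1..x2} \<times> {y1..y2}"
    using step.hyps x0 by auto
  moreover have "(\<lambda>s. (x1, s - 1)) ` {y1<..y2} \<union> {x1 + 1..<x2} \<times> {y1..<y2} = {x1..<x2} \<times> {y1..<y2}"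
  proof -
    have "(x1, s) \<in> (\<lambda>s. (x1, s - 1)) ` {y1<..y2}" if "y1 \<le> s" "s < y2" for s
      by (rule image_eqI[of _ _ "s + 1"]) (use that in auto)
    moreover have "{x1..<x2} = insert x1 {x1 + 1..<x2}" using step.hyps x0 by auto
    ultimately show ?thesis by auto
  qed
  ultimately show ?case unfolding x1_def[symmetric] by (simp add: algebra_simps)
qed

lemma balanced_corners:
  assumes "1 \<le> k" "k \<le> a0" "1 \<le> l" "l \<le> b0" "ak \<le> x" "x \<le> m" "bk \<le> y" "y \<le> n"
  shows "balanced (AV k l \<union> BV x y) (AC k l \<union> BC x y) (k + l + m - x + n - y)"
proof -
  have A: "AV k l = {1..k} \<times> {1..l}" "AC k l = {1..<k} \<times> {1..<l}"
    and B: "BV x y = {x..m} \<times> {y..n}" "BC x y = {x..<m} \<times> {y..<n}"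
    unfolding AV_def AC_def BV_def BC_def by auto
  have "balanced (AV k l) (AC k l) (k - 1 + l - 1 + 1)"
    using AV_sub[of k l] AC_sub[of k l] assms unfolding A by (intro balanced_grid) auto
  moreover have "balanced (BV x y) (BC x y) (m - x + n - y + 1)"
    using BV_sub[of x y] BC_sub[of x y] assms unfolding B by (intro balanced_grid) auto
  ultimately have "balanced (AV k l \<union> BV x y) (AC k l \<union> BC x y) ((k - 1 + l - 1 + 1) + (m - x + n - y + 1))"
  proof (rule balanced_join)
    show "AV k l \<inter> BV x y = {}" "AC k l \<inter> BC x y = {}"
      using AV_BV_disj AC_BC_disj assms by auto
    show "adjV v w" if "v \<in> AV k l" "w \<in> BV x y" for v w
      by (rule adjV_AB) (use that AV_sub[of k l] BV_sub[of x y] assms in auto)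
    show "adjC v w" if "v \<in> AC k l" "w \<in> BC x y" for v w
      by (rule adjC_AB) (use that AC_sub[of k l] BC_sub[of x y] assms in auto)
  qed
  then show ?thesis by (simp add: algebra_simps)
qed

text \<open>The bounds \<open>l\<close> on the rows of \<open>A\<close> and \<open>x\<close> on the
  columns of \<open>B\<close> stay free, since vertices of \<open>L\<close> will later vary them.
  Vertices of \<open>U\<close> affect the two other bounds, which are the parameters of the
  strand.\<close>

lemma balanced_upper:
  assumes l: "1 \<le> l" "l \<le> b0" and x: "ak \<le> x" "x \<le> m"
  shows "balanced (V.U \<union> (AV a0 l \<union> BV x bk)) (C.U \<union> (AC a0 l \<union> BC x bk)) (ak - 1 + (l + m - x + n) - b0)"
proof -
  let ?vt = "\<lambda>i j. (i, j) :: int \<times> int"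
  let ?X = "\<lambda>k y. AV k l \<union> BV x y" and ?Y = "\<lambda>k y. AC k l \<union> BC x y"
  have UV: "1 \<le> i \<and> i \<le> ak - 1 \<and> upV i \<le> j \<and> j \<le> n \<longleftrightarrow> (i, j) \<in> V.U" for i j
    using V.up_mono[of 1 i] bounds unfolding V.U_def upV_def by (auto split: if_splits)
  have UC: "1 \<le> p \<and> p \<le> ak - 1 \<and> (if p < a0 then b0 else upV (p + 1)) \<le> q \<and> q < n \<longleftrightarrow> (p, q) \<in> C.U" for p q
    using hi_gt[of p] bounds unfolding C.U_def upV_def upC_def by auto
  interpret S: strand adjV adjC t u a0 b0 "ak - 1" bk n "l + m - x + n" upV ?vt ?vt ?X ?Y
    "\<lambda>i j. 1 \<le> i \<and> i \<le> ak - 1 \<and> upV i \<le> j \<and> j \<le> n"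
    "\<lambda>p q. 1 \<le> p \<and> p \<le> ak - 1 \<and> (if p < a0 then b0 else upV (p + 1)) \<le> q \<and> q < n"
  \<comment> \<open>Cases 9 and 10 are adjacency inside the staircase, 11 and 12 disjointness from
    the rest, 13 and 14 intersections of truncated rests, 15 and 16 the truncation by a chosen
    point, and 17 the balance of the rest.\<close>
  proof (unfold_locales, goal_cases)
    case (6 i i')
    then show ?case using hi_mono[of "i - 1" "i' - 1"] hi_gt[of "i' - 1"] unfolding upV_def by auto
  next
    case (9 i j i' j')
    then show ?case using adjV_same[of "(i, j)" V.U "(i', j')"] unfolding UV by auto
  next
    case (10 i j i' j')
    then show ?case using adjC_same[of "(i, j)" C.U "(i', j')"] unfolding UC by auto
  next
    case (11 i j)
    then show ?case using AV_sub[of a0 l] BV_sub[of x bk] l x V.regions_disjoint unfolding UV by auto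
  next
    case (12 i j)
    then show ?case using AC_sub[of a0 l] BC_sub[of x bk] l x C.regions_disjoint unfolding UC by auto
  next
    case (13 k y k' y')
    then show ?case using x bounds unfolding AV_def BV_def by auto
  next
    case (14 k y k' y')
    then show ?case using x bounds unfolding AC_def BC_def by auto
  next
    case (15 i j z)
    then have u: "(i, j) \<in> V.U" unfolding UV by blast
    from 15(2) show ?case
    proof
      assume z: "z \<in> AV a0 l"
      then have "z \<notin> BV x (max j bk)" using AV_BV_disj[of a0 x l "max j bk"] x by auto
      moreover have "z \<in> V.A" using z AV_sub[of a0 l] l by auto
      ultimately show ?thesis using z adjV_UA[OF u, of z] unfolding AV_def by auto
    next
      assume z: "z \<in> BV x bk"
      then have "z \<notin> AV (min i a0) l" using AV_BV_disj[of "min i a0" x l bk] x by auto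
      moreover have "z \<in> V.B" using z BV_sub[of x bk] x by auto
      ultimately show ?thesis using z adjV_UB[OF u, of z] unfolding BV_def by auto
    qed
  next
    case (16 i j z)
    then have u: "(i, j) \<in> C.U" unfolding UC by blast
    from 16(2) show ?case
    proof
      assume z: "z \<in> AC a0 l"
      then have "z \<notin> BC x (max (j + 1) bk)" using AC_BC_disj[of a0 x l "max (j + 1) bk"] x by auto
      moreover have "z \<in> C.A" using z AC_sub[of a0 l] l by auto
      ultimately show ?thesis using z adjC_UA[OF u, of z] unfolding AC_def by auto
    next
      assume z: "z \<in> BC x bk"
      then have "z \<notin> AC (min i a0) l" using AC_BC_disj[of "min i a0" x l bk] x by auto
      moreover have "z \<in> C.B" using z BC_sub[of x bk] x by auto
      ultimately show ?thesis using z adjC_UB[OF u, of z] unfolding BC_def by auto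
    qed
  next
    case (17 k y)
    then show ?case using balanced_corners[of k l x y] l x by (simp add: algebra_simps)
  qed (use bounds hi_end in \<open>auto simp: upV_def\<close>)
  have "{(i, j) | i j. (i, j) \<in> V.U} = V.U" "{(i, j) | i j. (i, j) \<in> C.U} = C.U" by auto
  then show ?thesis using S.balanced_strand unfolding UV UC by simp
qed

text \<open>The second strand runs along \<open>L\<close> with the axes exchanged, over rests that
  contain \<open>U\<close> and are balanced by \<open>balanced_upper\<close>. The dimension is
  \<open>(bk - 1) + (ak - 1 + m + n - b0) - a0\<close>, regrouped.\<close>

lemma balanced_frame: "balanced (vertex_set P) P (m + n + (ak - a0) + (bk - b0) - 2)"
proof -
  let ?vt = "\<lambda>i j. (j, i) :: int \<times> int"
  let ?X = "\<lambda>k y. V.U \<union> (AV a0 k \<union> BV y bk)" and ?Y = "\<lambda>k y. C.U \<union> (AC a0 k \<union> BC y bk)"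
  have UV: "1 \<le> i \<and> i \<le> bk - 1 \<and> lft i \<le> j \<and> j \<le> m \<longleftrightarrow> (j, i) \<in> V.L" for i j
    using lft_le_iff[of j i] lft_gt[of i] bounds lo_lt[of j] unfolding V.L_def dnV_def by auto
  have UC: "1 \<le> p \<and> p \<le> bk - 1 \<and> (if p < b0 then a0 else lft (p + 1)) \<le> q \<and> q < m \<longleftrightarrow> (q, p) \<in> C.L" for p q
    using lft_le_iff[of q "p + 1"] lft_gt[of "p + 1"] bounds lo_lt[of q] lo_ge[of q] lo_start
    unfolding C.L_def dnC_def by (cases "q = a0") auto
  interpret S: strand adjV adjC t u b0 a0 "bk - 1" ak m "ak - 1 + m + n - b0" lft ?vt ?vt ?X ?Y
    "\<lambda>i j. 1 \<le> i \<and> i \<le> bk - 1 \<and> lft i \<le> j \<and> j \<le> m"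
    "\<lambda>p q. 1 \<le> p \<and> p \<le> bk - 1 \<and> (if p < b0 then a0 else lft (p + 1)) \<le> q \<and> q < m"
  proof (unfold_locales, goal_cases)
    case (6 i i')
    then show ?case using lft_mono by auto
  next
    case (9 i j i' j')
    then show ?case using adjV_same[of "(j, i)" V.L "(j', i')"] unfolding UV by auto
  next
    case (10 i j i' j')
    then show ?case using adjC_same[of "(j, i)" C.L "(j', i')"] unfolding UC by auto
  next
    case (11 i j)
    then show ?case using AV_sub[of a0 b0] BV_sub[of ak bk] V.regions_disjoint unfolding UV by auto
  next
    case (12 i j)
    then show ?case using AC_sub[of a0 b0] BC_sub[of ak bk] C.regions_disjoint unfolding UC by auto
  next
    case (13 k y k' y')
    have "AV a0 k \<inter> AV a0 k' = AV a0 (min k k')" "BV y bk \<inter> BV y' bk = BV (max y y') bk"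
      "AV a0 k \<inter> BV y' bk = {}" "AV a0 k' \<inter> BV y bk = {}"
      using 13 bounds unfolding AV_def BV_def by auto
    moreover have "AV a0 k \<inter> V.U = {}" "AV a0 k' \<inter> V.U = {}" "BV y bk \<inter> V.U = {}" "BV y' bk \<inter> V.U = {}"
      using AV_sub[of a0 k] AV_sub[of a0 k'] BV_sub[of y bk] BV_sub[of y' bk] 13 V.regions_disjoint by auto
    ultimately show ?case by blast
  next
    case (14 k y k' y')
    have "AC a0 k \<inter> AC a0 k' = AC a0 (min k k')" "BC y bk \<inter> BC y' bk = BC (max y y') bk"
      "AC a0 k \<inter> BC y' bk = {}" "AC a0 k' \<inter> BC y bk = {}"
      using 14 bounds unfolding AC_def BC_def by auto
    moreover have "AC a0 k \<inter> C.U = {}" "AC a0 k' \<inter> C.U = {}" "BC y bk \<inter> C.U = {}" "BC y' bk \<inter> C.U = {}"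
      using AC_sub[of a0 k] AC_sub[of a0 k'] BC_sub[of y bk] BC_sub[of y' bk] 14 C.regions_disjoint by auto
    ultimately show ?case by blast
  next
    case (15 i j z)
    then have u: "(j, i) \<in> V.L" unfolding UV by blast
    from 15(2) consider "z \<in> V.U" | "z \<in> AV a0 b0" | "z \<in> BV ak bk" by blast
    then show ?case
    proof cases
      case 1
      then show ?thesis using adjV_LU[OF u] by auto
    next
      case 2
      then have "z \<notin> BV (max j ak) bk" "z \<notin> V.U"
        using AV_BV_disj[of a0 "max j ak" b0 bk] AV_sub[of a0 b0] V.regions_disjoint by auto
      moreover have "z \<in> V.A" using 2 AV_sub[of a0 b0] by auto
      ultimately show ?thesis using 2 adjV_LA[OF u, of z] unfolding AV_def by auto
    next
      case 3
      then have "z \<notin> AV a0 (min i b0)" "z \<notin> V.U"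
        using AV_BV_disj[of a0 ak "min i b0" bk] BV_sub[of ak bk] V.regions_disjoint by auto
      moreover have "z \<in> V.B" using 3 BV_sub[of ak bk] by auto
      ultimately show ?thesis using 3 adjV_LB[OF u, of z] unfolding BV_def by auto
    qed
  next
    case (16 i j z)
    then have u: "(j, i) \<in> C.L" unfolding UC by blast
    from 16(2) consider "z \<in> C.U" | "z \<in> AC a0 b0" | "z \<in> BC ak bk" by blast
    then show ?case
    proof cases
      case 1
      then show ?thesis using adjC_LU[OF u] by auto
    next
      case 2
      then have "z \<notin> BC (max (j + 1) ak) bk" "z \<notin> C.U"
        using AC_BC_disj[of a0 "max (j + 1) ak" b0 bk] AC_sub[of a0 b0] C.regions_disjoint by auto
      moreover have "z \<in> C.A" using 2 AC_sub[of a0 b0] by auto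
      ultimately show ?thesis using 2 adjC_LA[OF u, of z] unfolding AC_def by auto
    next
      case 3
      then have "z \<notin> AC a0 (min i b0)" "z \<notin> C.U"
        using AC_BC_disj[of a0 ak "min i b0" bk] BC_sub[of ak bk] C.regions_disjoint by auto
      moreover have "z \<in> C.B" using 3 BC_sub[of ak bk] by auto
      ultimately show ?thesis using 3 adjC_LB[OF u, of z] unfolding BC_def by auto
    qed
  next
    case (17 k y)
    then show ?case using balanced_upper[of k y] by (simp add: algebra_simps)
  qed (use bounds lft_low lft_end in auto)
  have "{(j, i) | i j. (j, i) \<in> V.L} = V.L" "{(j, i) | i j. (j, i) \<in> C.L} = C.L" by auto
  moreover have "V.L \<union> ?X b0 ak = vertex_set P"
    unfolding vertices_eq V.Z_def AV_def BV_def V.A_def V.B_def by auto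
  moreover have "C.L \<union> ?Y b0 ak = P"
    unfolding cells_eq C.Z_def AC_def BC_def C.A_def C.B_def by auto
  ultimately have "balanced (vertex_set P) P (bk - 1 + (ak - 1 + m + n - b0) - a0)"
    using S.balanced_strand unfolding UV UC by simp
  then show ?thesis by (simp add: algebra_simps)
qed

end

section \<open>Rook configurations\<close>

context frame_data
begin

lemma UL_above:
  assumes "x \<in> C.U" "y \<in> C.L" "fst y \<le> fst x"
  shows "snd y < snd x"
  using assms C.dn_up[of "fst y"] C.up_mono[of "fst y" "fst x"] bounds unfolding C.region_defs by auto

lemma segment_subset:
  assumes u: "u \<in> P" and v: "v \<in> P" and nb: "\<not> (u \<in> C.U \<and> v \<in> C.L)"
    and le: "fst u \<le> fst v" "snd v \<le> snd u"
    and pq: "fst u \<le> p" "p \<le> fst v" "snd v \<le> q" "q \<le> snd u"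
  shows "(p, q) \<in> P"
proof -
  have "1 \<le> fst u" "fst v < m" "1 \<le> snd v" "snd u < n"
    using u v mem_P[of "fst u" "snd u"] mem_P[of "fst v" "snd v"] by auto
  then show ?thesis using C_hole_free[OF u v nb pq] pq unfolding mem_P by auto
qed

lemma attacking_sym: "attacking P x y \<Longrightarrow> attacking P y x"
  unfolding attacking_def by (auto simp: min.commute max.commute)

text \<open>On a common line the rectangle spanned by the cells degenerates to the segment joining
  them, and only a pair from \<open>U\<close> and \<open>L\<close> can have the hole inside
  it.\<close>

lemma attackingI:
  assumes x: "x \<in> P" and y: "y \<in> P" and "x \<noteq> y" and line: "fst x = fst y \<or> snd x = snd y"
    and nb: "\<not> (x \<in> C.U \<and> y \<in> C.L)" "\<not> (y \<in> C.U \<and> x \<in> C.L)"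
  shows "attacking P x y"
proof -
  have "(p, q) \<in> P" if "min (fst x) (fst y) \<le> p" "p \<le> max (fst x) (fst y)"
    "min (snd x) (snd y) \<le> q" "q \<le> max (snd x) (snd y)" for p q
  proof -
    have "fst x \<le> fst y \<and> snd y \<le> snd x \<or> fst y \<le> fst x \<and> snd x \<le> snd y" using line by auto
    then show ?thesis
      using segment_subset[OF x y nb(1), of p q] segment_subset[OF y x nb(2), of p q] that by auto
  qed
  then show ?thesis using assms unfolding attacking_def interval_def by auto
qed

lemma not_attacking_UL:
  assumes "x \<in> C.U" "y \<in> C.L"
  shows "\<not> attacking P x y"
proof
  assume a: "attacking P x y"
  then have line: "fst x = fst y \<or> snd x = snd y"
    and sub: "interval (min (fst x) (fst y), min (snd x) (snd y)) (max (fst x) (fst y), max (snd x) (snd y)) \<subseteq> P"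
    unfolding attacking_def by auto
  have le: "fst x \<le> fst y" "snd y \<le> snd x" using line UL_above[OF assms] by arith+
  obtain p q where "fst x \<le> p" "p \<le> fst y" "snd y \<le> q" "q \<le> snd x" "(p, q) \<in> H"
    using C_hole_hit[OF assms le] by blast
  moreover from this have "(p, q) \<in> P" using sub le unfolding interval_def by auto
  ultimately show False using mem_P by auto
qed

lemma adjC_not_attacking:
  assumes "adjC x y"
  shows "\<not> attacking P x y"
proof -
  consider "fst x \<noteq> fst y" "snd x \<noteq> snd y" | "x \<in> C.U" "y \<in> C.L" | "y \<in> C.U" "x \<in> C.L"
    using assms unfolding adjC_def by fastforce
  then show ?thesis
  proof cases
    case 1
    then show ?thesis unfolding attacking_def by simp
  next
    case 2
    then show ?thesis by (rule not_attacking_UL)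
  next
    case 3
    then show ?thesis using not_attacking_UL attacking_sym by blast
  qed
qed

lemma cliques_rook_configs: "R \<in> cliques adjC P \<Longrightarrow> R \<in> rook_configs P (card R)"
proof -
  assume R: "R \<in> cliques adjC P"
  then have "R \<subseteq> P" "finite R" using finite_subset[OF _ finite_P] unfolding cliques_def by auto
  moreover have "\<not> attacking P x y" if "x \<in> R" "y \<in> R" for x y
  proof (cases "x = y")
    case True
    then show ?thesis unfolding attacking_def by simp
  next
    case False
    then show ?thesis using R that by (intro adjC_not_attacking) (auto simp: cliques_def)
  qed
  ultimately show ?thesis unfolding rook_configs_def by auto
qed

definition straight :: "cell set \<Rightarrow> bool" where
  "straight R \<longleftrightarrow> (\<forall>u\<in>R. \<forall>v\<in>R. antidiag u v \<longrightarrow> u \<in> C.U \<and> v \<in> C.L)"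

text \<open>For a pair not separated by the hole, not attacking excludes a common line and
  straightness excludes the anti-diagonal position; strict comparability remains.\<close>

lemma cliques_iff: "R \<in> cliques adjC P \<longleftrightarrow> R \<in> rook_configs P (card R) \<and> straight R"
proof
  assume R: "R \<in> cliques adjC P"
  have "u \<in> C.U \<and> v \<in> C.L" if uv: "u \<in> R" "v \<in> R" "antidiag u v" for u v
  proof -
    have "adjC u v" using R uv unfolding cliques_def antidiag_def by auto
    then consider "u \<in> C.U \<and> v \<in> C.L" | "v \<in> C.U" "u \<in> C.L" using uv(3) unfolding adjC_def antidiag_def by auto
    then show ?thesis
    proof cases
      case 2
      then show ?thesis using UL_above[of v u] uv unfolding antidiag_def by auto
    qed
  qed
  then show "R \<in> rook_configs P (card R) \<and> straight R"
    using cliques_rook_configs[OF R] unfolding straight_def by blast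
next
  assume R: "R \<in> rook_configs P (card R) \<and> straight R"
  have "adjC u v" if uv: "u \<in> R" "v \<in> R" "u \<noteq> v" for u v
  proof (rule ccontr)
    assume n: "\<not> adjC u v"
    then have nb: "\<not> (u \<in> C.U \<and> v \<in> C.L)" "\<not> (v \<in> C.U \<and> u \<in> C.L)" unfolding adjC_def by auto
    then have "\<not> antidiag u v" "\<not> antidiag v u" using R uv unfolding straight_def by blast+
    moreover have "\<not> attacking P u v" "u \<in> P" "v \<in> P" using R uv unfolding rook_configs_def by auto
    then have "fst u \<noteq> fst v \<and> snd u \<noteq> snd v" using attackingI[of u v] nb uv by auto
    ultimately show False using n unfolding adjC_def antidiag_def by auto
  qed
  then show "R \<in> cliques adjC P" using R unfolding cliques_def rook_configs_def by auto
qed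

lemma switch_weight:
  assumes "switch P k R R'"
  shows "sum C.W R = sum C.W R'"
proof -
  obtain a b X Y where R: "R \<in> rook_configs P k" "R' \<in> rook_configs P k" and inner: "inner_interval P a b"
    and XY: "(X, Y) \<in> {(diagonal_cells a b, antidiagonal_cells a b), (antidiagonal_cells a b, diagonal_cells a b)}"
    and X: "card X = 2" "X \<subseteq> R" and R': "R' = (R - X) \<union> Y"
    using assms unfolding switch_def by blast
  obtain i j k' l where ab: "a = (i, j)" "b = (k', l)" by (cases a, cases b)
  have sub: "(p, q) \<in> P" if "i \<le> p" "p < k'" "j \<le> q" "q < l" for p q
    using inner that unfolding ab inner_interval_def proper_corners_def cells_in_interval by auto
  have lt: "i < k'" "j < l" using inner unfolding ab inner_interval_def proper_corners_def by auto
  have XY': "X = {(i, j), (k' - 1, l - 1)} \<and> Y = {(i, l - 1), (k' - 1, j)} \<or>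
      Y = {(i, j), (k' - 1, l - 1)} \<and> X = {(i, l - 1), (k' - 1, j)}"
    using XY unfolding diagonal_cells_def antidiagonal_cells_def ab by auto
  have fin: "finite R" "finite R'" "finite X" "finite Y" using R XY' unfolding rook_configs_def by auto
  have "sum C.W X = sum C.W Y"
  proof (cases "i < k' - 1 \<and> j < l - 1")
    case True
    have "\<not> ((i, l - 1) \<in> C.U \<and> (k' - 1, j) \<in> C.L)"
      using C_hole_hit[of "(i, l - 1)" "(k' - 1, j)"] sub mem_P True by fastforce
    then have "C.W (i, l - 1) + C.W (k' - 1, j) = C.W (i, j) + C.W (k' - 1, l - 1)"
      using C.straighten_W[of "(i, l - 1)" "(k' - 1, j)"] sub[of i "l - 1"] sub[of "k' - 1" j] lt True
      unfolding cells_eq antidiag_def by auto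
    then show ?thesis using XY' True by auto
  next
    \<comment> \<open>In an interval one cell thick the diagonal and the anti-diagonal cells
      coincide.\<close>
    case False
    then have "i = k' - 1 \<or> j = l - 1" using lt by auto
    then have "X = Y" using XY' by auto
    then show ?thesis by simp
  qed
  \<comment> \<open>Both configurations have \<open>k\<close> rooks, so no new rook can fall on a
    remaining one.\<close>
  moreover have "(R - X) \<inter> Y = {}"
  proof -
    have "card Y \<le> 2" using XY' by (auto simp: card_insert_if)
    moreover have "card R' = card (R - X) + card Y - card ((R - X) \<inter> Y)"
      unfolding R' using fin card_Un_Int[of "R - X" Y] by simp
    moreover have "card ((R - X) \<inter> Y) \<le> card Y" using fin by (intro card_mono) auto
    moreover have "card (R - X) = card R - 2" "2 \<le> card R"
      using X fin card_mono[of R X] by (auto simp: card_Diff_subset)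
    moreover have "card R = card R'" using R unfolding rook_configs_def by auto
    ultimately have "card ((R - X) \<inter> Y) = 0" by linarith
    then show ?thesis using fin by auto
  qed
  then have "sum C.W R' = sum C.W (R - X) + sum C.W Y"
    unfolding R' using fin by (intro sum.union_disjoint) auto
  moreover have "sum C.W R = sum C.W (R - X) + sum C.W X"
    using X fin by (simp add: sum.subset_diff)
  ultimately show ?thesis by simp
qed

text \<open>In a straightening switch this turns an attack on a new rook into an attack on the old
  rook of the same column.\<close>

lemma attacking_column:
  assumes "attacking P x y" "fst x = fst y" "fst z = fst y" "x \<noteq> z"
    and "\<And>q. min (snd y) (snd z) \<le> q \<Longrightarrow> q \<le> max (snd y) (snd z) \<Longrightarrow> (fst y, q) \<in> P"
  shows "attacking P x z"
proof -
  have "(fst y, q) \<in> P" if "min (snd x) (snd z) \<le> q" "q \<le> max (snd x) (snd z)" for q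
  proof (cases "min (snd y) (snd z) \<le> q \<and> q \<le> max (snd y) (snd z)")
    case False
    then have "min (snd x) (snd y) \<le> q \<and> q \<le> max (snd x) (snd y)" using that by linarith
    then show ?thesis using assms(1,2) unfolding attacking_def interval_def by auto
  qed (use assms(5) in auto)
  then show ?thesis using assms(2-4) unfolding attacking_def interval_def by auto
qed

lemma attacking_row:
  assumes "attacking P x y" "snd x = snd y" "snd z = snd y" "x \<noteq> z"
    and "\<And>p. min (fst y) (fst z) \<le> p \<Longrightarrow> p \<le> max (fst y) (fst z) \<Longrightarrow> (p, snd y) \<in> P"
  shows "attacking P x z"
proof -
  have "(p, snd y) \<in> P" if "min (fst x) (fst z) \<le> p" "p \<le> max (fst x) (fst z)" for p
  proof (cases "min (fst y) (fst z) \<le> p \<and> p \<le> max (fst y) (fst z)")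
    case False
    then have "min (fst x) (fst y) \<le> p \<and> p \<le> max (fst x) (fst y)" using that by linarith
    then show ?thesis using assms(1,2) unfolding attacking_def interval_def by auto
  qed (use assms(5) in auto)
  then show ?thesis using assms(2-4) unfolding attacking_def interval_def by auto
qed

text \<open>The termination measure for rooks as well as for monomials. Straightening raises the sum
  of the products \<open>fst c * snd c\<close> by the area of the rectangle; subtracting from
  \<open>m * n\<close> turns this growth into descent in the natural numbers.\<close>

definition defect :: "cell \<Rightarrow> nat" where
  "defect c = nat (m * n - fst c * snd c)"

lemma defect_straighten:
  assumes "antidiag u v" "0 \<le> fst u" "fst v \<le> m" "0 \<le> snd v" "snd u \<le> n"
  shows "defect (fst u, snd v) + defect (fst v, snd u) < defect u + defect v"
proof -
  have *: "0 \<le> x * y \<and> x * y \<le> m * n" if "0 \<le> x" "x \<le> m" "0 \<le> y" "y \<le> n" for x y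
    using that by (auto intro: mult_mono)
  have lt: "fst u < fst v" "snd v < snd u" using assms unfolding antidiag_def by auto
  then have "0 < (fst v - fst u) * (snd u - snd v)" by auto
  moreover have "fst u * snd u \<le> m * n" "fst v * snd v \<le> m * n" "fst u * snd v \<le> m * n" "fst v * snd u \<le> m * n"
    using * assms lt by auto
  ultimately have "int (defect (fst u, snd v) + defect (fst v, snd u)) < int (defect u + defect v)"
    unfolding defect_def by (simp add: algebra_simps)
  then show ?thesis by linarith
qed

text \<open>The whole rectangle lies in \<open>P\<close>, and each new corner shares its column with
  one old rook and its row with the other. A third rook attacking a new corner would have attacked
  one of the two, and a rook already standing there would have done so too.\<close>

lemma straightening_switch:
  assumes R: "R \<in> rook_configs P k" and uv: "u \<in> R" "v \<in> R" "antidiag u v" and nb: "\<not> (u \<in> C.U \<and> v \<in> C.L)"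
  shows "\<exists>R'. switch P k R R' \<and> sum defect R' < sum defect R"
proof -
  define w1 w2 where "w1 = (fst u, snd v)" and "w2 = (fst v, snd u)"
  define R' where "R' = (R - {u, v}) \<union> {w1, w2}"
  have lt: "fst u < fst v" "snd v < snd u" using uv unfolding antidiag_def by auto
  have P: "u \<in> P" "v \<in> P" "R \<subseteq> P" and fin: "finite R" and cardR: "card R = k"
    and na: "\<And>x y. x \<in> R \<Longrightarrow> y \<in> R \<Longrightarrow> \<not> attacking P x y"
    using R uv unfolding rook_configs_def by auto
  have rect: "(p, q) \<in> P" if "fst u \<le> p" "p \<le> fst v" "snd v \<le> q" "q \<le> snd u" for p q
    using segment_subset[OF P(1,2) nb] that lt by auto
  have col1: "(fst w1, q) \<in> P" if "min (snd w1) (snd u) \<le> q" "q \<le> max (snd w1) (snd u)" for q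
    using that rect[of "fst u" q] lt unfolding w1_def by auto
  have row1: "(p, snd w1) \<in> P" if "min (fst w1) (fst v) \<le> p" "p \<le> max (fst w1) (fst v)" for p
    using that rect[of p "snd v"] lt unfolding w1_def by auto
  have col2: "(fst w2, q) \<in> P" if "min (snd w2) (snd v) \<le> q" "q \<le> max (snd w2) (snd v)" for q
    using that rect[of "fst v" q] lt unfolding w2_def by auto
  have row2: "(p, snd w2) \<in> P" if "min (fst w2) (fst u) \<le> p" "p \<le> max (fst w2) (fst u)" for p
    using that rect[of p "snd u"] lt unfolding w2_def by auto
  have n1: "\<not> attacking P x w1" if "x \<in> R" "x \<noteq> u" "x \<noteq> v" for x
  proof
    assume a: "attacking P x w1"
    then consider "fst x = fst w1" | "snd x = snd w1" unfolding attacking_def by auto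
    then show False
    proof cases
      case 1
      then have "attacking P x u" by (rule attacking_column[OF a]) (use that col1 w1_def in auto)
      then show False using na that uv by blast
    next
      case 2
      then have "attacking P x v" by (rule attacking_row[OF a]) (use that row1 w1_def in auto)
      then show False using na that uv by blast
    qed
  qed
  have n2: "\<not> attacking P x w2" if "x \<in> R" "x \<noteq> u" "x \<noteq> v" for x
  proof
    assume a: "attacking P x w2"
    then consider "fst x = fst w2" | "snd x = snd w2" unfolding attacking_def by auto
    then show False
    proof cases
      case 1
      then have "attacking P x v" by (rule attacking_column[OF a]) (use that col2 w2_def in auto)
      then show False using na that uv by blast
    next
      case 2
      then have "attacking P x u" by (rule attacking_row[OF a]) (use that row2 w2_def in auto)
      then show False using na that uv by blast
    qed
  qed
  have au: "attacking P w1 u" "attacking P w2 v"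
    using col1 col2 lt unfolding attacking_def interval_def w1_def w2_def by (auto simp: prod_eq_iff)
  then have notin: "w1 \<notin> R" "w2 \<notin> R" using na uv by blast+
  have ne: "u \<noteq> v" "w1 \<noteq> w2" using lt unfolding w1_def w2_def by auto
  have "card {u, v} \<le> card R" using uv fin by (intro card_mono) auto
  then have card': "card R' = k" unfolding R'_def
    using fin uv notin ne cardR by (subst card_Un_disjoint) (auto simp: card_Diff_subset)
  have n12: "\<not> attacking P w1 w2" "\<not> attacking P w2 w1" "\<not> attacking P w1 w1" "\<not> attacking P w2 w2"
    using lt unfolding attacking_def w1_def w2_def by auto
  have R'rc: "R' \<in> rook_configs P k"
  proof -
    have "w1 \<in> P" "w2 \<in> P" unfolding w1_def w2_def using rect lt by auto
    then have "R' \<subseteq> P" using P unfolding R'_def by auto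
    moreover have "\<not> attacking P x y" if "x \<in> R'" "y \<in> R'" for x y
      using that n1 n2 n12 na attacking_sym unfolding R'_def by blast
    ultimately show ?thesis using fin card' unfolding rook_configs_def R'_def by auto
  qed
  have "inner_interval P (fst u, snd v) (fst v + 1, snd u + 1)"
    using rect lt unfolding inner_interval_def proper_corners_def cells_in_interval by auto
  moreover have "antidiagonal_cells (fst u, snd v) (fst v + 1, snd u + 1) = {u, v}"
    "diagonal_cells (fst u, snd v) (fst v + 1, snd u + 1) = {w1, w2}"
    unfolding antidiagonal_cells_def diagonal_cells_def w1_def w2_def by auto
  moreover have "card {u, v} = 2" using ne by simp
  ultimately have "switch P k R R'"
    unfolding switch_def using R R'rc uv R'_def by blast
  moreover have "sum defect R' < sum defect R"
  proof -
    have "sum defect R' = sum defect (R - {u, v}) + sum defect {w1, w2}"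
      unfolding R'_def using fin notin by (intro sum.union_disjoint) auto
    moreover have "sum defect R = sum defect (R - {u, v}) + sum defect {u, v}"
      using uv fin by (intro sum.subset_diff) auto
    moreover have "sum defect {w1, w2} < sum defect {u, v}"
      using defect_straighten[OF uv(3)] P ne mem_P[of "fst u" "snd u"] mem_P[of "fst v" "snd v"]
      unfolding w1_def w2_def by auto
    ultimately show ?thesis by simp
  qed
  ultimately show ?thesis by blast
qed

lemma straight_representative:
  assumes "R \<in> rook_configs P k"
  shows "\<exists>R'. equivclp (switch P k) R R' \<and> R' \<in> rook_configs P k \<and> straight R'"
  using assms
proof (induction "sum defect R" arbitrary: R rule: less_induct)
  case less
  show ?case
  proof (cases "straight R")
    case True
    then show ?thesis using less.prems by (intro exI[of _ R]) auto
  next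
    case False
    then obtain u v where "u \<in> R" "v \<in> R" "antidiag u v" "\<not> (u \<in> C.U \<and> v \<in> C.L)"
      unfolding straight_def by blast
    then obtain R1 where R1: "switch P k R R1" "sum defect R1 < sum defect R"
      using straightening_switch[OF less.prems] by blast
    then have "R1 \<in> rook_configs P k" unfolding switch_def by blast
    then obtain R' where R': "equivclp (switch P k) R1 R'" "R' \<in> rook_configs P k" "straight R'"
      using less.hyps[OF R1(2)] by blast
    have "equivclp (switch P k) R R1"
      using R1(1) by (rule r_into_equivclp)
    then have "equivclp (switch P k) R R'"
      using R'(1) by (rule equivclp_trans)
    then show ?thesis using R' by (intro exI[of _ R']) auto
  qed
qed

lemma equivclp_switch_weight: "equivclp (switch P k) R R' \<Longrightarrow> sum C.W R = sum C.W R'"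
  by (induction rule: equivclp_induct) (auto dest: switch_weight)

text \<open>A straight configuration is a normal multiset without repetitions, so the uniqueness of
  normal forms applies to cells as it does to vertices.\<close>

lemma straight_unique:
  assumes "R \<in> rook_configs P k" "R' \<in> rook_configs P k" "straight R" "straight R'" "sum C.W R = sum C.W R'"
  shows "R = R'"
proof -
  have fin: "finite R" "finite R'" using assms unfolding rook_configs_def by auto
  have "mset_set R = mset_set R'"
  proof (rule C.normal_unique)
    show "C.normal (mset_set R)" "C.normal (mset_set R')"
      using assms(1-4) fin cells_eq unfolding C.normal_def straight_def rook_configs_def by auto
    show "C.WM (mset_set R) = C.WM (mset_set R')"
      using assms(5) by (simp add: sum_unfold_sum_mset)
  qed
  then show ?thesis using fin by (metis finite_set_mset_mset_set)
qed

text \<open>Each class contains exactly one straight configuration: one exists by descent, and two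
  would have the same weight.\<close>

lemma switching_rook_count_eq: "switching_rook_count P k = card {R \<in> cliques adjC P. card R = k}"
proof -
  let ?E = "switch_equivalence P k" and ?S = "{R \<in> cliques adjC P. card R = k}"
  have S: "R \<in> ?S \<longleftrightarrow> R \<in> rook_configs P k \<and> straight R" for R
    using cliques_iff[of R] unfolding rook_configs_def by auto
  have equiv: "equiv (rook_configs P k) ?E"
  proof (rule equivI)
    show "?E \<subseteq> rook_configs P k \<times> rook_configs P k" "refl_on (rook_configs P k) ?E"
      unfolding switch_equivalence_def refl_on_def by auto
    show "sym ?E" unfolding switch_equivalence_def sym_def by (auto simp: equivclp_sym)
    show "trans ?E" unfolding switch_equivalence_def trans_def using equivclp_trans by fastforce
  qed
  have "bij_betw (\<lambda>R. ?E `` {R}) ?S (rook_configs P k // ?E)"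
  proof (rule bij_betwI')
    fix R R' assume RR: "R \<in> ?S" "R' \<in> ?S"
    show "(?E `` {R} = ?E `` {R'}) = (R = R')"
    proof
      assume "?E `` {R} = ?E `` {R'}"
      then have "(R, R') \<in> ?E" using RR S eq_equiv_class[OF _ equiv] by blast
      then have "equivclp (switch P k) R R'" unfolding switch_equivalence_def by blast
      then show "R = R'"
        using RR S straight_unique[of R k R'] equivclp_switch_weight[of k R R'] by simp
    qed simp
  next
    fix R assume "R \<in> ?S"
    then show "?E `` {R} \<in> rook_configs P k // ?E" using S by (blast intro: quotientI)
  next
    fix X assume "X \<in> rook_configs P k // ?E"
    then obtain R where R: "R \<in> rook_configs P k" "X = ?E `` {R}" by (blast elim: quotientE)
    obtain R' where "equivclp (switch P k) R R'" "R' \<in> rook_configs P k" "straight R'"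
      using straight_representative[OF R(1)] by blast
    then have "(R, R') \<in> ?E" "R' \<in> ?S" using R S unfolding switch_equivalence_def by auto
    then show "\<exists>R'\<in>?S. X = ?E `` {R'}" using R equiv_class_eq[OF equiv] by blast
  qed
  from bij_betw_same_card[OF this] show ?thesis unfolding switching_rook_count_def by simp
qed

lemma card_le_rook_number:
  assumes "R \<in> cliques adjC P"
  shows "card R \<le> rook_number P"
proof -
  have "{k. rook_configs P k \<noteq> {}} \<subseteq> {..card P}"
    using card_mono[OF finite_P] unfolding rook_configs_def by auto
  then have "finite {k. rook_configs P k \<noteq> {}}" using finite_subset by blast
  then show ?thesis unfolding rook_number_def using cliques_rook_configs[OF assms] by (intro Max_ge) auto
qed

lemma clique_poly_rooks:
  "clique_poly adjC P t = (\<Sum>k\<le>rook_number P. of_nat (switching_rook_count P k) * t ^ k)"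
proof -
  have "(\<Sum>R\<in>cliques adjC P. t ^ card R)
      = (\<Sum>k\<le>rook_number P. \<Sum>R\<in>{R \<in> cliques adjC P. card R = k}. t ^ card R)"
    by (rule sum.group[symmetric]) (use finite_cliques[OF finite_P] card_le_rook_number in auto)
  also have "\<dots> = (\<Sum>k\<le>rook_number P. of_nat (switching_rook_count P k) * t ^ k)"
    by (rule sum.cong) (auto simp: switching_rook_count_eq)
  finally show ?thesis unfolding clique_poly_def .
qed

lemma fps_of_switching_rook_poly: "fps_of_poly (switching_rook_poly P) = clique_poly adjC P fps_X"
  unfolding switching_rook_poly_def clique_poly_rooks
  by (simp add: fps_of_poly_sum fps_of_poly_monom fps_of_nat)

lemma switching_rook_poly_at_1: "poly (switching_rook_poly P) 1 \<noteq> 0"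
proof -
  have "{} \<in> {R \<in> cliques adjC P. card R = 0}" unfolding cliques_def by auto
  moreover have "finite {R \<in> cliques adjC P. card R = 0}" using finite_cliques[OF finite_P] by auto
  ultimately have "0 < switching_rook_count P 0"
    unfolding switching_rook_count_eq using card_gt_0_iff by blast
  then have "0 < (\<Sum>k\<le>rook_number P. int (switching_rook_count P k))"
    by (intro sum_pos2[of _ 0]) auto
  then show ?thesis unfolding switching_rook_poly_def by (simp add: poly_sum poly_monom)
qed

end

section \<open>Monomial maps of polynomial rings\<close>

text \<open>The linear extension of a map between monomials; for additive \<open>h\<close> it is a
  homomorphism of monoid algebras. The toric map, the normal form and the passage between toric maps
  are all instances.\<close>

definition push :: "('a \<Rightarrow> 'b) \<Rightarrow> ('a \<Rightarrow>\<^sub>0 'c::comm_monoid_add) \<Rightarrow> 'b \<Rightarrow>\<^sub>0 'c" where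
  "push h p = (\<Sum>m\<in>Poly_Mapping.keys p. Poly_Mapping.single (h m) (Poly_Mapping.lookup p m))"

lemma push_superset:
  assumes "finite S" "Poly_Mapping.keys p \<subseteq> S"
  shows "push h p = (\<Sum>m\<in>S. Poly_Mapping.single (h m) (Poly_Mapping.lookup p m))"
  unfolding push_def
  by (rule sum.mono_neutral_left) (use assms in \<open>auto simp: in_keys_iff\<close>)

lemma push_single [simp]: "push h (Poly_Mapping.single m c) = Poly_Mapping.single (h m) c"
  by (subst push_superset[of "{m}"]) auto

lemma push_0 [simp]: "push h 0 = 0" unfolding push_def by simp

lemma push_add: "push h (p + q) = push h p + push h q"
proof -
  let ?S = "Poly_Mapping.keys p \<union> Poly_Mapping.keys q"
  have "finite ?S" by simp
  then show ?thesis
    using Poly_Mapping.keys_add[of p q]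
    by (simp add: push_superset[of ?S] lookup_add single_add sum.distrib)
qed

lemma push_uminus: "push h (- p) = - push h (p :: 'a \<Rightarrow>\<^sub>0 'c::ab_group_add)"
  unfolding push_def by (simp add: single_uminus sum_negf)

lemma push_diff: "push h (p - q) = push h p - push h (q :: 'a \<Rightarrow>\<^sub>0 'c::ab_group_add)"
  using push_add[of h p "- q"] by (simp add: push_uminus)

lemma push_sum: "push h (sum f A) = (\<Sum>x\<in>A. push h (f x))"
  by (induction A rule: infinite_finite_induct) (auto simp: push_add)

lemma sum_keys_single: "(\<Sum>m\<in>Poly_Mapping.keys p. Poly_Mapping.single m (Poly_Mapping.lookup p m)) = p"
proof (rule poly_mapping_eqI)
  fix k
  show "Poly_Mapping.lookup (\<Sum>m\<in>Poly_Mapping.keys p. Poly_Mapping.single m (Poly_Mapping.lookup p m)) k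
      = Poly_Mapping.lookup p k"
    by (cases "k \<in> Poly_Mapping.keys p")
      (auto simp: lookup_sum lookup_single when_def sum.delta in_keys_iff)
qed

lemma push_push: "push g (push h p) = push (\<lambda>m. g (h m)) p"
  by (subst (2) push_def, subst push_sum) (simp add: push_def[of "\<lambda>m. g (h m)"])

lemma push_ident: "(\<And>m. m \<in> Poly_Mapping.keys p \<Longrightarrow> h m = m) \<Longrightarrow> push h p = p"
  unfolding push_def by (subst sum_keys_single[symmetric, of p]) (rule sum.cong, auto)

lemma push_mult:
  fixes p q :: "'a::monoid_add \<Rightarrow>\<^sub>0 'c::comm_ring_1" and h :: "'a \<Rightarrow> 'b::monoid_add"
  assumes "\<And>x y. h (x + y) = h x + h y"
  shows "push h (p * q) = push h p * push h q"
proof -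
  have "push h (p * q) = push h ((\<Sum>m\<in>Poly_Mapping.keys p. Poly_Mapping.single m (Poly_Mapping.lookup p m)) *
     (\<Sum>m\<in>Poly_Mapping.keys q. Poly_Mapping.single m (Poly_Mapping.lookup q m)))"
    by (simp only: sum_keys_single)
  also have "\<dots> = push h p * push h q"
    unfolding push_def[of h p] push_def[of h q]
    by (simp only: sum_product push_sum mult_single push_single assms)
  finally show ?thesis .
qed

lemma keys_push:
  fixes p :: "'a \<Rightarrow>\<^sub>0 'c::comm_monoid_add" and h :: "'a \<Rightarrow> 'b"
  shows "Poly_Mapping.keys (push h p) \<subseteq> h ` Poly_Mapping.keys p"
proof -
  have "Poly_Mapping.keys (sum f A) \<subseteq> (\<Union>x\<in>A. Poly_Mapping.keys (f x))" for f :: "'a \<Rightarrow> 'b \<Rightarrow>\<^sub>0 'c" and A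
  proof (induction A rule: infinite_finite_induct)
    case (insert x F)
    then show ?case using Poly_Mapping.keys_add[of "f x" "sum f F"] by auto
  qed auto
  from this[of "\<lambda>m. Poly_Mapping.single (h m) (Poly_Mapping.lookup p m)"]
  show ?thesis unfolding push_def by (auto split: if_splits)
qed

definition mset_of :: "('a \<Rightarrow>\<^sub>0 nat) \<Rightarrow> 'a multiset" where
  "mset_of m = (\<Sum>v\<in>Poly_Mapping.keys m. replicate_mset (Poly_Mapping.lookup m v) v)"

definition mon_of :: "'a multiset \<Rightarrow> ('a \<Rightarrow>\<^sub>0 nat)" where
  "mon_of M = sum_mset (image_mset (\<lambda>v. Poly_Mapping.single v 1) M)"

lemma count_mset_of [simp]: "count (mset_of m) v = Poly_Mapping.lookup m v"
  unfolding mset_of_def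
  by (cases "v \<in> Poly_Mapping.keys m") (auto simp: count_sum sum.delta in_keys_iff)

lemma lookup_mon_of [simp]: "Poly_Mapping.lookup (mon_of M) v = count M v"
  unfolding mon_of_def by (induction M) (auto simp: lookup_add lookup_single when_def)

lemma mset_of_mon_of [simp]: "mset_of (mon_of M) = M" by (rule multiset_eqI) simp
lemma mon_of_mset_of [simp]: "mon_of (mset_of m) = m" by (rule poly_mapping_eqI) simp

lemma mset_of_add: "mset_of (a + b) = mset_of a + mset_of b"
  by (rule multiset_eqI) (simp add: lookup_add)

lemma mset_of_single [simp]: "mset_of (Poly_Mapping.single v 1) = {#v#}"
  by (rule multiset_eqI) (simp add: lookup_single when_def)

lemma mset_of_0 [simp]: "mset_of 0 = {#}" by (rule multiset_eqI) simp

lemma set_mset_of [simp]: "set_mset (mset_of m) = Poly_Mapping.keys m"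
  unfolding set_eq_iff by (simp only: count_greater_zero_iff[symmetric] count_mset_of in_keys_iff neq0_conv simp_thms)

lemma keys_mon_of [simp]: "Poly_Mapping.keys (mon_of M) = set_mset M"
  unfolding set_eq_iff by (simp only: count_greater_zero_iff[symmetric] lookup_mon_of in_keys_iff neq0_conv simp_thms)

lemma size_mset_of: "size (mset_of m) = (\<Sum>v\<in>Poly_Mapping.keys m. Poly_Mapping.lookup m v)"
  unfolding mset_of_def by (simp add: size_multiset_sum)

text \<open>On weight monomials this sets the variables with index outside \<open>T\<close> to
  1.\<close>

definition restr :: "'a set \<Rightarrow> ('a \<Rightarrow>\<^sub>0 'b::zero) \<Rightarrow> 'a \<Rightarrow>\<^sub>0 'b" where
  "restr T w = Abs_poly_mapping (\<lambda>i. Poly_Mapping.lookup w i when i \<in> T)"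

lemma lookup_restr [simp]: "Poly_Mapping.lookup (restr T w) i = (if i \<in> T then Poly_Mapping.lookup w i else 0)"
proof -
  have "finite {i. (Poly_Mapping.lookup w i when i \<in> T) \<noteq> 0}"
    by (rule finite_subset[OF _ finite_keys[of w]]) (auto simp: in_keys_iff)
  then show ?thesis unfolding restr_def by (simp add: when_def)
qed

lemma restr_add: "restr T (v + w) = restr T v + restr T w"
  by (rule poly_mapping_eqI) (simp add: lookup_add)

lemma restr_UNIV [simp]: "restr UNIV w = w"
  by (rule poly_mapping_eqI) simp

lemma restr_restr [simp]: "restr T (restr T' w) = restr (T \<inter> T') w"
  by (rule poly_mapping_eqI) simp

lemma restr_0 [simp]: "restr T 0 = 0" by (rule poly_mapping_eqI) simp


lemma mpoly_ring_simps [simp]: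
  "monoid.mult (mpoly_ring V) = (*)" "one (mpoly_ring V) = 1" "zero (mpoly_ring V) = 0" "add (mpoly_ring V) = (+)"
  unfolding mpoly_ring_def by simp_all

lemma mem_mpoly_ring: "p \<in> carrier (mpoly_ring V) \<longleftrightarrow> (\<forall>m\<in>Poly_Mapping.keys p. Poly_Mapping.keys m \<subseteq> V)"
  unfolding mpoly_ring_def by simp

lemma mpoly_ring_closed:
  assumes "p \<in> carrier (mpoly_ring V)" "q \<in> carrier (mpoly_ring V)"
  shows "p + q \<in> carrier (mpoly_ring V)" "p - q \<in> carrier (mpoly_ring V)" "p * q \<in> carrier (mpoly_ring V)"
    "- p \<in> carrier (mpoly_ring V)"
proof -
  interpret cring "mpoly_ring V" by (rule cring_mpoly_ring)
  show "p + q \<in> carrier (mpoly_ring V)" "p * q \<in> carrier (mpoly_ring V)"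
    using a_closed[OF assms] m_closed[OF assms] by simp_all
  show "- p \<in> carrier (mpoly_ring V)" using assms by (simp add: mem_mpoly_ring)
  show "p - q \<in> carrier (mpoly_ring V)"
    using assms Poly_Mapping.keys_diff[of p q] unfolding mem_mpoly_ring by blast
qed

lemma mpoly_ring_a_inv:
  assumes "p \<in> carrier (mpoly_ring V)"
  shows "\<ominus>\<^bsub>mpoly_ring V\<^esub> p = - p"
proof -
  interpret cring "mpoly_ring V" by (rule cring_mpoly_ring)
  show ?thesis using minus_equality[of "- p" p] assms mpoly_ring_closed[OF assms assms] by simp
qed

lemma mpoly_ring_minus:
  assumes "p \<in> carrier (mpoly_ring V)" "q \<in> carrier (mpoly_ring V)"
  shows "p \<ominus>\<^bsub>mpoly_ring V\<^esub> q = p - q"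
  unfolding a_minus_def using mpoly_ring_a_inv[OF assms(2)] by simp

lemma single_in_mpoly_ring: "Poly_Mapping.keys m \<subseteq> V \<Longrightarrow> Poly_Mapping.single m c \<in> carrier (mpoly_ring V)"
  by (simp add: mem_mpoly_ring)

lemma const_in_mpoly_ring: "const c \<in> carrier (mpoly_ring V)"
  unfolding const_def by (rule single_in_mpoly_ring) simp

lemma var_in_mpoly_ring: "v \<in> V \<Longrightarrow> var v \<in> carrier (mpoly_ring V)"
  unfolding var_def by (rule single_in_mpoly_ring) simp

lemma const_simps:
  "const (a + b) = const a + const b" "const (a * b) = const a * const b" "const 1 = 1" "const 0 = 0"
  "const (- a) = - const a"
  unfolding const_def by (simp_all add: single_add mult_single single_uminus)

lemma const_mult_single: "const c * Poly_Mapping.single m d = Poly_Mapping.single m (c * d)"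
  unfolding const_def by (simp add: mult_single)

lemma subfield_const: "subfield (range const) (mpoly_ring V :: 'k::field mpoly ring)"
proof -
  let ?R = "mpoly_ring V :: 'k mpoly ring"
  interpret cring ?R by (rule cring_mpoly_ring)
  have "subring (range const) ?R"
  proof (rule subringI)
    show "range const \<subseteq> carrier ?R" using const_in_mpoly_ring by auto
    show "\<one>\<^bsub>?R\<^esub> \<in> range const" using const_simps(3) by (metis mpoly_ring_simps(2) rangeI)
    show "\<ominus>\<^bsub>?R\<^esub> h \<in> range const" if "h \<in> range const" for h
    proof -
      obtain c where "h = const c" using \<open>h \<in> range const\<close> by auto
      then have "\<ominus>\<^bsub>?R\<^esub> h = const (- c)"
        using mpoly_ring_a_inv[OF const_in_mpoly_ring] by (simp add: const_simps(5))
      then show ?thesis by simp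
    qed
    show "x \<otimes>\<^bsub>?R\<^esub> y \<in> range const" "x \<oplus>\<^bsub>?R\<^esub> y \<in> range const"
      if "x \<in> range const" "y \<in> range const" for x y
    proof -
      obtain c d where "x = const c" "y = const d" using \<open>x \<in> range const\<close> \<open>y \<in> range const\<close> by auto
      then have "x \<otimes>\<^bsub>?R\<^esub> y = const (c * d)" "x \<oplus>\<^bsub>?R\<^esub> y = const (c + d)" by (simp_all add: const_simps)
      then show "x \<otimes>\<^bsub>?R\<^esub> y \<in> range const" "x \<oplus>\<^bsub>?R\<^esub> y \<in> range const" by simp_all
    qed
  qed
  moreover have "subfield (range const) ?R" if "subcring (range const) ?R"
  proof (rule subfieldI[OF that])
    have inv: "const c * const (inverse c) = (1 :: 'k mpoly)" if "c \<noteq> 0" for c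
      using that by (simp add: const_simps(2,3)[symmetric])
    have ne: "const c \<noteq> (0 :: 'k mpoly)" if "c \<noteq> 0" for c
      using inv[OF that] by auto
    show "Units (?R\<lparr>carrier := range const\<rparr>) = range const - {\<zero>\<^bsub>?R\<^esub>}"
    proof
      show "Units (?R\<lparr>carrier := range const\<rparr>) \<subseteq> range const - {\<zero>\<^bsub>?R\<^esub>}"
        unfolding Units_def by auto
      show "range const - {\<zero>\<^bsub>?R\<^esub>} \<subseteq> Units (?R\<lparr>carrier := range const\<rparr>)"
      proof
        fix x assume "x \<in> range const - {\<zero>\<^bsub>?R\<^esub>}"
        then obtain c where c: "x = const c" and "x \<noteq> 0" by auto
        then have c0: "c \<noteq> 0" using const_simps(4) by metis
        then show "x \<in> Units (?R\<lparr>carrier := range const\<rparr>)"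
          unfolding Units_def c using inv[OF c0] by (auto simp: mult.commute intro!: bexI[of _ "const (inverse c)"])
      qed
    qed
  qed
  ultimately show ?thesis
    using subcringI' by blast
qed

lemma Span_monomials:
  assumes "\<And>m. m \<in> set Ms \<Longrightarrow> Poly_Mapping.keys m \<subseteq> V"
  shows "ring.Span (mpoly_ring V) (range const) (map (\<lambda>m. Poly_Mapping.single m (1::'k::field)) Ms)
    = {p. Poly_Mapping.keys p \<subseteq> set Ms}"
  using assms
proof (induction Ms)
  interpret cring "mpoly_ring V :: 'k mpoly ring" by (rule cring_mpoly_ring)
  case Nil
  then show ?case by auto
next
  interpret cring "mpoly_ring V :: 'k mpoly ring" by (rule cring_mpoly_ring)
  case (Cons m Ms)
  have IH: "foldr (line_extension (range const)) (map (\<lambda>m. Poly_Mapping.single m 1) Ms) {0}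
      = {p :: 'k mpoly. Poly_Mapping.keys p \<subseteq> set Ms}"
    using Cons by simp
  have "line_extension (range const) (Poly_Mapping.single m 1) {p :: 'k mpoly. Poly_Mapping.keys p \<subseteq> set Ms}
      = {p. Poly_Mapping.keys p \<subseteq> insert m (set Ms)}"
  proof (intro equalityI subsetI)
    fix p :: "'k mpoly" assume "p \<in> line_extension (range const) (Poly_Mapping.single m 1) {p. Poly_Mapping.keys p \<subseteq> set Ms}"
    then obtain c q where "p = Poly_Mapping.single m c + q" "Poly_Mapping.keys q \<subseteq> set Ms"
      unfolding line_extension_mem_iff by (auto simp: const_mult_single)
    then show "p \<in> {p. Poly_Mapping.keys p \<subseteq> insert m (set Ms)}"
      using Poly_Mapping.keys_add[of "Poly_Mapping.single m c" q] by (auto split: if_splits)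
  next
    fix p :: "'k mpoly" assume p: "p \<in> {p. Poly_Mapping.keys p \<subseteq> insert m (set Ms)}"
    define q where "q = p - Poly_Mapping.single m (Poly_Mapping.lookup p m)"
    have "Poly_Mapping.keys q \<subseteq> set Ms"
    proof
      fix x assume "x \<in> Poly_Mapping.keys q"
      then have "x \<noteq> m" "x \<in> Poly_Mapping.keys p"
        unfolding q_def by (auto simp: in_keys_iff lookup_minus lookup_single when_def split: if_splits)
      then show "x \<in> set Ms" using p by auto
    qed
    moreover have "p = const (Poly_Mapping.lookup p m) * Poly_Mapping.single m 1 + q"
      unfolding q_def by (simp add: const_mult_single)
    ultimately show "p \<in> line_extension (range const) (Poly_Mapping.single m 1) {p. Poly_Mapping.keys p \<subseteq> set Ms}"
      unfolding line_extension_mem_iff by auto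
  qed
  then show ?case using IH by simp
qed

lemma dimension_monomials:
  assumes "finite S" "\<And>m. m \<in> S \<Longrightarrow> Poly_Mapping.keys m \<subseteq> V"
  shows "ring.dimension (mpoly_ring V) (card S) (range const) {p :: 'k::field mpoly. Poly_Mapping.keys p \<subseteq> S}"
proof -
  let ?s = "\<lambda>m. Poly_Mapping.single m (1::'k)"
  interpret cring "mpoly_ring V :: 'k mpoly ring" by (rule cring_mpoly_ring)
  obtain Ms where Ms: "set Ms = S" "distinct Ms" using finite_distinct_list[OF assms(1)] by blast
  have "independent (range const) (map ?s Ms)"
    using Ms(2) assms(2) unfolding Ms(1)[symmetric]
  proof (induction Ms)
    case (Cons m Ms)
    have "?s m \<notin> Span (range const) (map ?s Ms)"
      using Span_monomials[of Ms V, where 'k = 'k] Cons.prems by auto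
    moreover have "?s m \<in> carrier (mpoly_ring V)" using Cons.prems by (auto intro: single_in_mpoly_ring)
    moreover have "independent (range const) (map ?s Ms)" using Cons by auto
    ultimately show ?case unfolding list.map by (intro li_Cons)
  qed simp
  moreover have "length Ms = card S" using Ms distinct_card by metis
  ultimately show ?thesis
    using dimension_independent[of "range const" "map ?s Ms"] Span_monomials[of Ms V, where 'k = 'k] assms(2) Ms(1)
    by simp
qed

section \<open>The Hilbert series\<close>


lemma finite_msets_support: "finite F \<Longrightarrow> finite {M. set_mset M \<subseteq> F \<and> size M = k}"
proof (induction k)
  case (Suc k)
  have "{M. set_mset M \<subseteq> F \<and> size M = Suc k}
      \<subseteq> (\<lambda>(x, M). add_mset x M) ` (F \<times> {M. set_mset M \<subseteq> F \<and> size M = k})"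
  proof
    fix M assume M: "M \<in> {M. set_mset M \<subseteq> F \<and> size M = Suc k}"
    then obtain x M' where "M = add_mset x M'" by (auto dest: size_eq_Suc_imp_eq_union)
    then show "M \<in> (\<lambda>(x, M). add_mset x M) ` (F \<times> {M. set_mset M \<subseteq> F \<and> size M = k})"
      using M by (intro image_eqI[of _ _ "(x, M')"]) auto
  qed
  then show ?case using Suc by (meson finite_SigmaI finite_imageI finite_subset)
qed simp

lemma finite_msets_support_eq: "finite F \<Longrightarrow> finite {M. set_mset M = F \<and> size M = k}"
  by (rule finite_subset[OF _ finite_msets_support[of F k]]) auto

definition ones :: "'a::comm_ring_1 fps" where "ones = Abs_fps (\<lambda>_. 1)"

lemma ones_unit: "ones * (1 - fps_X) = 1"
proof -
  have "fps_nth (fps_X * ones) k = (if k = 0 then 0 else 1)" for k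
    by (cases k) (simp_all add: ones_def)
  then show ?thesis by (intro fps_ext) (simp add: algebra_simps ones_def fps_sub_nth)
qed

text \<open>The multisets are sorted by the size \<open>i\<close> of their part over
  \<open>F\<close>; the remaining multiplicity \<open>k - i\<close> of \<open>x\<close> is positive
  because \<open>i < k\<close>.\<close>

lemma card_msets_insert:
  assumes F: "finite F" "x \<notin> F"
  shows "card {M. set_mset M = insert x F \<and> size M = k} = (\<Sum>i<k. card {M. set_mset M = F \<and> size M = i})"
proof -
  let ?S = "\<lambda>i. {M. set_mset M = F \<and> size M = i}"
  let ?h = "\<lambda>i M. M + replicate_mset (k - i) x"
  have "{M. set_mset M = insert x F \<and> size M = k} = (\<Union>i<k. ?h i ` ?S i)"
  proof (intro equalityI subsetI)
    fix M assume M: "M \<in> {M. set_mset M = insert x F \<and> size M = k}"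
    define M' where "M' = filter_mset (\<lambda>y. y \<noteq> x) M"
    have split: "M = M' + replicate_mset (count M x) x"
      unfolding M'_def by (rule multiset_eqI) auto
    then have size: "k = size M' + count M x" using M by (metis (mono_tags, lifting) mem_Collect_eq size_replicate_mset size_union)
    have "0 < count M x" using M by auto
    moreover have "set_mset M' = F" using M F unfolding M'_def by auto
    ultimately show "M \<in> (\<Union>i<k. ?h i ` ?S i)"
      using split size by (intro UN_I[of "size M'"] image_eqI[of _ _ M']) auto
  next
    fix M assume "M \<in> (\<Union>i<k. ?h i ` ?S i)"
    then show "M \<in> {M. set_mset M = insert x F \<and> size M = k}" by auto
  qed
  moreover have "card (\<Union>i<k. ?h i ` ?S i) = (\<Sum>i<k. card (?h i ` ?S i))"
  proof (rule card_UN_disjoint)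
    show "\<forall>i\<in>{..<k}. finite (?h i ` ?S i)" using finite_msets_support_eq[OF F(1)] by simp
    show "\<forall>i\<in>{..<k}. \<forall>j\<in>{..<k}. i \<noteq> j \<longrightarrow> ?h i ` ?S i \<inter> ?h j ` ?S j = {}"
    proof (intro ballI impI)
      fix i j assume ij: "i \<in> {..<k}" "j \<in> {..<k}" "i \<noteq> j"
      have cnt: "count y x = k - l" if "y \<in> ?h l ` ?S l" for l y
        using that F(2) by (auto simp: count_eq_zero_iff)
      have "k - i \<noteq> k - j" using ij by auto
      then show "?h i ` ?S i \<inter> ?h j ` ?S j = {}" using cnt[of _ i] cnt[of _ j] by force
    qed
  qed simp
  moreover have "card (?h i ` ?S i) = card (?S i)" for i
    by (rule card_image) (auto simp: inj_on_def)
  ultimately show ?thesis by simp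
qed

lemma msets_support_fps:
  assumes "finite F"
  shows "Abs_fps (\<lambda>k. of_nat (card {M. set_mset M = F \<and> size M = k})) = (fps_X * ones :: 'a::comm_ring_1 fps) ^ card F"
  using assms
proof (induction F rule: finite_induct)
  case empty
  have "{M :: 'b multiset. set_mset M = {} \<and> size M = k} = (if k = 0 then {{#}} else {})" for k by auto
  then show ?case by (intro fps_ext) auto
next
  case (insert x F)
  let ?A = "Abs_fps (\<lambda>k. of_nat (card {M. set_mset M = F \<and> size M = k})) :: 'a fps"
  have "Abs_fps (\<lambda>k. of_nat (card {M. set_mset M = insert x F \<and> size M = k})) = (fps_X * ones) * ?A"
  proof (rule fps_ext)
    fix k
    have "fps_nth ((fps_X * ones) * ?A) k = fps_nth (?A * ones * fps_X) k" by (simp add: ac_simps)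
    also have "\<dots> = (\<Sum>i<k. fps_nth ?A i)"
    proof (cases k)
      case (Suc l)
      then have "fps_nth (?A * ones * fps_X) k = fps_nth (?A * ones) l"
        by (simp only: fps_X_mult_right_nth) simp
      also have "\<dots> = (\<Sum>i<k. fps_nth ?A i)"
        unfolding fps_mult_nth Suc by (simp add: ones_def lessThan_Suc_atMost atMost_atLeast0)
      finally show ?thesis .
    qed simp
    finally show "fps_nth (Abs_fps (\<lambda>k. of_nat (card {M. set_mset M = insert x F \<and> size M = k}))) k = fps_nth ((fps_X * ones) * ?A) k"
      using card_msets_insert[OF insert.hyps(1,2), of k] by simp
  qed
  then show ?case using insert by simp
qed


section \<open>The polyomino ideal as the kernel of a monomial map\<close>

context frame_data
begin

definition wt :: "(point \<Rightarrow>\<^sub>0 nat) \<Rightarrow> weight" where "wt e = V.WM (mset_of e)"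

definition toric :: "(nat \<times> int) set \<Rightarrow> 'k::field mpoly \<Rightarrow> weight \<Rightarrow>\<^sub>0 'k" where
  "toric T = push (\<lambda>e. restr T (wt e))"

abbreviation PR :: "'k::field mpoly ring" where "PR \<equiv> mpoly_ring (vertex_set P)"

definition toric_ker :: "(nat \<times> int) set \<Rightarrow> 'k::field mpoly set" where
  "toric_ker T = {p \<in> carrier PR. toric T p = 0}"

lemma wt_add: "wt (a + b) = wt a + wt b" unfolding wt_def by (simp add: mset_of_add)
lemma wt_0 [simp]: "wt 0 = 0" unfolding wt_def by simp
lemma wt_single [simp]: "wt (Poly_Mapping.single v (Suc 0)) = V.W v"
  unfolding wt_def using mset_of_single[of v] by simp

lemma toric_add: "toric T (p + q) = toric T p + toric T q" unfolding toric_def by (rule push_add)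
lemma toric_diff: "toric T (p - q) = toric T p - toric T q" unfolding toric_def by (rule push_diff)
lemma toric_uminus: "toric T (- p) = - toric T p" unfolding toric_def by (rule push_uminus)
lemma toric_mult: "toric T (p * q) = toric T p * toric T q"
  unfolding toric_def by (rule push_mult) (simp add: wt_add restr_add)
lemma toric_0 [simp]: "toric T 0 = 0" unfolding toric_def by simp
lemma toric_1 [simp]: "toric T 1 = 1"
proof -
  have "toric T (Poly_Mapping.single 0 1) = Poly_Mapping.single (restr T (wt 0)) 1"
    unfolding toric_def by (rule push_single)
  then show ?thesis by simp
qed
lemma toric_var: "toric T (var v) = Poly_Mapping.single (restr T (V.W v)) 1"
  unfolding toric_def var_def by simp

text \<open>Weights carry a linear order compatible with addition, based on the lexicographic order
  of the index pairs. Their monoid algebra over a field therefore has no zero divisors, and the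
  kernel of a ring map into it is prime.\<close>

lemma primeideal_toric_ker: "primeideal (toric_ker T :: 'k::field mpoly set) PR"
proof -
  interpret cring "PR :: 'k mpoly ring" by (rule cring_mpoly_ring)
  show ?thesis
  proof (rule primeidealI)
    show "ideal (toric_ker T) (PR :: 'k mpoly ring)"
    proof (rule idealI)
      show "ring (PR :: 'k mpoly ring)" by (rule ring_axioms)
      show "subgroup (toric_ker T) (add_monoid (PR :: 'k mpoly ring))"
      proof (rule add.subgroupI)
        show "toric_ker T \<noteq> ({} :: 'k mpoly set)"
          unfolding toric_ker_def using zero_closed by auto
        show "\<ominus>\<^bsub>PR\<^esub> p \<in> toric_ker T" if "p \<in> toric_ker T" for p :: "'k mpoly"
          using that mpoly_ring_a_inv[of p] mpoly_ring_closed(4)[of p _ p]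
          unfolding toric_ker_def by (simp add: toric_uminus)
      qed (auto simp: toric_ker_def toric_add mpoly_ring_closed)
    qed (auto simp: toric_ker_def toric_mult mpoly_ring_closed)
    show "cring (PR :: 'k mpoly ring)" by (rule is_cring)
    have "(1 :: 'k mpoly) \<in> carrier PR" "(1 :: 'k mpoly) \<notin> toric_ker T"
      using one_closed unfolding toric_ker_def by auto
    then show "carrier PR \<noteq> (toric_ker T :: 'k mpoly set)" by blast
    show "a \<in> toric_ker T \<or> b \<in> toric_ker T"
      if "a \<in> carrier PR" "b \<in> carrier PR" "a \<otimes>\<^bsub>PR\<^esub> b \<in> toric_ker T" for a b :: "'k mpoly"
      using that unfolding toric_ker_def by (auto simp: toric_mult)
  qed
qed

abbreviation I :: "'k::field mpoly set" where "I \<equiv> polyomino_ideal P"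

lemma ideal_I: "ideal (I :: 'k::field mpoly set) PR"
proof -
  interpret cring "PR :: 'k mpoly ring" by (rule cring_mpoly_ring)
  show ?thesis unfolding polyomino_ideal_def by (rule genideal_ideal[OF inner_binomials_in_carrier])
qed

text \<open>The two monomials of a generator are the corner pairs of a rectangle avoiding the hole
  and so have equal weight. The set \<open>T\<close> is arbitrary because these kernels will form
  the chain of primes above the ideal.\<close>

lemma I_sub_toric_ker: "(I :: 'k::field mpoly set) \<subseteq> toric_ker T"
proof -
  interpret cring "PR :: 'k mpoly ring" by (rule cring_mpoly_ring)
  show ?thesis unfolding polyomino_ideal_def
  proof (rule genideal_minimal[OF primeideal.axioms(1)[OF primeideal_toric_ker]])
    show "inner_binomials P \<subseteq> (toric_ker T :: 'k mpoly set)"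
    proof
      fix f :: "'k mpoly" assume f: "f \<in> inner_binomials P"
      then obtain a b where ab: "inner_interval P a b"
        and f_eq: "f = var a * var b - var (fst a, snd b) * var (fst b, snd a)"
        unfolding inner_binomials_def by blast
      obtain i j k l where [simp]: "a = (i, j)" "b = (k, l)" by (cases a, cases b)
      have "V.W (i, l) + V.W (k, j) = V.W (i, j) + V.W (k, l)"
        using V.straighten_W[of "(i, l)" "(k, j)"] inner_interval_vertices[of i j k l] ab
        unfolding antidiag_def by simp
      then have "toric T f = 0"
        unfolding f_eq by (simp add: toric_diff toric_mult toric_var mult_single restr_add[symmetric])
      then show "f \<in> toric_ker T"
        using f inner_binomials_in_carrier unfolding toric_ker_def by blast
    qed
  qed
qed

lemma I_closed:
  "f \<in> I \<Longrightarrow> g \<in> I \<Longrightarrow> f + g \<in> (I :: 'k::field mpoly set)"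
  "f \<in> I \<Longrightarrow> g \<in> I \<Longrightarrow> f - g \<in> (I :: 'k::field mpoly set)"
  "f \<in> I \<Longrightarrow> h \<in> carrier PR \<Longrightarrow> h * f \<in> (I :: 'k::field mpoly set)"
  "0 \<in> (I :: 'k::field mpoly set)"
proof -
  note add = additive_subgroup.a_closed[OF ideal.axioms(1)[OF ideal_I]]
  note neg = additive_subgroup.a_inv_closed[OF ideal.axioms(1)[OF ideal_I]]
  show "f \<in> I \<Longrightarrow> g \<in> I \<Longrightarrow> f + g \<in> (I :: 'k mpoly set)" using add[of f g] by simp
  show "f \<in> I \<Longrightarrow> h \<in> carrier PR \<Longrightarrow> h * f \<in> (I :: 'k mpoly set)"
    using ideal.I_l_closed[OF ideal_I, of f h] by simp
  show "0 \<in> (I :: 'k mpoly set)"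
    using additive_subgroup.zero_closed[OF ideal.axioms(1)[OF ideal_I]] by simp
  show "f \<in> I \<Longrightarrow> g \<in> I \<Longrightarrow> f - g \<in> (I :: 'k mpoly set)"
    using add[of f "- g"] neg[of g] mpoly_ring_a_inv[of g] ideal.Icarr[OF ideal_I, of g] by simp
qed

lemma I_sum: "(\<And>x. x \<in> A \<Longrightarrow> f x \<in> (I :: 'k::field mpoly set)) \<Longrightarrow> sum f A \<in> I"
  by (induction A rule: infinite_finite_induct) (auto intro: I_closed)

text \<open>Each rewriting step adds a monomial multiple of a generator; it preserves weight and
  degree and lowers the total \<open>defect\<close>.\<close>

lemma straightening:
  assumes "set_mset M \<subseteq> V.Z"
  shows "\<exists>N. V.normal N \<and> V.WM N = V.WM M \<and> size N = size M \<and>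
    Poly_Mapping.single (mon_of M) 1 - Poly_Mapping.single (mon_of N) 1 \<in> (I :: 'k::field mpoly set)"
  using assms
proof (induction "sum_mset (image_mset defect M)" arbitrary: M rule: less_induct)
  case less
  show ?case
  proof (cases "V.normal M")
    case True
    then show ?thesis using I_closed(4) by (intro exI[of _ M]) simp
  next
    case False
    then obtain u v where uv: "u \<in># M" "v \<in># M" "antidiag u v" "\<not> (u \<in> V.U \<and> v \<in> V.L)"
      using less.prems unfolding V.normal_def by blast
    have "u \<noteq> v" using uv(3) unfolding antidiag_def by auto
    obtain M0 where M0: "M = add_mset u M0" using uv(1) by (meson multi_member_split)
    then have "v \<in># M0" using uv(2) \<open>u \<noteq> v\<close> by simp
    then obtain K where "M0 = add_mset v K" by (meson multi_member_split)
    then have K: "M = {#u, v#} + K" using M0 by simp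
    define w1 w2 where "w1 = (fst u, snd v)" and "w2 = (fst v, snd u)"
    define M1 where "M1 = {#w1, w2#} + K"
    have Z: "u \<in> V.Z" "v \<in> V.Z" using less.prems uv by auto
    have "w1 \<in> V.Z" "w2 \<in> V.Z" unfolding w1_def w2_def using V.straighten_Z[OF Z uv(3,4)] by auto
    then have M1: "set_mset M1 \<subseteq> V.Z" using less.prems unfolding M1_def K by auto
    have "V.W u + V.W v = V.W w1 + V.W w2"
      using V.straighten_W[OF Z uv(3,4)] unfolding w1_def w2_def .
    then have WM: "V.WM M1 = V.WM M" unfolding M1_def K by (simp add: add.assoc[symmetric])
    have "defect w1 + defect w2 < defect u + defect v"
      using defect_straighten[OF uv(3)] mem_VZ[of "fst u" "snd u"] mem_VZ[of "fst v" "snd v"] Z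
      unfolding w1_def w2_def by auto
    then have "sum_mset (image_mset defect M1) < sum_mset (image_mset defect M)"
      unfolding M1_def K by simp
    from less.hyps[OF this M1] obtain N where N: "V.normal N" "V.WM N = V.WM M1" "size N = size M1"
      "Poly_Mapping.single (mon_of M1) 1 - Poly_Mapping.single (mon_of N) 1 \<in> (I :: 'k mpoly set)"
      by blast
    have "var w1 * var w2 - var u * var v \<in> (inner_binomials P :: 'k mpoly set)"
      using V_inner_interval[OF Z uv(3,4)] unfolding inner_binomials_def w1_def w2_def
      by (intro CollectI exI[of _ "(fst u, snd v)"] exI[of _ "(fst v, snd u)"]) simp
    then have "var w1 * var w2 - var u * var v \<in> (I :: 'k mpoly set)"
      unfolding polyomino_ideal_def genideal_def by blast
    moreover have "Poly_Mapping.single (mon_of K) 1 \<in> carrier (PR :: 'k mpoly ring)"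
      using less.prems vertices_eq unfolding K by (intro single_in_mpoly_ring) auto
    ultimately have "Poly_Mapping.single (mon_of K) 1 * (var w1 * var w2 - var u * var v) \<in> (I :: 'k mpoly set)"
      by (rule I_closed(3))
    moreover have "Poly_Mapping.single (mon_of K) 1 * (var w1 * var w2 - var u * var v)
        = Poly_Mapping.single (mon_of M1) 1 - (Poly_Mapping.single (mon_of M) 1 :: 'k mpoly)"
      unfolding M1_def K var_def
      by (simp add: right_diff_distrib mult_single) (simp add: mon_of_def add_ac)
    ultimately have "(Poly_Mapping.single (mon_of M1) 1 - Poly_Mapping.single (mon_of N) 1)
       - (Poly_Mapping.single (mon_of M1) 1 - Poly_Mapping.single (mon_of M) 1) \<in> (I :: 'k mpoly set)"
      using I_closed(2) N(4) by metis
    then have "Poly_Mapping.single (mon_of M) 1 - Poly_Mapping.single (mon_of N) 1 \<in> (I :: 'k mpoly set)" by simp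
    then show ?thesis using N WM unfolding M1_def K by (intro exI[of _ N]) simp
  qed
qed

text \<open>A section of \<open>wt\<close>, arbitrary on weights that no normal monomial has.\<close>

definition sect :: "weight \<Rightarrow> point \<Rightarrow>\<^sub>0 nat" where
  "sect w = mon_of (THE N. V.normal N \<and> V.WM N = w)"

lemma sect_normal:
  assumes "V.normal N" "V.WM N = w"
  shows "sect w = mon_of N"
proof -
  have "(THE N. V.normal N \<and> V.WM N = w) = N"
  proof (rule the_equality)
    fix N' assume "V.normal N' \<and> V.WM N' = w"
    then show "N' = N" using assms V.normal_unique[of N' N] by simp
  qed (use assms in simp)
  then show ?thesis unfolding sect_def by simp
qed

lemma sect_wt:
  assumes "Poly_Mapping.keys e \<subseteq> vertex_set P"
  shows "\<exists>N. V.normal N \<and> size N = size (mset_of e) \<and> sect (wt e) = mon_of N \<and>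
    Poly_Mapping.single e 1 - Poly_Mapping.single (sect (wt e)) 1 \<in> (I :: 'k::field mpoly set)"
proof -
  have "set_mset (mset_of e) \<subseteq> V.Z" using assms vertices_eq by simp
  from straightening[OF this, where 'k = 'k] obtain N where N: "V.normal N" "V.WM N = wt e" "size N = size (mset_of e)"
    "Poly_Mapping.single e 1 - Poly_Mapping.single (mon_of N) 1 \<in> (I :: 'k mpoly set)"
    unfolding wt_def by auto
  then show ?thesis using sect_normal[OF N(1,2)] by auto
qed

text \<open>It factors through the toric map and so vanishes on its kernel, while
  \<open>f - nf f\<close> always lies in the ideal; hence the kernel is contained in the
  ideal.\<close>

definition nf :: "'k::field mpoly \<Rightarrow> 'k mpoly" where "nf f = push (\<lambda>e. sect (wt e)) f"

lemma nf_toric: "nf f = push sect (toric UNIV f)"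
  unfolding nf_def toric_def by (simp add: push_push)

lemma nf_cong:
  assumes "f \<in> carrier PR"
  shows "f - nf f \<in> (I :: 'k::field mpoly set)"
proof -
  have "f - nf f = (\<Sum>e\<in>Poly_Mapping.keys f. const (Poly_Mapping.lookup f e) *
      (Poly_Mapping.single e 1 - Poly_Mapping.single (sect (wt e)) 1))"
    unfolding nf_def push_def
    by (subst (1) sum_keys_single[symmetric, of f])
      (simp add: sum_subtractf[symmetric] right_diff_distrib const_mult_single)
  also have "\<dots> \<in> I"
  proof (rule I_sum)
    fix e assume "e \<in> Poly_Mapping.keys f"
    then have "Poly_Mapping.keys e \<subseteq> vertex_set P" using assms by (simp add: mem_mpoly_ring)
    from sect_wt[OF this, where 'k = 'k]
    show "const (Poly_Mapping.lookup f e) * (Poly_Mapping.single e 1 - Poly_Mapping.single (sect (wt e)) 1) \<in> I"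
      by (intro I_closed(3) const_in_mpoly_ring) blast
  qed
  finally show ?thesis .
qed

lemma I_eq: "(I :: 'k::field mpoly set) = toric_ker UNIV"
proof
  show "toric_ker UNIV \<subseteq> (I :: 'k mpoly set)"
  proof
    fix f :: "'k mpoly" assume "f \<in> toric_ker UNIV"
    then have "f \<in> carrier PR" "nf f = 0" unfolding toric_ker_def nf_toric by auto
    then show "f \<in> I" using nf_cong[of f] by simp
  qed
qed (rule I_sub_toric_ker)

lemma mem_I: "f \<in> carrier PR \<Longrightarrow> f \<in> (I :: 'k::field mpoly set) \<longleftrightarrow> nf f = 0"
proof
  assume f: "f \<in> carrier PR"
  show "nf f = 0" if "f \<in> I" using that unfolding I_eq toric_ker_def nf_toric by simp
  show "f \<in> I" if "nf f = 0" using nf_cong[OF f] that by simp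
qed

definition normal_mons :: "nat \<Rightarrow> (point \<Rightarrow>\<^sub>0 nat) set" where
  "normal_mons k = mon_of ` {N. V.normal N \<and> size N = k}"

lemma finite_VZ: "finite V.Z"
proof (rule finite_subset)
  show "V.Z \<subseteq> {1..m} \<times> {1..n}" using mem_VZ by auto
qed simp

lemma finite_normal: "finite {N. V.normal N \<and> size N = k}"
  by (rule finite_subset[OF _ finite_msets_support[OF finite_VZ, of k]]) (auto simp: V.normal_def)

lemma keys_normal_mons: "e \<in> normal_mons k \<Longrightarrow> Poly_Mapping.keys e \<subseteq> vertex_set P"
  unfolding normal_mons_def V.normal_def vertices_eq by auto

lemma nf_normal: "Poly_Mapping.keys f \<subseteq> (\<Union>k. normal_mons k) \<Longrightarrow> nf f = f"
  unfolding nf_def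
proof (rule push_ident)
  fix e assume "Poly_Mapping.keys f \<subseteq> (\<Union>k. normal_mons k)" "e \<in> Poly_Mapping.keys f"
  then obtain N where N: "V.normal N" "e = mon_of N" unfolding normal_mons_def by blast
  then have "wt e = V.WM N" unfolding wt_def by simp
  then show "sect (wt e) = e" using sect_normal[OF N(1)] N(2) by simp
qed

lemma keys_nf:
  fixes f :: "'k::field mpoly"
  assumes "f \<in> carrier PR" "homogeneous k f"
  shows "Poly_Mapping.keys (nf f) \<subseteq> normal_mons k"
proof -
  have "sect (wt e) \<in> normal_mons k" if e: "e \<in> Poly_Mapping.keys f" for e
  proof -
    have "Poly_Mapping.keys e \<subseteq> vertex_set P" "size (mset_of e) = k"
      using e assms unfolding mem_mpoly_ring homogeneous_def size_mset_of by auto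
    then obtain N where "V.normal N" "size N = k" "sect (wt e) = mon_of N"
      using sect_wt[of e, where 'k = 'k] by blast
    then show ?thesis unfolding normal_mons_def by blast
  qed
  then show ?thesis using keys_push[of "\<lambda>e. sect (wt e)" f] unfolding nf_def by blast
qed

text \<open>On the span of the normal monomials of degree \<open>k\<close> the residue map is
  injective, since \<open>nf\<close> fixes that span, and by \<open>nf_cong\<close> it reaches the
  whole component. The dimension is carried over along this map.\<close>

lemma hilbert_function_eq: "hilbert_function TYPE('k::field) P k = card {N. V.normal N \<and> size N = k}"
proof -
  let ?E = "{p :: 'k mpoly. Poly_Mapping.keys p \<subseteq> normal_mons k}"
  let ?h = "residue_class P :: 'k mpoly \<Rightarrow> _"
  interpret R: cring "PR :: 'k mpoly ring" by (rule cring_mpoly_ring)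
  interpret Q: cring "coord_ring P :: 'k mpoly set ring" by (rule cring_coord_ring)
  have h: "?h = (+>\<^bsub>PR\<^esub>) I" unfolding residue_class_def by (rule ext) simp
  interpret hom: ring_hom_ring PR "coord_ring P" ?h
    unfolding h coord_ring_def by (rule ideal.rcos_ring_hom_ring[OF ideal_I])
  have carr: "?E \<subseteq> carrier PR"
  proof
    fix f assume "f \<in> ?E"
    then show "f \<in> carrier PR" using keys_normal_mons[of _ k] unfolding mem_mpoly_ring by blast
  qed
  have eq_iff: "?h f = ?h g \<longleftrightarrow> f - g \<in> I" if "f \<in> carrier PR" "g \<in> carrier PR" for f g
    using R.quotient_eq_iff_same_a_r_cos[OF ideal_I that] mpoly_ring_minus[OF that] unfolding h by simp
  have inj: "inj_on ?h ?E"
  proof (rule inj_onI)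
    fix f g assume fg: "f \<in> ?E" "g \<in> ?E" "?h f = ?h g"
    then have c: "f \<in> carrier PR" "g \<in> carrier PR" using carr by auto
    then have "nf (f - g) = 0" using eq_iff fg mem_I[OF mpoly_ring_closed(2)] by blast
    moreover have "Poly_Mapping.keys (f - g) \<subseteq> (\<Union>k. normal_mons k)"
      using fg Poly_Mapping.keys_diff[of f g] by blast
    ultimately show "f = g" using nf_normal[of "f - g"] by simp
  qed
  have img: "?h ` ?E = coord_ring_component P k"
  proof -
    have "f \<in> carrier PR \<and> homogeneous k f" if "f \<in> ?E" for f :: "'k mpoly"
    proof -
      have "(\<Sum>v\<in>Poly_Mapping.keys e. Poly_Mapping.lookup e v) = k" if "e \<in> normal_mons k" for e
        using that unfolding normal_mons_def size_mset_of[symmetric] by auto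
      then show ?thesis using that carr unfolding homogeneous_def by auto
    qed
    moreover have "?h f \<in> ?h ` ?E" if f: "f \<in> carrier PR" "homogeneous k f" for f
    proof -
      have "nf f \<in> ?E" using keys_nf[OF f] by simp
      moreover have "?h f = ?h (nf f)" using eq_iff[of f "nf f"] nf_cong[of f] f carr calculation by auto
      ultimately show ?thesis by simp
    qed
    ultimately show ?thesis unfolding coord_ring_component_def by auto
  qed
  have "R.dimension (card (normal_mons k)) (range const) ?E"
    by (rule dimension_monomials) (use finite_normal keys_normal_mons in \<open>auto simp: normal_mons_def\<close>)
  have ne: "\<one>\<^bsub>coord_ring P\<^esub> \<noteq> \<zero>\<^bsub>coord_ring P :: 'k mpoly set ring\<^esub>"
  proof
    assume "\<one>\<^bsub>coord_ring P\<^esub> = \<zero>\<^bsub>coord_ring P :: 'k mpoly set ring\<^esub>"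
    then have "?h 1 = ?h 0" using hom.hom_one hom.hom_zero by simp
    then have "1 - 0 \<in> (I :: 'k mpoly set)" using eq_iff[of 1 0] R.one_closed R.zero_closed by simp
    then show False unfolding I_eq toric_ker_def by simp
  qed
  have "Q.dimension (card (normal_mons k)) (?h ` range const) (?h ` ?E)"
    by (rule hom.inj_hom_dimension[OF subfield_const ne inj]) fact
  moreover have "subfield (?h ` range const) (coord_ring P)"
    by (rule hom.img_is_subfield(2)[OF subfield_const ne])
  ultimately have "Q.dim (?h ` range const) (?h ` ?E) = card (normal_mons k)"
    using Q.dimI unfolding over_def by blast
  moreover have "inj_on mon_of A" for A :: "point multiset set"
    by (rule inj_on_inverseI[of _ mset_of]) simp
  then have "card (normal_mons k) = card {N. V.normal N \<and> size N = k}"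
    unfolding normal_mons_def by (rule card_image)
  ultimately show ?thesis
    unfolding hilbert_function_def coord_ring_scalars_def img by simp
qed

lemma normal_iff_clique: "V.normal N \<longleftrightarrow> set_mset N \<in> cliques adjV V.Z"
proof -
  have "\<not> antidiag x x" for x unfolding antidiag_def by simp
  then show ?thesis unfolding V.normal_def cliques_def adjV_def by fast
qed

text \<open>Normal multisets are sorted by support. The supports are the cliques, and each point of
  a support contributes a factor \<open>X / (1 - X)\<close> for its positive multiplicity.\<close>

lemma hilbert_series_eq: "hilbert_series TYPE('k::field) P = clique_poly adjV (vertex_set P) (fps_X * ones)"
proof (rule fps_ext)
  fix k
  let ?Cl = "cliques adjV V.Z"
  have fin: "finite ?Cl" by (rule finite_cliques[OF finite_VZ])
  have finF: "finite F" if "F \<in> ?Cl" for F using that finite_subset[OF _ finite_VZ] unfolding cliques_def by auto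
  have "{N. V.normal N \<and> size N = k} = (\<Union>F\<in>?Cl. {N. set_mset N = F \<and> size N = k})"
    unfolding normal_iff_clique by auto
  moreover have "card (\<Union>F\<in>?Cl. {N. set_mset N = F \<and> size N = k})
      = (\<Sum>F\<in>?Cl. card {N. set_mset N = F \<and> size N = k})"
    by (rule card_UN_disjoint) (use fin finF finite_msets_support_eq in auto)
  moreover have "fps_nth ((fps_X * ones) ^ card F) k = int (card {N. set_mset N = F \<and> size N = k})" if "F \<in> ?Cl" for F
    using msets_support_fps[OF finF[OF that], where 'a = int, symmetric] by simp
  ultimately show "fps_nth (hilbert_series TYPE('k) P) k = fps_nth (clique_poly adjV (vertex_set P) (fps_X * ones)) k"
    unfolding hilbert_series_def hilbert_function_eq clique_poly_def vertices_eq
    by (simp add: fps_sum_nth)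
qed

text \<open>The rank of the vertex weights: the first four kinds have \<open>ak - 1\<close>,
  \<open>bk - 1\<close>, \<open>m - a0\<close> and \<open>n - b0\<close> coordinates, there are two
  marks, and the six totals depend on the sizes of four regions only, which leaves two linear
  relations.\<close>

definition kdim :: nat where "kdim = nat (m + n + (ak - a0) + (bk - b0) - 2)"

theorem hilbert_series_rook:
  "hilbert_series TYPE('k::field) P = ones ^ kdim * fps_of_poly (switching_rook_poly P)"
  "hilbert_series TYPE('k::field) P * (1 - fps_X) ^ kdim = fps_of_poly (switching_rook_poly P)"
proof -
  interpret frame_balance m n a0 ak b0 bk lo hi H P fps_X "ones :: int fps"
    by standard (rule ones_unit)
  show 1: "hilbert_series TYPE('k) P = ones ^ kdim * fps_of_poly (switching_rook_poly P)"
    using balanced_frame unfolding hilbert_series_eq fps_of_switching_rook_poly kdim_def balanced_def by simp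
  show "hilbert_series TYPE('k) P * (1 - fps_X) ^ kdim = fps_of_poly (switching_rook_poly P)"
    unfolding 1 using ones_unit[where 'a = int] by (metis mult.assoc mult.commute mult.right_neutral power_mult_distrib power_one)
qed

end

section \<open>The Krull dimension\<close>


lemma Span_family:
  fixes g :: "'a \<Rightarrow> 'k::field mpoly"
  assumes "distinct Ms"
  shows "ring.Span (mpoly_ring V) (range const) (map g Ms) = {\<Sum>m\<in>set Ms. const (c m) * g m | c. True}"
  using assms
proof (induction Ms)
  interpret cring "mpoly_ring V :: 'k mpoly ring" by (rule cring_mpoly_ring)
  case Nil
  then show ?case by simp
next
  interpret cring "mpoly_ring V :: 'k mpoly ring" by (rule cring_mpoly_ring)
  case (Cons m Ms)
  have IH: "foldr (line_extension (range const)) (map g Ms) {0} = {\<Sum>m\<in>set Ms. const (c m) * g m | c. True}"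
    using Cons by simp
  have "line_extension (range const) (g m) {\<Sum>m\<in>set Ms. const (c m) * g m | c. True}
      = {\<Sum>m\<in>set (m # Ms). const (c m) * g m | c. True}"
  proof (intro equalityI subsetI)
    fix p assume "p \<in> line_extension (range const) (g m) {\<Sum>m\<in>set Ms. const (c m) * g m | c. True}"
    then obtain d c where p: "p = const d * g m + (\<Sum>m\<in>set Ms. const (c m) * g m)"
      unfolding line_extension_mem_iff by auto
    have "(\<Sum>m\<in>set Ms. const (c m) * g m) = (\<Sum>i\<in>set Ms. const ((c(m := d)) i) * g i)"
      using Cons.prems by (intro sum.cong) auto
    then have "p = (\<Sum>i\<in>set (m # Ms). const ((c(m := d)) i) * g i)"
      using Cons.prems p by simp
    then show "p \<in> {\<Sum>m\<in>set (m # Ms). const (c m) * g m | c. True}" by blast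
  next
    fix p assume "p \<in> {\<Sum>m\<in>set (m # Ms). const (c m) * g m | c. True}"
    then obtain c where "p = const (c m) * g m + (\<Sum>i\<in>set Ms. const (c i) * g i)"
      using Cons.prems by auto
    then show "p \<in> line_extension (range const) (g m) {\<Sum>m\<in>set Ms. const (c m) * g m | c. True}"
      unfolding line_extension_mem_iff by auto
  qed
  then show ?case using IH by simp
qed

text \<open>Stated for an indexed family, so that the index set is bounded without first proving
  that \<open>g\<close> is injective.\<close>

lemma independent_family_card:
  fixes g :: "'a \<Rightarrow> 'k::field mpoly"
  assumes A: "finite A" and g: "\<And>a. a \<in> A \<Longrightarrow> g a \<in> E" and E: "E \<subseteq> carrier (mpoly_ring V)"
    and indep: "\<And>c. (\<Sum>a\<in>A. const (c a) * g a) = 0 \<Longrightarrow> \<forall>a\<in>A. c a = 0"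
    and dim: "ring.dimension (mpoly_ring V) n (range const) E"
  shows "card A \<le> n"
proof -
  interpret cring "mpoly_ring V :: 'k mpoly ring" by (rule cring_mpoly_ring)
  obtain Ms where Ms: "set Ms = A" "distinct Ms" using finite_distinct_list[OF A] by blast
  have "independent (range const) (map g Ms')" if "set Ms' \<subseteq> A" "distinct Ms'" for Ms'
    using that
  proof (induction Ms')
    case (Cons m Ms')
    have "g m \<notin> Span (range const) (map g Ms')"
    proof
      assume "g m \<in> Span (range const) (map g Ms')"
      then obtain c where c: "g m = (\<Sum>i\<in>set Ms'. const (c i) * g i)"
        using Cons.prems unfolding Span_family[of Ms' V g, OF distinct.simps(2)[THEN iffD1, THEN conjunct2, OF Cons.prems(2)]] by blast
      define d where "d i = (if i = m then - 1 else if i \<in> set Ms' then c i else 0)" for i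
      have "(\<Sum>a\<in>A. const (d a) * g a) = (\<Sum>a\<in>set (m # Ms'). const (d a) * g a)"
        using Cons.prems A by (intro sum.mono_neutral_right) (auto simp: d_def const_simps)
      also have "\<dots> = const (- 1) * g m + (\<Sum>a\<in>set Ms'. const (d a) * g a)"
        using Cons.prems by (simp add: d_def)
      also have "(\<Sum>a\<in>set Ms'. const (d a) * g a) = g m"
        unfolding c using Cons.prems by (intro sum.cong) (auto simp: d_def)
      also have "const (- 1) * g m + g m = 0" by (simp add: const_simps)
      finally show False using indep[of d] Cons.prems unfolding d_def by auto
    qed
    moreover have "g m \<in> carrier (mpoly_ring V)" using Cons.prems g E by auto
    moreover have "independent (range const) (map g Ms')" using Cons by auto
    ultimately show ?case unfolding list.map by (intro li_Cons)
  qed simp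
  from independent_length_le_dimension[OF subfield_const dim this, of Ms] Ms g
  show ?thesis using distinct_card[OF Ms(2)] by auto
qed


fun monomial_ev :: "'k::field mpoly list \<Rightarrow> nat list \<Rightarrow> 'k mpoly" where
  "monomial_ev (f # fs) (a # as) = f ^ a * monomial_ev fs as"
| "monomial_ev _ _ = 1"

definition exponents :: "nat \<Rightarrow> nat \<Rightarrow> nat list set" where
  "exponents N n = {as. set as \<subseteq> {..N} \<and> length as = n}"

lemma finite_exponents: "finite (exponents N n)"
  unfolding exponents_def by (rule finite_lists_length_eq) simp

lemma card_exponents: "card (exponents N n) = (N + 1) ^ n"
  unfolding exponents_def by (subst card_lists_length_eq) auto

lemma sum_exponents_Suc:
  "(\<Sum>as\<in>exponents N (Suc n). F as) = (\<Sum>a\<le>N. \<Sum>as\<in>exponents N n. F (a # as))"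
proof -
  let ?h = "\<lambda>p. fst p # snd p"
  have eq: "exponents N (Suc n) = ?h ` ({..N} \<times> exponents N n)"
  proof
    show "exponents N (Suc n) \<subseteq> ?h ` ({..N} \<times> exponents N n)"
    proof
      fix as assume "as \<in> exponents N (Suc n)"
      then obtain b bs where "as = b # bs" "b \<le> N" "bs \<in> exponents N n"
        unfolding exponents_def by (auto simp: length_Suc_conv)
      then show "as \<in> ?h ` ({..N} \<times> exponents N n)" by (intro image_eqI[of _ _ "(b, bs)"]) auto
    qed
  qed (auto simp: exponents_def)
  have inj: "inj_on ?h ({..N} \<times> exponents N n)" by (auto simp: inj_on_def)
  have "(\<Sum>as\<in>exponents N (Suc n). F as) = (\<Sum>p\<in>{..N} \<times> exponents N n. F (fst p # snd p))"
    unfolding eq by (subst sum.reindex[OF inj]) (simp only: o_def)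
  then show ?thesis by (simp add: sum.cartesian_product case_prod_beta)
qed

text \<open>A strictly increasing chain of primes starting at \<open>J\<close>, remembered through
  elements that separate consecutive members: these are what the growth argument multiplies
  together.\<close>

fun prime_chain :: "point set \<Rightarrow> 'k::field mpoly set \<Rightarrow> 'k mpoly list \<Rightarrow> bool" where
  "prime_chain V J [] \<longleftrightarrow> primeideal J (mpoly_ring V)"
| "prime_chain V J (f # fs) \<longleftrightarrow> primeideal J (mpoly_ring V) \<and> f \<in> carrier (mpoly_ring V) \<and> f \<notin> J \<and>
     (\<exists>J'. J \<subseteq> J' \<and> f \<in> J' \<and> prime_chain V J' fs)"

lemma prime_chain_prime: "prime_chain V J fs \<Longrightarrow> primeideal J (mpoly_ring V)"
  by (cases fs) auto

lemma prime_chain_carrier: "prime_chain V J fs \<Longrightarrow> set fs \<subseteq> carrier (mpoly_ring V)"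
  by (induction fs arbitrary: J) auto

lemma mpoly_ring_power: "f \<in> carrier (mpoly_ring V) \<Longrightarrow> f ^ a \<in> carrier (mpoly_ring V)"
proof (induction a)
  case 0
  then show ?case using const_in_mpoly_ring[of 1 V] by (simp add: const_simps)
qed (simp add: mpoly_ring_closed)

lemma mpoly_ring_sum:
  "(\<And>x. x \<in> A \<Longrightarrow> f x \<in> carrier (mpoly_ring V)) \<Longrightarrow> sum f A \<in> carrier (mpoly_ring V)"
  by (induction A rule: infinite_finite_induct) (auto intro: mpoly_ring_closed simp: mem_mpoly_ring[of 0])

lemma monomial_ev_carrier:
  "set fs \<subseteq> carrier (mpoly_ring V) \<Longrightarrow> monomial_ev fs as \<in> carrier (mpoly_ring V)"
proof (induction fs as rule: monomial_ev.induct)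
  case (1 f fs a as)
  then show ?case by (auto intro!: mpoly_ring_closed(3) mpoly_ring_power)
qed (use const_in_mpoly_ring[of 1 V] in \<open>auto simp: const_simps\<close>)

lemma ideal_mpoly_closed:
  assumes "ideal J (mpoly_ring V)"
  shows "f \<in> J \<Longrightarrow> g \<in> J \<Longrightarrow> f - g \<in> J"
    and "f \<in> J \<Longrightarrow> h \<in> carrier (mpoly_ring V) \<Longrightarrow> f * h \<in> J"
    and "0 \<in> J"
proof -
  note sub = ideal.axioms(1)[OF assms]
  show "f \<in> J \<Longrightarrow> h \<in> carrier (mpoly_ring V) \<Longrightarrow> f * h \<in> J"
    using ideal.I_r_closed[OF assms, of f h] by simp
  show "0 \<in> J" using additive_subgroup.zero_closed[OF sub] by simp
  show "f \<in> J \<Longrightarrow> g \<in> J \<Longrightarrow> f - g \<in> J"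
    using additive_subgroup.a_closed[OF sub, of f "- g"] additive_subgroup.a_inv_closed[OF sub, of g]
      mpoly_ring_a_inv[of g V] ideal.Icarr[OF assms, of g] by simp
qed

text \<open>Modulo \<open>J'\<close> only the term with \<open>a = 0\<close> survives; once it vanishes, \<open>f\<close> cancels modulo \<open>J\<close>.\<close>

lemma power_sum_in_prime:
  fixes f :: "'k::field mpoly"
  assumes J: "primeideal J (mpoly_ring V)" and J': "ideal J' (mpoly_ring V)" and sub: "J \<subseteq> J'"
    and f: "f \<in> carrier (mpoly_ring V)" "f \<notin> J" "f \<in> J'"
    and g: "\<And>a. g a \<in> carrier (mpoly_ring V)" "\<And>a. a \<le> N \<Longrightarrow> g a \<in> J' \<Longrightarrow> g a = 0"
    and sum: "(\<Sum>a\<le>N. f ^ a * g a) \<in> J"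
  shows "\<forall>a\<le>N. g a = 0"
  using g sum
proof (induction N arbitrary: g)
  case 0
  then show ?case using sub by auto
next
  case (Suc N)
  let ?r = "\<Sum>a\<le>N. f ^ a * g (Suc a)"
  have r: "?r \<in> carrier (mpoly_ring V)"
    using Suc.prems(1) f by (intro mpoly_ring_sum mpoly_ring_closed(3) mpoly_ring_power) auto
  have eq: "(\<Sum>a\<le>Suc N. f ^ a * g a) = g 0 + f * ?r"
    by (subst sum.atMost_Suc_shift) (simp add: sum_distrib_left mult.assoc)
  have "(g 0 + f * ?r) - f * ?r \<in> J'"
    using Suc.prems(3) sub ideal_mpoly_closed(1)[OF J'] ideal_mpoly_closed(2)[OF J' f(3) r] unfolding eq by blast
  then have g0: "g 0 = 0" using Suc.prems(2)[of 0] by simp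
  then have "f * ?r \<in> J" using Suc.prems(3) unfolding eq by simp
  then have "?r \<in> J" using primeideal.I_prime[OF J f(1) r] f(2) by auto
  then have "\<forall>a\<le>N. g (Suc a) = 0"
    by (intro Suc.IH[of "\<lambda>a. g (Suc a)"]) (use Suc.prems(1,2) in simp_all)
  then have "g a = 0" if "a \<le> Suc N" for a
    using g0 that by (cases a) auto
  then show ?case by blast
qed

text \<open>A relation is expanded in powers of the first separating element. Its coefficients are
  combinations of the same kind for the rest of the chain, so one that falls into the next prime
  vanishes by induction; this is the hypothesis under which the power sum can be taken
  apart.\<close>

lemma prime_chain_independent:
  assumes "prime_chain V J fs" "(\<Sum>as\<in>exponents N (length fs). const (c as) * monomial_ev fs as) \<in> J"
  shows "\<forall>as\<in>exponents N (length fs). c as = 0"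
  using assms
proof (induction fs arbitrary: J c)
  case Nil
  interpret primeideal J "mpoly_ring V" using Nil by simp
  have exps: "exponents N 0 = {[]}" unfolding exponents_def by auto
  show ?case
  proof (rule ccontr)
    assume "\<not> ?thesis"
    then have c: "c [] \<noteq> 0" using exps by simp
    have "const (c []) \<in> J" using Nil exps by simp
    then have "const (c []) * const (inverse (c [])) \<in> J"
      using ideal_mpoly_closed(2)[OF is_ideal _ const_in_mpoly_ring] by blast
    then have "1 \<in> J" using c by (simp add: const_simps(2,3)[symmetric])
    then show False using one_imp_carrier I_notcarr by simp
  qed
next
  case (Cons f fs)
  then obtain J' where J: "primeideal J (mpoly_ring V)" "f \<in> carrier (mpoly_ring V)" "f \<notin> J"
    "J \<subseteq> J'" "f \<in> J'" "prime_chain V J' fs" by auto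
  define g where "g a = (\<Sum>as\<in>exponents N (length fs). const (c (a # as)) * monomial_ev fs as)" for a
  have zero: "\<forall>as\<in>exponents N (length fs). c (a # as) = 0" if "g a \<in> J'" for a
    using Cons.IH[OF J(6), of "\<lambda>as. c (a # as)"] that unfolding g_def by simp
  have "\<forall>a\<le>N. g a = 0"
  proof (rule power_sum_in_prime[OF J(1) _ J(4) J(2,3,5)])
    show "ideal J' (mpoly_ring V)" using prime_chain_prime[OF J(6)] by (rule primeideal.axioms(1))
    show "g a \<in> carrier (mpoly_ring V)" for a
      unfolding g_def using prime_chain_carrier[OF J(6)]
      by (intro mpoly_ring_sum mpoly_ring_closed(3) const_in_mpoly_ring monomial_ev_carrier)
    show "g a = 0" if "g a \<in> J'" for a
      using zero[OF that] unfolding g_def by (simp add: const_simps)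
    have "(\<Sum>as\<in>exponents N (length (f # fs)). const (c as) * monomial_ev (f # fs) as) = (\<Sum>a\<le>N. f ^ a * g a)"
      unfolding g_def by (simp add: sum_exponents_Suc sum_distrib_left ac_simps)
    then show "(\<Sum>a\<le>N. f ^ a * g a) \<in> J" using Cons.prems(2) by simp
  qed
  moreover have "0 \<in> J'"
    using ideal_mpoly_closed(3)[OF primeideal.axioms(1)[OF prime_chain_prime[OF J(6)]]] .
  ultimately have "\<forall>a\<le>N. \<forall>as\<in>exponents N (length fs). c (a # as) = 0" using zero by simp
  then show ?case unfolding exponents_def by (auto simp: length_Suc_conv)
qed

definition deg_le :: "nat \<Rightarrow> 'k::field mpoly \<Rightarrow> bool" where
  "deg_le d f \<longleftrightarrow> (\<forall>e\<in>Poly_Mapping.keys f. size (mset_of e) \<le> d)"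

lemma deg_le_mult: "deg_le a f \<Longrightarrow> deg_le b g \<Longrightarrow> deg_le (a + b) (f * g)"
  unfolding deg_le_def
proof
  fix e assume *: "\<forall>e\<in>Poly_Mapping.keys f. size (mset_of e) \<le> a" "\<forall>e\<in>Poly_Mapping.keys g. size (mset_of e) \<le> b"
    and "e \<in> Poly_Mapping.keys (f * g)"
  then obtain s t where "s \<in> Poly_Mapping.keys f" "t \<in> Poly_Mapping.keys g" "e = s + t"
    using keys_mult[of f g] by blast
  then show "size (mset_of e) \<le> a + b" using * by (simp add: mset_of_add add_mono)
qed

lemma deg_le_1: "deg_le d 1" unfolding deg_le_def by simp

lemma deg_le_power: "deg_le d f \<Longrightarrow> deg_le (a * d) (f ^ a)"
  by (induction a) (auto simp: deg_le_1 dest: deg_le_mult)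

lemma deg_le_mono: "deg_le a f \<Longrightarrow> a \<le> b \<Longrightarrow> deg_le b f" unfolding deg_le_def by auto

lemma deg_le_monomial_ev:
  "\<forall>f\<in>set fs. deg_le D f \<Longrightarrow> set as \<subseteq> {..N} \<Longrightarrow> deg_le (length fs * (N * D)) (monomial_ev fs as)"
proof (induction fs as rule: monomial_ev.induct)
  case (1 f fs a as)
  have "deg_le (N * D) (f ^ a)"
    by (rule deg_le_mono[OF deg_le_power[of D f a]]) (use 1 in auto)
  from deg_le_mult[OF this 1(1)] 1(2,3) show ?case by (simp add: add.commute)
qed (auto simp: deg_le_1)

lemma deg_le_exists: "\<exists>D. \<forall>f\<in>set fs. deg_le D f"
proof (induction fs)
  case (Cons f fs)
  then obtain D where D: "\<forall>f\<in>set fs. deg_le D f" by blast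
  have "deg_le (\<Sum>e\<in>Poly_Mapping.keys f. size (mset_of e)) f"
    unfolding deg_le_def by (auto intro: member_le_sum)
  then have "\<forall>g\<in>set (f # fs). deg_le (D + (\<Sum>e\<in>Poly_Mapping.keys f. size (mset_of e))) g"
    using D deg_le_mono by (auto intro: deg_le_mono)
  then show ?case by blast
qed simp

text \<open>Multiplication by \<open>ones\<close> forms partial sums, so each further factor costs
  at most \<open>k + 1\<close>.\<close>

lemma ones_power_bound: "0 \<le> fps_nth (ones ^ Suc d :: int fps) k \<and> fps_nth (ones ^ Suc d :: int fps) k \<le> int ((k + 1) ^ d)"
proof (induction d arbitrary: k)
  case (Suc d)
  have eq: "fps_nth (ones ^ Suc (Suc d) :: int fps) k = (\<Sum>i\<le>k. fps_nth (ones ^ Suc d) i)"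
    by (subst power_Suc2) (simp add: fps_mult_nth ones_def atMost_atLeast0 del: power_Suc)
  have "(\<Sum>i\<le>k. fps_nth (ones ^ Suc d :: int fps) i) \<le> (\<Sum>i\<le>k. int ((k + 1) ^ d))"
  proof (rule sum_mono)
    fix i assume "i \<in> {..k}"
    then have "(i + 1) ^ d \<le> (k + 1) ^ d" by (intro power_mono) auto
    then show "fps_nth (ones ^ Suc d :: int fps) i \<le> int ((k + 1) ^ d)" using Suc[of i] by linarith
  qed
  moreover have "(\<Sum>i\<le>k. int ((k + 1) ^ d)) = int ((k + 1) ^ Suc d)" by (simp add: algebra_simps)
  moreover have "0 \<le> (\<Sum>i\<le>k. fps_nth (ones ^ Suc d :: int fps) i)"
    using Suc by (intro sum_nonneg) blast
  ultimately show ?case unfolding eq by (simp only: simp_thms)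
qed (simp add: ones_def)

lemma exponent_le_of_growth:
  fixes C D n d :: nat
  assumes "\<And>N. (N + 1) ^ n \<le> C * (n * (N * D) + 1) ^ d"
  shows "n \<le> d"
proof (rule ccontr)
  assume "\<not> n \<le> d"
  \<comment> \<open>The growth bound is tested at \<open>N = B\<close>, where it would give
    \<open>(B + 1) ^ n \<le> B * (B + 1) ^ d\<close>.\<close>
  define B where "B = C * (n * D + 1) ^ d"
  have "(B + 1) ^ n \<le> C * (n * (B * D) + 1) ^ d" by (rule assms)
  also have "\<dots> \<le> C * ((n * D + 1) * (B + 1)) ^ d"
    by (intro mult_le_mono2 power_mono) (auto simp: algebra_simps)
  also have "\<dots> = (C * (n * D + 1) ^ d) * (B + 1) ^ d" by (simp only: power_mult_distrib mult.assoc)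
  also have "\<dots> = B * (B + 1) ^ d" by (simp only: B_def)
  also have "\<dots> < (B + 1) * (B + 1) ^ d" by simp
  also have "\<dots> = (B + 1) ^ Suc d" by simp
  also have "\<dots> \<le> (B + 1) ^ n" using \<open>\<not> n \<le> d\<close> by (intro power_increasing) auto
  finally show False by simp
qed

lemma push_const_mult: "push h (const x * f) = const x * push h f"
proof -
  have "push h (const x * f) = push h (const x * (\<Sum>e\<in>Poly_Mapping.keys f. Poly_Mapping.single e (Poly_Mapping.lookup f e)))"
    by (simp only: sum_keys_single)
  also have "\<dots> = const x * push h f"
    unfolding push_def[of h f]
    by (simp only: sum_distrib_left push_sum const_mult_single push_single)
  finally show ?thesis .
qed

context frame_data
begin

lemma keys_nf_deg_le:
  fixes f :: "'k::field mpoly"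
  assumes "f \<in> carrier PR" "deg_le k f"
  shows "Poly_Mapping.keys (nf f) \<subseteq> (\<Union>j\<le>k. normal_mons j)"
proof -
  have "sect (wt e) \<in> (\<Union>j\<le>k. normal_mons j)" if e: "e \<in> Poly_Mapping.keys f" for e
  proof -
    have "Poly_Mapping.keys e \<subseteq> vertex_set P" "size (mset_of e) \<le> k"
      using e assms unfolding mem_mpoly_ring deg_le_def by auto
    moreover from this obtain N where "V.normal N" "size N = size (mset_of e)" "sect (wt e) = mon_of N"
      using sect_wt[of e, where 'k = 'k] by blast
    ultimately show ?thesis unfolding normal_mons_def by blast
  qed
  then show ?thesis using keys_push[of "\<lambda>e. sect (wt e)" f] unfolding nf_def by blast
qed

lemma nf_linear: "nf (\<Sum>a\<in>A. const (c a) * g a) = (\<Sum>a\<in>A. const (c a) * nf (g a))"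
  unfolding nf_def push_sum push_const_mult ..

lemma card_normal_mons: "card (\<Union>j\<le>k. normal_mons j) = (\<Sum>j\<le>k. hilbert_function TYPE('k::field) P j)"
proof -
  have inj: "inj_on mon_of A" for A :: "point multiset set"
    by (rule inj_on_inverseI[of _ mset_of]) simp
  have disj: "normal_mons i \<inter> normal_mons j = {}" if "i \<noteq> j" for i j
  proof (rule ccontr)
    assume "normal_mons i \<inter> normal_mons j \<noteq> {}"
    then obtain e where e: "e \<in> normal_mons i" "e \<in> normal_mons j" by blast
    have "size (mset_of e) = l" if "e \<in> normal_mons l" for l
      using that unfolding normal_mons_def by auto
    then show False using e that by blast
  qed
  have "card (\<Union>j\<le>k. normal_mons j) = (\<Sum>j\<le>k. card (normal_mons j))"
    by (rule card_UN_disjoint) (use disj finite_normal in \<open>auto simp: normal_mons_def\<close>)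
  also have "\<dots> = (\<Sum>j\<le>k. hilbert_function TYPE('k) P j)"
    unfolding hilbert_function_eq normal_mons_def by (simp add: card_image[OF inj])
  finally show ?thesis .
qed

text \<open>Summing the Hilbert function multiplies the series by \<open>ones\<close>, so the
  coefficients of \<open>h / (1 - X) ^ (kdim + 1)\<close> are to be bounded; the constant is the sum
  of the absolute values of the coefficients of \<open>h\<close>.\<close>

lemma hilbert_growth: "\<exists>C. \<forall>k. card (\<Union>j\<le>k. normal_mons j) \<le> C * (k + 1) ^ kdim"
proof -
  let ?h = "switching_rook_poly P" and ?d = kdim
  define C where "C = nat (\<Sum>i\<le>degree ?h. \<bar>coeff ?h i\<bar>)"
  have "card (\<Union>j\<le>k. normal_mons j) \<le> C * (k + 1) ^ ?d" for k
  proof -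
    \<comment> \<open>The claim mentions no field, and the Hilbert function is the same over all
      fields; the rationals serve as a sample.\<close>
    let ?HS = "hilbert_series TYPE(rat) P"
    have "int (card (\<Union>j\<le>k. normal_mons j)) = (\<Sum>j\<le>k. fps_nth ?HS j)"
      unfolding card_normal_mons[where 'k = rat] hilbert_series_def by simp
    also have "\<dots> = fps_nth (?HS * ones) k"
      by (simp add: fps_mult_nth ones_def atMost_atLeast0)
    also have "?HS * ones = fps_of_poly ?h * ones ^ Suc ?d"
      unfolding hilbert_series_rook(1) by (simp add: ac_simps)
    also have "fps_nth \<dots> k = (\<Sum>i\<le>k. coeff ?h i * fps_nth (ones ^ Suc ?d) (k - i))"
      by (simp add: fps_mult_nth atMost_atLeast0 del: power_Suc)
    also have "\<dots> \<le> (\<Sum>i\<le>k. \<bar>coeff ?h i\<bar> * int ((k + 1) ^ ?d))"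
    proof (rule sum_mono)
      fix i assume "i \<in> {..k}"
      have "(k - i + 1) ^ ?d \<le> (k + 1) ^ ?d" by (intro power_mono) auto
      then have "int ((k - i + 1) ^ ?d) \<le> int ((k + 1) ^ ?d)" by (simp only: of_nat_le_iff)
      then have "0 \<le> fps_nth (ones ^ Suc ?d :: int fps) (k - i)" "fps_nth (ones ^ Suc ?d) (k - i) \<le> int ((k + 1) ^ ?d)"
        using ones_power_bound[of ?d "k - i"] order_trans by blast+
      then show "coeff ?h i * fps_nth (ones ^ Suc ?d) (k - i) \<le> \<bar>coeff ?h i\<bar> * int ((k + 1) ^ ?d)"
        by (intro mult_mono) auto
    qed
    also have "\<dots> = (\<Sum>i\<le>k. \<bar>coeff ?h i\<bar>) * int ((k + 1) ^ ?d)" by (simp add: sum_distrib_right)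
    also have "\<dots> \<le> int C * int ((k + 1) ^ ?d)"
    proof (rule mult_right_mono)
      have "(\<Sum>i\<le>k. \<bar>coeff ?h i\<bar>) \<le> (\<Sum>i\<in>{..k} \<union> {..degree ?h}. \<bar>coeff ?h i\<bar>)"
        by (rule sum_mono2) auto
      also have "\<dots> = (\<Sum>i\<le>degree ?h. \<bar>coeff ?h i\<bar>)"
        by (rule sum.mono_neutral_right) (auto simp: coeff_eq_0)
      finally show "(\<Sum>i\<le>k. \<bar>coeff ?h i\<bar>) \<le> int C" unfolding C_def by simp
    qed simp
    finally show ?thesis by (simp only: of_nat_mult[symmetric] of_nat_le_iff)
  qed
  then show ?thesis by blast
qed

text \<open>With \<open>l\<close> separating elements of degree at most \<open>D\<close>, the
  \<open>(N + 1) ^ l\<close> monomials with exponents up to \<open>N\<close> have independent normal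
  forms of degree at most \<open>l * N * D\<close>. The polynomial growth of order
  \<open>kdim\<close> then bounds \<open>l\<close>.\<close>

lemma prime_chain_length:
  fixes J :: "'k::field mpoly set"
  assumes J: "prime_chain (vertex_set P) J fs" "I \<subseteq> J"
  shows "length fs \<le> kdim"
proof -
  obtain D where D: "\<forall>f\<in>set fs. deg_le D f" using deg_le_exists by blast
  obtain C where C: "\<And>k. card (\<Union>j\<le>k. normal_mons j) \<le> C * (k + 1) ^ kdim" using hilbert_growth by blast
  have fs: "set fs \<subseteq> carrier PR" using prime_chain_carrier[OF J(1)] .
  have "(N + 1) ^ length fs \<le> C * (length fs * (N * D) + 1) ^ kdim" for N
  proof -
    let ?k = "length fs * (N * D)" and ?A = "exponents N (length fs)"
    let ?S = "\<Union>j\<le>?k. normal_mons j"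
    let ?E = "{p :: 'k mpoly. Poly_Mapping.keys p \<subseteq> ?S}"
    have keysS: "Poly_Mapping.keys e \<subseteq> vertex_set P" if "e \<in> ?S" for e using that keys_normal_mons by blast
    have finS: "finite ?S" using finite_normal unfolding normal_mons_def by auto
    have "card ?A \<le> card ?S"
    proof (rule independent_family_card)
      show "finite ?A" by (rule finite_exponents)
      show "nf (monomial_ev fs as) \<in> ?E" if "as \<in> ?A" for as
        using keys_nf_deg_le[OF monomial_ev_carrier[OF fs] deg_le_monomial_ev[OF D]] that
        unfolding exponents_def by auto
      show "?E \<subseteq> carrier PR"
      proof
        fix f assume "f \<in> ?E"
        then show "f \<in> carrier PR" using keysS unfolding mem_mpoly_ring by blast
      qed
      show "ring.dimension PR (card ?S) (range const) ?E"
        by (rule dimension_monomials[OF finS keysS])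
      show "\<forall>as\<in>?A. c as = 0" if "(\<Sum>as\<in>?A. const (c as) * nf (monomial_ev fs as)) = 0" for c
      proof (rule prime_chain_independent[OF J(1)])
        let ?f = "\<Sum>as\<in>?A. const (c as) * monomial_ev fs as"
        have "?f \<in> carrier PR"
          by (intro mpoly_ring_sum mpoly_ring_closed(3) const_in_mpoly_ring monomial_ev_carrier fs)
        moreover have "nf ?f = 0" using that by (simp add: nf_linear)
        ultimately show "?f \<in> J" using mem_I J(2) by blast
      qed
    qed
    then show ?thesis using C[of ?k] unfolding card_exponents by linarith
  qed
  then show ?thesis by (rule exponent_le_of_growth)
qed

end

section \<open>Lower bound: a chain of toric primes\<close>

context frame_data
begin

lemma toric_restrict: "T' \<subseteq> T \<Longrightarrow> toric T' f = push (restr T') (toric T f)"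
  unfolding toric_def push_push by (simp add: Int_absorb2)

lemma toric_ker_psubset:
  assumes v: "v \<in> V.Z" and meets: "T \<inter> Poly_Mapping.keys (V.W v) \<noteq> {}"
  shows "(toric_ker T :: 'k::field mpoly set) \<subset> toric_ker (T - Poly_Mapping.keys (V.W v))"
proof
  let ?T' = "T - Poly_Mapping.keys (V.W v)"
  show "(toric_ker T :: 'k mpoly set) \<subseteq> toric_ker ?T'"
  proof
    fix f :: "'k mpoly" assume "f \<in> toric_ker T"
    moreover have "toric ?T' f = push (restr ?T') (toric T f)" by (rule toric_restrict) blast
    ultimately show "f \<in> toric_ker ?T'" unfolding toric_ker_def by simp
  qed
  \<comment> \<open>A variable is sent to 1 as soon as all coordinates of its weight are forgotten,
    and not before; hence \<open>var v - 1\<close> separates the two kernels.\<close>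
  let ?f = "var v - 1 :: 'k mpoly"
  have "(1 :: 'k mpoly) \<in> carrier PR" by (simp add: mem_mpoly_ring)
  then have "?f \<in> carrier PR" using var_in_mpoly_ring[of v] v vertices_eq by (intro mpoly_ring_closed(2)) auto
  moreover have "restr ?T' (V.W v) = 0" by (rule poly_mapping_eqI) (simp add: in_keys_iff)
  then have "toric ?T' ?f = 0" by (simp add: toric_diff toric_var)
  moreover obtain s where s: "s \<in> T" "s \<in> Poly_Mapping.keys (V.W v)" using meets by blast
  then have "Poly_Mapping.lookup (restr T (V.W v)) s \<noteq> 0" by (simp add: in_keys_iff)
  then have "restr T (V.W v) \<noteq> 0" by (metis lookup_zero)
  then have "Poly_Mapping.lookup (toric T ?f) 0 \<noteq> 0"
    by (simp add: toric_diff toric_var lookup_minus lookup_single)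
  then have "toric T ?f \<noteq> 0" by (metis lookup_zero)
  ultimately show "toric_ker T \<noteq> (toric_ker ?T' :: 'k mpoly set)" unfolding toric_ker_def by blast
qed

text \<open>The combinatorial skeleton of a chain of primes: each removal of the support of a vertex
  weight that still meets \<open>T\<close> makes the toric kernel strictly larger.\<close>

inductive drops :: "(nat \<times> int) set \<Rightarrow> nat \<Rightarrow> bool" where
  drops_0: "drops T 0"
| drops_Suc: "v \<in> V.Z \<Longrightarrow> T \<inter> Poly_Mapping.keys (V.W v) \<noteq> {} \<Longrightarrow>
    drops (T - Poly_Mapping.keys (V.W v)) l \<Longrightarrow> drops T (Suc l)"

text \<open>Additional coordinates do no harm, so after each step more coordinates may be discarded
  than the vertex itself involves. The sets \<open>used\<close> rely on this freedom.\<close>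

lemma drops_mono: "drops T l \<Longrightarrow> T \<subseteq> T' \<Longrightarrow> drops T' l"
proof (induction arbitrary: T' rule: drops.induct)
  case (drops_Suc v T l)
  show ?case
  proof (rule drops.drops_Suc[OF drops_Suc.hyps(1)])
    show "drops (T' - Poly_Mapping.keys (V.W v)) l"
      by (rule drops_Suc.IH) (use drops_Suc.prems in blast)
  qed (use drops_Suc in blast)
qed (rule drops_0)

lemma drops_chain:
  assumes "drops T l"
  shows "\<exists>C. C 0 = (toric_ker T :: 'k::field mpoly set) \<and> (\<forall>i\<le>l. \<exists>T. C i = toric_ker T) \<and> (\<forall>i<l. C i \<subset> C (Suc i))"
  using assms
proof (induction rule: drops.induct)
  case (drops_0 T)
  show ?case by (intro exI[of _ "\<lambda>_. toric_ker T"]) auto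
next
  case (drops_Suc v T l)
  then obtain C where C: "C 0 = (toric_ker (T - Poly_Mapping.keys (V.W v)) :: 'k mpoly set)"
    "\<forall>i\<le>l. \<exists>T. C i = toric_ker T" "\<forall>i<l. C i \<subset> C (Suc i)" by blast
  define C' where "C' i = (case i of 0 \<Rightarrow> toric_ker T | Suc j \<Rightarrow> C j)" for i
  have "\<exists>T. C' i = toric_ker T" if "i \<le> Suc l" for i
    using C(2) that unfolding C'_def by (cases i) auto
  moreover have "C' i \<subset> C' (Suc i)" if "i < Suc l" for i
  proof (cases i)
    case 0
    then show ?thesis using toric_ker_psubset[OF drops_Suc.hyps(1,2), where 'k = 'k] C(1) unfolding C'_def by simp
  next
    case (Suc j)
    then show ?thesis using C(3) that unfolding C'_def by simp
  qed
  moreover have "C' 0 = toric_ker T" unfolding C'_def by simp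
  ultimately show ?case by blast
qed

lemma keys_W:
  "v \<in> V.A \<Longrightarrow> Poly_Mapping.keys (V.W v) = {(0, fst v), (1, snd v), (4, 0)}"
  "v \<in> V.U \<Longrightarrow> Poly_Mapping.keys (V.W v) = {(0, fst v), (3, snd v)}"
  "v \<in> V.L \<Longrightarrow> Poly_Mapping.keys (V.W v) = {(1, snd v), (2, fst v)}"
  "v \<in> V.B \<Longrightarrow> Poly_Mapping.keys (V.W v) = {(2, fst v), (3, snd v), (5, 0)}"
  by (auto simp: V.W_region in_keys_iff lookup_add lookup_single when_def split: if_splits)

text \<open>Walking along vertices of the outer boundary, each vertex involves exactly one weight
  coordinate outside the sets \<open>used p q r s\<close> of coordinates met before.\<close>

definition used :: "int \<Rightarrow> int \<Rightarrow> int \<Rightarrow> int \<Rightarrow> (nat \<times> int) set" where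
  "used p q r s = {(k, c). k = 0 \<and> c \<le> p \<or> k = 1 \<and> c \<le> q \<or> k = 2 \<and> c \<le> r \<or> k = 3 \<and> c \<le> s \<or> k = 4}"

lemma drops_used:
  assumes "drops (- used p' q' r' s') l" "v \<in> V.Z"
    and "Poly_Mapping.keys (V.W v) \<subseteq> used p' q' r' s'" "used p q r s \<subseteq> used p' q' r' s'"
    and "\<not> Poly_Mapping.keys (V.W v) \<subseteq> used p q r s"
  shows "drops (- used p q r s) (Suc l)"
proof (rule drops_Suc[OF assms(2)])
  show "drops (- used p q r s - Poly_Mapping.keys (V.W v)) l"
    by (rule drops_mono[OF assms(1)]) (use assms(3,4) in blast)
qed (use assms(5) in blast)

text \<open>The walk follows \<open>(i, 1)\<close> and then \<open>(1, i)\<close> in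
  \<open>A\<close>, the left side and the top in \<open>U\<close>, the bottom and the right side in
  \<open>L\<close>, and ends at \<open>(m, n)\<close>, which is new only through the mark of
  \<open>B\<close>. Facts 1 to 7 follow this order and are proved backwards. The steps number
  \<open>a0\<close>, \<open>b0 - 1\<close>, \<open>n - b0\<close>, \<open>ak - 1 - a0\<close>,
  \<open>m - a0\<close>, \<open>bk - 1 - b0\<close> and 1, with sum \<open>kdim\<close>.\<close>

lemma drops_kdim: "drops UNIV kdim"
proof -
  have 7: "drops (- used (ak - 1) (bk - 1) m n) 1"
  proof -
    have B: "(m, n) \<in> V.B" using bounds unfolding V.B_def by auto
    then show ?thesis unfolding One_nat_def
      by (intro drops_Suc[of "(m, n)"] drops_0) (auto simp: V.Z_def keys_W used_def)
  qed
  have 6: "drops (- used (ak - 1) q m n) (nat (bk - 1 - q) + 1)" if "q \<le> bk - 1" "b0 \<le> q" for q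
    using that
  proof (induction q rule: int_le_induct)
    case (step i)
    have L: "(m, i) \<in> V.L" using step bounds unfolding V.L_def dnV_def by auto
    have "nat (bk - 1 - (i - 1)) + 1 = Suc (nat (bk - 1 - i) + 1)" using step by auto
    moreover have "drops (- used (ak - 1) (i - 1) m n) (Suc (nat (bk - 1 - i) + 1))"
      by (rule drops_used[OF step.IH, of "(m, i)"]) (use L step bounds in \<open>auto simp: V.Z_def keys_W used_def\<close>)
    ultimately show ?case by (simp only:)
  qed (use 7 in simp)
  have 5: "drops (- used (ak - 1) b0 r n) (nat (m - r) + nat (bk - 1 - b0) + 1)" if "r \<le> m" "a0 \<le> r" for r
    using that
  proof (induction r rule: int_le_induct)
    case (step i)
    have L: "(i, 1) \<in> V.L" using step bounds lo_ge[of i] unfolding V.L_def dnV_def by auto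
    have "nat (m - (i - 1)) + nat (bk - 1 - b0) + 1 = Suc (nat (m - i) + nat (bk - 1 - b0) + 1)" using step by auto
    moreover have "drops (- used (ak - 1) b0 (i - 1) n) (Suc (nat (m - i) + nat (bk - 1 - b0) + 1))"
      by (rule drops_used[OF step.IH, of "(i, 1)"]) (use L step bounds in \<open>auto simp: V.Z_def keys_W used_def\<close>)
    ultimately show ?case by (simp only:)
  qed (use 6[of b0] bounds in simp)
  define l5 where "l5 = nat (m - a0) + nat (bk - 1 - b0) + 1"
  have 4: "drops (- used p b0 a0 n) (nat (ak - 1 - p) + l5)" if "p \<le> ak - 1" "a0 \<le> p" for p
    using that
  proof (induction p rule: int_le_induct)
    case (step i)
    have U: "(i, n) \<in> V.U" using step bounds hi_le[of "i - 1"] unfolding V.U_def upV_def by auto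
    have "nat (ak - 1 - (i - 1)) + l5 = Suc (nat (ak - 1 - i) + l5)" using step by auto
    moreover have "drops (- used (i - 1) b0 a0 n) (Suc (nat (ak - 1 - i) + l5))"
      by (rule drops_used[OF step.IH, of "(i, n)"]) (use U step bounds in \<open>auto simp: V.Z_def keys_W used_def\<close>)
    ultimately show ?case by (simp only:)
  qed (use 5[of a0] bounds in \<open>simp add: l5_def\<close>)
  define l4 where "l4 = nat (ak - 1 - a0) + l5"
  have 3: "drops (- used a0 b0 a0 s) (nat (n - s) + l4)" if "s \<le> n" "b0 \<le> s" for s
    using that
  proof (induction s rule: int_le_induct)
    case (step i)
    have U: "(1, i) \<in> V.U" using step bounds unfolding V.U_def upV_def by auto
    have "nat (n - (i - 1)) + l4 = Suc (nat (n - i) + l4)" using step by auto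
    moreover have "drops (- used a0 b0 a0 (i - 1)) (Suc (nat (n - i) + l4))"
      by (rule drops_used[OF step.IH, of "(1, i)"]) (use U step bounds in \<open>auto simp: V.Z_def keys_W used_def\<close>)
    ultimately show ?case by (simp only:)
  qed (use 4[of a0] bounds in \<open>simp add: l4_def\<close>)
  define l3 where "l3 = nat (n - b0) + l4"
  have 2: "drops (- used a0 q a0 b0) (nat (b0 - q) + l3)" if "q \<le> b0" "1 \<le> q" for q
    using that
  proof (induction q rule: int_le_induct)
    case (step i)
    have A: "(1, i) \<in> V.A" using step bounds unfolding V.A_def by auto
    have "nat (b0 - (i - 1)) + l3 = Suc (nat (b0 - i) + l3)" using step by auto
    moreover have "drops (- used a0 (i - 1) a0 b0) (Suc (nat (b0 - i) + l3))"
      by (rule drops_used[OF step.IH, of "(1, i)"]) (use A step bounds in \<open>auto simp: V.Z_def keys_W used_def\<close>)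
    ultimately show ?case by (simp only:)
  qed (use 3[of b0] bounds in \<open>simp add: l3_def\<close>)
  define l2 where "l2 = nat (b0 - 1) + l3"
  \<comment> \<open>At the start \<open>p = 0\<close>, but row 1 and the mark of \<open>A\<close>
    already count as met, since the vertex \<open>(1, 1)\<close> may be counted only once.
    Coordinates of kind 2 up to \<open>a0\<close> and of kind 3 up to \<open>b0\<close> occur in no
    weight.\<close>
  have 1: "drops (- used p 1 a0 b0) (nat (a0 - p) + l2)" if "p \<le> a0" "0 \<le> p" for p
    using that
  proof (induction p rule: int_le_induct)
    case (step i)
    have A: "(i, 1) \<in> V.A" using step bounds unfolding V.A_def by auto
    have "nat (a0 - (i - 1)) + l2 = Suc (nat (a0 - i) + l2)" using step by auto
    moreover have "drops (- used (i - 1) 1 a0 b0) (Suc (nat (a0 - i) + l2))"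
      by (rule drops_used[OF step.IH, of "(i, 1)"]) (use A step bounds in \<open>auto simp: V.Z_def keys_W used_def\<close>)
    ultimately show ?case by (simp only:)
  qed (use 2[of 1] bounds in \<open>simp add: l2_def\<close>)
  have "nat (a0 - 0) + l2 = kdim"
    unfolding kdim_def l2_def l3_def l4_def l5_def using bounds by auto
  then show ?thesis using drops_mono[OF 1[of 0], of UNIV] bounds by simp
qed


section \<open>Primes of the quotient and the value of the dimension\<close>

lemma hom_residue: "ring_hom_ring PR (coord_ring P) (residue_class P :: 'k::field mpoly \<Rightarrow> _)"
proof -
  have "(residue_class P :: 'k mpoly \<Rightarrow> _) = (+>\<^bsub>PR\<^esub>) I" unfolding residue_class_def by (rule ext) simp
  then show ?thesis unfolding coord_ring_def using ideal.rcos_ring_hom_ring[OF ideal_I] by simp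
qed

lemma residue_class_eq:
  assumes "f \<in> carrier PR" "g \<in> carrier PR"
  shows "residue_class P f = residue_class P g \<longleftrightarrow> f - g \<in> (I :: 'k::field mpoly set)"
proof -
  interpret R: cring "PR :: 'k mpoly ring" by (rule cring_mpoly_ring)
  show ?thesis
    using R.quotient_eq_iff_same_a_r_cos[OF ideal_I assms] mpoly_ring_minus[OF assms]
    unfolding residue_class_def by simp
qed

lemma carrier_coord_ring: "carrier (coord_ring P) = (residue_class P :: 'k::field mpoly \<Rightarrow> _) ` carrier PR"
  unfolding coord_ring_def FactRing_def residue_class_def A_RCOSETS_def' by auto

text \<open>An ideal above \<open>I\<close> is a union of cosets of \<open>I\<close>, so membership
  may be tested on representatives. The second claim also keeps strict inclusions strict in the
  quotient.\<close>

lemma primeideal_image: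
  fixes J :: "'k::field mpoly set"
  assumes J: "primeideal J PR" and sub: "I \<subseteq> J"
  shows "primeideal (residue_class P ` J) (coord_ring P)"
    and "f \<in> carrier PR \<Longrightarrow> residue_class P f \<in> residue_class P ` J \<longleftrightarrow> f \<in> J"
proof -
  let ?h = "residue_class P :: 'k mpoly \<Rightarrow> _"
  interpret R: cring "PR :: 'k mpoly ring" by (rule cring_mpoly_ring)
  interpret Q: cring "coord_ring P :: 'k mpoly set ring" by (rule cring_coord_ring)
  interpret hom: ring_hom_ring "PR :: 'k mpoly ring" "coord_ring P" ?h by (rule hom_residue)
  note id = primeideal.axioms(1)[OF J]
  note closed = ideal_mpoly_closed[OF id]
  have Jc: "f \<in> carrier PR" if "f \<in> J" for f using ideal.Icarr[OF id that] .
  have mem: "?h f \<in> ?h ` J \<longleftrightarrow> f \<in> J" if f: "f \<in> carrier PR" for f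
  proof
    assume "?h f \<in> ?h ` J"
    then obtain g where g: "g \<in> J" "?h f = ?h g" by auto
    then have "f - g \<in> J" using residue_class_eq[OF f Jc] sub by blast
    then have "(f - g) - (0 - g) \<in> J" using closed(1)[OF _ closed(1)[OF closed(3) g(1)]] by blast
    then show "f \<in> J" by simp
  qed auto
  then show "f \<in> carrier PR \<Longrightarrow> ?h f \<in> ?h ` J \<longleftrightarrow> f \<in> J" .
  have car: "\<exists>f\<in>carrier PR. x = ?h f" if "x \<in> carrier (coord_ring P)" for x
    using that unfolding carrier_coord_ring by blast
  show "primeideal (?h ` J) (coord_ring P)"
  proof (rule primeidealI)
    show "ideal (?h ` J) (coord_ring P)"
    proof (rule idealI)
      show "ring (coord_ring P :: 'k mpoly set ring)" by (rule Q.ring_axioms)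
      show "subgroup (?h ` J) (add_monoid (coord_ring P))"
      proof (rule Q.add.subgroupI)
        show "?h ` J \<subseteq> carrier (coord_ring P)" using Jc carrier_coord_ring by blast
        show "?h ` J \<noteq> {}" using closed(3) by auto
        show "\<ominus>\<^bsub>coord_ring P\<^esub> x \<in> ?h ` J" if x: "x \<in> ?h ` J" for x
        proof -
          obtain f where f: "f \<in> J" "x = ?h f" using x by auto
          then have "\<ominus>\<^bsub>coord_ring P\<^esub> x = ?h (- f)"
            using hom.hom_a_inv[of f] mpoly_ring_a_inv[OF Jc[OF f(1)]] Jc by simp
          moreover have "- f \<in> J" using closed(1)[OF closed(3) f(1)] by simp
          ultimately show ?thesis by simp
        qed
        show "x \<oplus>\<^bsub>coord_ring P\<^esub> y \<in> ?h ` J" if xy: "x \<in> ?h ` J" "y \<in> ?h ` J" for x y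
        proof -
          obtain f g where fg: "f \<in> J" "x = ?h f" "g \<in> J" "y = ?h g" using xy by auto
          then have "x \<oplus>\<^bsub>coord_ring P\<^esub> y = ?h (f + g)"
            using hom.hom_add[of f g] Jc by simp
          moreover have "f - (0 - g) \<in> J" using closed(1)[OF fg(1) closed(1)[OF closed(3) fg(3)]] .
          ultimately show ?thesis by simp
        qed
      qed
      show "x \<otimes>\<^bsub>coord_ring P\<^esub> y \<in> ?h ` J" "y \<otimes>\<^bsub>coord_ring P\<^esub> x \<in> ?h ` J"
        if x: "x \<in> carrier (coord_ring P)" and y: "y \<in> ?h ` J" for x y
      proof -
        obtain f g where fg: "f \<in> carrier PR" "x = ?h f" "g \<in> J" "y = ?h g" using car[OF x] y by auto
        have "?h (g * f) \<in> ?h ` J" using closed(2)[OF fg(3,1)] by blast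
        then show "x \<otimes>\<^bsub>coord_ring P\<^esub> y \<in> ?h ` J" "y \<otimes>\<^bsub>coord_ring P\<^esub> x \<in> ?h ` J"
          using hom.hom_mult[of f g] hom.hom_mult[of g f] Jc[OF fg(3)] fg by (simp_all add: mult.commute)
      qed
    qed
    show "cring (coord_ring P :: 'k mpoly set ring)" by (rule cring_coord_ring)
    show "carrier (coord_ring P) \<noteq> ?h ` J"
    proof
      assume "carrier (coord_ring P) = ?h ` J"
      then have "?h f \<in> ?h ` J" if "f \<in> carrier PR" for f using that carrier_coord_ring by blast
      then have "carrier PR \<subseteq> J" using mem by blast
      then show False using primeideal.I_notcarr[OF J] Jc by blast
    qed
    show "x \<in> ?h ` J \<or> y \<in> ?h ` J"
      if xy: "x \<in> carrier (coord_ring P)" "y \<in> carrier (coord_ring P)" "x \<otimes>\<^bsub>coord_ring P\<^esub> y \<in> ?h ` J" for x y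
    proof -
      obtain f g where fg: "f \<in> carrier PR" "x = ?h f" "g \<in> carrier PR" "y = ?h g"
        using car[OF xy(1)] car[OF xy(2)] by auto
      then have "?h (f * g) \<in> ?h ` J" using xy(3) hom.hom_mult[of f g] by simp
      then have "f * g \<in> J" using mem mpoly_ring_closed(3)[OF fg(1,3)] by blast
      then show ?thesis using primeideal.I_prime[OF J fg(1,3)] fg by auto
    qed
  qed
qed

text \<open>Preimages of primes under the residue map are prime, and a class lying in the next prime
  but not in the present one lifts to a separating polynomial.\<close>

lemma prime_chain_of_quotient:
  fixes C :: "nat \<Rightarrow> 'k::field mpoly set set"
  assumes "\<forall>i\<le>l. primeideal (C i) (coord_ring P)" "\<forall>i<l. C i \<subset> C (Suc i)"
  shows "\<exists>fs. length fs = l \<and> prime_chain (vertex_set P) {f \<in> carrier PR. residue_class P f \<in> C 0} fs"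
  using assms
proof (induction l arbitrary: C)
  interpret hom: ring_hom_ring "PR :: 'k mpoly ring" "coord_ring P" "residue_class P" by (rule hom_residue)
  {
    case 0
    then show ?case using hom.primeideal_vimage[OF cring_mpoly_ring, of "C 0"] by simp
  next
    case (Suc l)
    have "\<forall>i\<le>l. primeideal (C (Suc i)) (coord_ring P)" "\<forall>i<l. C (Suc i) \<subset> C (Suc (Suc i))"
      using Suc.prems by simp_all
    from Suc.IH[OF this] obtain fs where fs: "length fs = l"
      "prime_chain (vertex_set P) {f \<in> carrier PR. residue_class P f \<in> C 1} fs"
      by auto
    have "C 0 \<subset> C 1" using Suc.prems(2) by simp
    then obtain x where x: "x \<in> C 1" "x \<notin> C 0" by blast
    have "primeideal (C 1) (coord_ring P)" using Suc.prems(1) by simp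
    from ideal.Icarr[OF primeideal.axioms(1)[OF this] x(1)] have "x \<in> carrier (coord_ring P)" .
    then obtain f where f: "f \<in> carrier PR" "x = residue_class P f" unfolding carrier_coord_ring by blast
    have "primeideal {f \<in> carrier PR. residue_class P f \<in> C 0} PR"
      using hom.primeideal_vimage[OF cring_mpoly_ring, of "C 0"] Suc.prems(1) by simp
    moreover have "{f \<in> carrier PR. residue_class P f \<in> C 0} \<subseteq> {f \<in> carrier PR. residue_class P f \<in> C 1}"
      using \<open>C 0 \<subset> C 1\<close> by blast
    ultimately have "prime_chain (vertex_set P) {f \<in> carrier PR. residue_class P f \<in> C 0} (f # fs)"
      unfolding prime_chain.simps using f x fs(2) by blast
    then show ?case using fs(1) by (intro exI[of _ "f # fs"]) simp
  }
qed

lemma I_sub_vimage: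
  fixes J :: "'k::field mpoly set set"
  assumes "ideal J (coord_ring P)"
  shows "I \<subseteq> {f \<in> carrier PR. residue_class P f \<in> J}"
proof
  interpret hom: ring_hom_ring "PR :: 'k mpoly ring" "coord_ring P" "residue_class P" by (rule hom_residue)
  fix f :: "'k mpoly" assume f: "f \<in> I"
  then have "f \<in> carrier PR" using ideal.Icarr[OF ideal_I] by blast
  moreover have "(0 :: 'k mpoly) \<in> carrier PR" by (simp add: mem_mpoly_ring)
  ultimately have "residue_class P f = residue_class P 0" using residue_class_eq[of f 0] f by simp
  also have "\<dots> = \<zero>\<^bsub>coord_ring P\<^esub>" using hom.hom_zero by simp
  also have "\<dots> \<in> J" using additive_subgroup.zero_closed[OF ideal.axioms(1)[OF assms]] .
  finally show "f \<in> {f \<in> carrier PR. residue_class P f \<in> J}" using \<open>f \<in> carrier PR\<close> by simp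
qed

lemma krull_dim_coord_ring: "krull_dim (coord_ring P :: 'k::field mpoly set ring) = enat kdim"
proof (rule antisym)
  show "krull_dim (coord_ring P :: 'k mpoly set ring) \<le> enat kdim"
    unfolding krull_dim_def
  proof (rule SUP_least)
    fix l assume "l \<in> {n. \<exists>C :: nat \<Rightarrow> 'k mpoly set set. (\<forall>i\<le>n. primeideal (C i) (coord_ring P)) \<and> (\<forall>i<n. C i \<subset> C (Suc i))}"
    then obtain C :: "nat \<Rightarrow> 'k mpoly set set" where
      C: "\<forall>i\<le>l. primeideal (C i) (coord_ring P)" "\<forall>i<l. C i \<subset> C (Suc i)" by blast
    obtain fs where fs: "length fs = l"
      "prime_chain (vertex_set P) {f \<in> carrier PR. residue_class P f \<in> C 0} fs"
      using prime_chain_of_quotient[OF C] by blast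
    have "ideal (C 0) (coord_ring P)" using C(1) by (auto intro: primeideal.axioms(1))
    then show "enat l \<le> enat kdim" using prime_chain_length[OF fs(2) I_sub_vimage] fs(1) by simp
  qed
  obtain C where C: "\<forall>i\<le>kdim. \<exists>T. C i = (toric_ker T :: 'k mpoly set)" "\<forall>i<kdim. C i \<subset> C (Suc i)"
    using drops_chain[OF drops_kdim] by blast
  let ?C = "\<lambda>i. residue_class P ` C i"
  have prime: "primeideal (C i) PR \<and> I \<subseteq> C i" if "i \<le> kdim" for i
    using C(1) that primeideal_toric_ker I_sub_toric_ker by metis
  have "primeideal (?C i) (coord_ring P)" if "i \<le> kdim" for i
    using primeideal_image(1) prime[OF that] by blast
  moreover have "?C i \<subset> ?C (Suc i)" if i: "i < kdim" for i
  proof -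
    obtain f where f: "f \<in> C (Suc i)" "f \<notin> C i" using C(2) i by blast
    have "f \<in> carrier PR"
      using f(1) prime[of "Suc i"] i ideal.Icarr[OF primeideal.axioms(1)] by auto
    then have "residue_class P f \<notin> ?C i" using primeideal_image(2)[of "C i" f] prime[of i] i f(2) by auto
    then show ?thesis using f(1) C(2) i by blast
  qed
  ultimately show "enat kdim \<le> krull_dim (coord_ring P :: 'k mpoly set ring)"
    unfolding krull_dim_def by (intro SUP_upper) (blast intro: exI[of _ ?C])
qed

lemma is_h_polynomial_rook: "is_h_polynomial TYPE('k::field) P (switching_rook_poly P)"
  unfolding is_h_polynomial_def
  using switching_rook_poly_at_1 krull_dim_coord_ring hilbert_series_rook(2) by blast

end

theorem theorem4p7:
  fixes P :: "cell set"
  assumes "frame_polyomino P"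
  shows "is_h_polynomial TYPE('k::field) P (switching_rook_poly P)"
proof -
  obtain m n a0 ak b0 bk lo hi H where "frame_data m n a0 ak b0 bk lo hi H P"
    using frame_polyomino_data[OF assms] by blast
  then show ?thesis by (rule frame_data.is_h_polynomial_rook)
qed

end
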